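(* There is an algorithm which, given a finite set $\Sigma$, an antimatroid $A$ on $\Sigma$ in a precedence formula representation of length $n$, and a comparison oracle for a permutation $\pi\in\mathcal{P}(A)$, outputs $\pi$ in time $\mathcal{O}(n+\log|\mathcal{P}(A)|)$. (This running time is optimal in the sense that it matches, up to a constant factor, the size of the input plus the information-theoretic lower bound $\log|\mathcal{P}(A)|$ on the worst-case number of comparisons.)
   Context: Model: word RAM; the order of the elements of $\Sigma$ is accessible only through a comparison oracle for $\pi$, which answers queries of the form "does $x$ precede $y$ in $\pi$?" in constant time. Logarithms are base 2 and the constant in $\mathcal{O}(\cdot)$ is absolute. A simple word on $\Sigma$ is a finite sequence of pairwise distinct letters of $\Sigma$; $\tilde\alpha$ denotes the set of letters of a word $\alpha$; $\Sigma^*_{\mathrm{s}}$ is the set of simple words. An antimatroid on $\Sigma$ is a set $A\subseteq\Sigma^*_{\mathrm{s}}$ such that (i) if $\alpha x\in A$ with $\alpha\in\Sigma^*_{\mathrm{s}}$ and $x\in\Sigma\setminus\tilde\alpha$, then $\alpha\in A$; and (ii) for all $\alpha,\beta\in A$ with $\tilde\alpha\not\subseteq\tilde\beta$ there is $x\in\tilde\alpha\setminus\tilde\beta$ with $\beta x\in A$. $\mathcal{P}(A)$ is the set of permutations of $\Sigma$ (simple words containing all letters) that belong to $A$; the antimatroid is full if $\mathcal{P}(A)\ne\emptyset$. A precedence formula representation of a full antimatroid $A$ on $\Sigma$ is a collection $\{F_x\}_{x\in\Sigma}$ where each $F_x$ is a monotone Boolean formula (using only $\vee$, $\wedge$, the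 constants $0,1$, variables and parentheses; no negation) on the variable set $\Sigma\setminus\{x\}$. $F_x$ defines the monotone function $p_x\colon 2^{\Sigma\setminus\{x\}}\to\{0,1\}$ where $p_x(Y)$ is the value of $F_x$ when each variable $y\in Y$ is set to $1$ and every other variable is set to $0$. The represented antimatroid is $A=\{x_1x_2\dots x_k\in\Sigma^*_{\mathrm{s}}\mid\forall i\in[k]:p_{x_i}(\{x_1,\dots,x_{i-1}\})=1\}$. Each formula is given as a linked list of symbols, each variable, operator, constant or parenthesis occupying one machine word; the length $n$ is the total number of symbols of all formulas. *)

theory Defs
  imports Complex_Main
begin

section \<open>Simple words and antimatroids\<close>

definition simple_words :: "'a set \<Rightarrow> 'a list set" where
  "simple_words \<Sigma> = {\<alpha>. distinct \<alpha> \<and> set \<alpha> \<subseteq> \<Sigma>}"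

definition antimatroid :: "'a set \<Rightarrow> 'a list set \<Rightarrow> bool" where
  "antimatroid \<Sigma> A \<longleftrightarrow>
     A \<subseteq> simple_words \<Sigma> \<and>
     (\<forall>\<alpha>\<in>simple_words \<Sigma>. \<forall>x\<in>\<Sigma> - set \<alpha>. \<alpha> @ [x] \<in> A \<longrightarrow> \<alpha> \<in> A) \<and>
     (\<forall>\<alpha>\<in>A. \<forall>\<beta>\<in>A. \<not> set \<alpha> \<subseteq> set \<beta> \<longrightarrow> (\<exists>x\<in>set \<alpha> - set \<beta>. \<beta> @ [x] \<in> A))"

definition permutations_in :: "'a set \<Rightarrow> 'a list set \<Rightarrow> 'a list set" where
  "permutations_in \<Sigma> A = {\<pi>\<in>A. \<pi> \<in> simple_words \<Sigma> \<and> set \<pi> = \<Sigma>}"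

definition full_antimatroid :: "'a set \<Rightarrow> 'a list set \<Rightarrow> bool" where
  "full_antimatroid \<Sigma> A \<longleftrightarrow> antimatroid \<Sigma> A \<and> permutations_in \<Sigma> A \<noteq> {}"

definition precedes :: "'a list \<Rightarrow> 'a \<Rightarrow> 'a \<Rightarrow> bool" where
  "precedes \<pi> x y \<longleftrightarrow> (\<exists>i j. i < j \<and> j < length \<pi> \<and> \<pi> ! i = x \<and> \<pi> ! j = y)"


section \<open>Monotone Boolean formulas\<close>

text \<open>
  A formula is a concrete syntax tree of the usual infix grammar, in which conjunction binds
  stronger than disjunction. Parentheses may be used redundantly, and they are recorded in the
  tree because they count towards the length.
\<close>

datatype 'a formula = Single "'a conjunction" | Disj "'a formula" "'a conjunction"
  and 'a conjunction = Factor "'a atom" | Conj "'a conjunction" "'a atom"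
  and 'a atom = Zero | One | Var 'a | Paren "'a formula"

datatype 'a symbol = SZero | SOne | SOr | SAnd | SLeft | SRight | SVar 'a

primrec symbols :: "'a formula \<Rightarrow> 'a symbol list"
  and symbols_conj :: "'a conjunction \<Rightarrow> 'a symbol list"
  and symbols_atom :: "'a atom \<Rightarrow> 'a symbol list" where
  "symbols (Single c) = symbols_conj c"
| "symbols (Disj f c) = symbols f @ [SOr] @ symbols_conj c"
| "symbols_conj (Factor a) = symbols_atom a"
| "symbols_conj (Conj c a) = symbols_conj c @ [SAnd] @ symbols_atom a"
| "symbols_atom Zero = [SZero]"
| "symbols_atom One = [SOne]"
| "symbols_atom (Var x) = [SVar x]"
| "symbols_atom (Paren f) = [SLeft] @ symbols f @ [SRight]"

definition variables :: "'a formula \<Rightarrow> 'a set" where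
  "variables f = {x. SVar x \<in> set (symbols f)}"

primrec holds :: "'a formula \<Rightarrow> 'a set \<Rightarrow> bool"
  and holds_conj :: "'a conjunction \<Rightarrow> 'a set \<Rightarrow> bool"
  and holds_atom :: "'a atom \<Rightarrow> 'a set \<Rightarrow> bool" where
  "holds (Single c) Y \<longleftrightarrow> holds_conj c Y"
| "holds (Disj f c) Y \<longleftrightarrow> holds f Y \<or> holds_conj c Y"
| "holds_conj (Factor a) Y \<longleftrightarrow> holds_atom a Y"
| "holds_conj (Conj c a) Y \<longleftrightarrow> holds_conj c Y \<and> holds_atom a Y"
| "holds_atom Zero Y \<longleftrightarrow> False"
| "holds_atom One Y \<longleftrightarrow> True"
| "holds_atom (Var x) Y \<longleftrightarrow> x \<in> Y"
| "holds_atom (Paren f) Y \<longleftrightarrow> holds f Y"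

definition precedence_representation :: "'a set \<Rightarrow> ('a \<Rightarrow> 'a formula) \<Rightarrow> 'a list set \<Rightarrow> bool" where
  "precedence_representation \<Sigma> F A \<longleftrightarrow>
     (\<forall>x\<in>\<Sigma>. variables (F x) \<subseteq> \<Sigma> - {x}) \<and>
     A = {\<alpha>\<in>simple_words \<Sigma>. \<forall>i<length \<alpha>. holds (F (\<alpha> ! i)) (set (take i \<alpha>))}"

definition representation_length :: "'a set \<Rightarrow> ('a \<Rightarrow> 'a formula) \<Rightarrow> nat" where
  "representation_length \<Sigma> F = (\<Sum>x\<in>\<Sigma>. length (symbols (F x)))"


section \<open>Word RAM with a comparison oracle\<close>

text \<open>
  Words of \<open>w\<close> bits are the natural numbers below \<open>2 ^ w\<close>; arithmetic is modulo \<open>2 ^ w\<close>.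
  A program is a fixed instruction list, independent of \<open>w\<close>, and mentions only finitely many
  registers. Memory is addressed by words. Every instruction, including an oracle query, costs
  one step; the machine halts when the program counter leaves the program.
\<close>

type_synonym reg = nat

datatype operation = Add | Sub | Mul | Div | BitAnd | BitOr | BitXor | ShiftL | ShiftR

datatype instr =
    Immediate reg nat
  | Copy reg reg
  | Op operation reg reg reg
  | Load reg reg
  | Store reg reg
  | Jump nat
  | JumpLess reg reg nat
  | JumpEq reg reg nat
  | Compare reg reg reg

datatype state = State (counter: nat) (regs: "reg \<Rightarrow> nat") (mem: "nat \<Rightarrow> nat")

fun apply_op :: "nat \<Rightarrow> operation \<Rightarrow> nat \<Rightarrow> nat \<Rightarrow> nat" where
  "apply_op w Add a b = (a + b) mod 2 ^ w"
| "apply_op w Sub a b = (2 ^ w + a - b) mod 2 ^ w"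
| "apply_op w Mul a b = (a * b) mod 2 ^ w"
| "apply_op w Div a b = a div b"
| "apply_op w BitAnd a b = Bit_Operations.and a b"
| "apply_op w BitOr a b = Bit_Operations.or a b"
| "apply_op w BitXor a b = Bit_Operations.xor a b"
| "apply_op w ShiftL a b = (a * 2 ^ b) mod 2 ^ w"
| "apply_op w ShiftR a b = a div 2 ^ b"

fun exec_instr :: "nat \<Rightarrow> (nat \<Rightarrow> nat \<Rightarrow> bool) \<Rightarrow> instr \<Rightarrow> state \<Rightarrow> state" where
  "exec_instr w orc (Immediate d k) (State pc R M) = State (pc + 1) (R(d := k mod 2 ^ w)) M"
| "exec_instr w orc (Copy d a) (State pc R M) = State (pc + 1) (R(d := R a)) M"
| "exec_instr w orc (Op f d a b) (State pc R M) =
     State (pc + 1) (R(d := apply_op w f (R a) (R b))) M"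
| "exec_instr w orc (Load d a) (State pc R M) = State (pc + 1) (R(d := M (R a))) M"
| "exec_instr w orc (Store a b) (State pc R M) = State (pc + 1) R (M(R a := R b))"
| "exec_instr w orc (Jump l) (State pc R M) = State l R M"
| "exec_instr w orc (JumpLess a b l) (State pc R M) = State (if R a < R b then l else pc + 1) R M"
| "exec_instr w orc (JumpEq a b l) (State pc R M) = State (if R a = R b then l else pc + 1) R M"
| "exec_instr w orc (Compare d a b) (State pc R M) =
     State (pc + 1) (R(d := of_bool (orc (R a) (R b)) mod 2 ^ w)) M"

definition halted :: "instr list \<Rightarrow> state \<Rightarrow> bool" where
  "halted P s \<longleftrightarrow> length P \<le> counter s"

definition step :: "nat \<Rightarrow> (nat \<Rightarrow> nat \<Rightarrow> bool) \<Rightarrow> instr list \<Rightarrow> state \<Rightarrow> state" where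
  "step w orc P s = (if halted P s then s else exec_instr w orc (P ! counter s) s)"

definition run :: "nat \<Rightarrow> (nat \<Rightarrow> nat \<Rightarrow> bool) \<Rightarrow> instr list \<Rightarrow> nat \<Rightarrow> state \<Rightarrow> state" where
  "run w orc P t = step w orc P ^^ t"

definition comparisons :: "nat \<Rightarrow> (nat \<Rightarrow> nat \<Rightarrow> bool) \<Rightarrow> instr list \<Rightarrow> nat \<Rightarrow> state \<Rightarrow> nat" where
  "comparisons w orc P t s =
     card {i. i < t \<and> \<not> halted P (run w orc P i s) \<and>
              (\<exists>d a b. P ! counter (run w orc P i s) = Compare d a b)}"


section \<open>Input and output conventions\<close>

text \<open>
  The letters are numbered by an arbitrary enumeration \<open>xs\<close> of the alphabet, and a letter is
  handled by the machine as its number. The numbering is unrelated to the hidden permutation.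
\<close>

definition comparison_oracle :: "'a list \<Rightarrow> 'a list \<Rightarrow> nat \<Rightarrow> nat \<Rightarrow> bool" where
  "comparison_oracle xs \<pi> i j \<longleftrightarrow>
     i < length xs \<and> j < length xs \<and> precedes \<pi> (xs ! i) (xs ! j)"

fun encodes_symbol :: "'a list \<Rightarrow> nat \<Rightarrow> 'a symbol \<Rightarrow> bool" where
  "encodes_symbol xs c SZero \<longleftrightarrow> c = 0"
| "encodes_symbol xs c SOne \<longleftrightarrow> c = 1"
| "encodes_symbol xs c SOr \<longleftrightarrow> c = 2"
| "encodes_symbol xs c SAnd \<longleftrightarrow> c = 3"
| "encodes_symbol xs c SLeft \<longleftrightarrow> c = 4"
| "encodes_symbol xs c SRight \<longleftrightarrow> c = 5"
| "encodes_symbol xs c (SVar x) \<longleftrightarrow> (\<exists>i<length xs. xs ! i = x \<and> c = 6 + i)"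

text \<open>
  A list node at address \<open>p\<close> holds its symbol in cell \<open>p\<close> and the address of the next node in
  cell \<open>p + 1\<close>; the null pointer is \<open>0\<close>. All nodes lie below the address \<open>e\<close>, in any order.
\<close>

fun linked_list :: "'a list \<Rightarrow> nat \<Rightarrow> (nat \<Rightarrow> nat) \<Rightarrow> nat \<Rightarrow> 'a symbol list \<Rightarrow> bool" where
  "linked_list xs e M p [] \<longleftrightarrow> p = 0"
| "linked_list xs e M p (c # cs) \<longleftrightarrow>
     p \<noteq> 0 \<and> p + 1 < e \<and> encodes_symbol xs (M p) c \<and> linked_list xs e M (M (p + 1)) cs"

text \<open>
  Register 0 holds the number of letters, register 1 the address of the table of the list heads
  of the formulas, and register 2 an address \<open>e\<close> from which on at least \<open>free\<close> cells are available
  as working space. Everything else holds arbitrary words.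
\<close>

definition input_state ::
  "nat \<Rightarrow> nat \<Rightarrow> 'a list \<Rightarrow> ('a \<Rightarrow> 'a formula) \<Rightarrow> state \<Rightarrow> bool" where
  "input_state w free xs F s \<longleftrightarrow>
     (\<forall>r. regs s r < 2 ^ w) \<and> (\<forall>a. mem s a < 2 ^ w) \<and>
     counter s = 0 \<and>
     regs s 0 = length xs \<and>
     regs s 1 + length xs \<le> regs s 2 \<and>
     regs s 2 + free \<le> 2 ^ w \<and>
     (\<forall>i<length xs. linked_list xs (regs s 2) (mem s) (mem s (regs s 1 + i)) (symbols (F (xs ! i))))"

text \<open>Register 0 holds the address of an array of the letters of the output, in order.\<close>

definition outputs :: "nat \<Rightarrow> 'a list \<Rightarrow> 'a list \<Rightarrow> state \<Rightarrow> bool" where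
  "outputs w xs \<pi> s \<longleftrightarrow>
     regs s 0 + length \<pi> \<le> 2 ^ w \<and>
     (\<forall>i<length \<pi>. mem s (regs s 0 + i) < length xs \<and> xs ! mem s (regs s 0 + i) = \<pi> ! i)"

end

(*
  The admissible letters are kept in a tournament whose leaves are ordered by insertion time.
  A letter that is removed when d letters have been inserted since its own insertion costs
  O(1 + log d) steps. A gate network evaluates all formulas incrementally in O(n) steps.

  Lower bound on the number of permutations: let lo(x) and hi(x) be the numbers of insertions before
  the insertion and before the removal of x. If every letter x is moved to any point of the interval
  from lo(x) to hi(x), sorting the points gives a permutation in A again, because a letter y that was
  output before x became admissible satisfies hi(y) <= lo(x). At most 4^N choices of points
  lead to the same permutation, hence the sum of the log (hi(x) - lo(x)) is at most
  2N + log |P(A)|.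
*)
theory Submission
  imports Defs "HOL-Library.FuncSet"
begin

section \<open>The information-theoretic lower bound\<close>

text \<open>An ordinary heap would be too slow. With about sqrt N unconstrained letters waiting
  while the others form a chain, its removals may cost N log N in total, although n is of order N
  and log |P(A)| only of order sqrt N log N. The cost of a removal must depend on the age of the
  letter alone; this is why a tournament node over 2^k leaves is put to use only after a delay. With
  the delay, each occupied level has one or two nodes without a parent in use; these counts are the
  digits of the number of insertions in binary notation with digits 1 and 2. An insertion increments
  this counter. Its carry may be long, but the number of ones in the usual binary form of the length
  plus one is a potential that pays for it. The spine, a chain of minima over the parentless nodes,
  needs repair only up to the highest level that changed. Ages are counted in insertions, not in
  outputs, so that the intervals live on the time line of the tournament. The term 2N is harmless
  because every formula has at least one symbol, hence N is at most n.\<close>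

lemma finite_permutations_in: "finite \<Sigma> \<Longrightarrow> finite (permutations_in \<Sigma> A)"
  unfolding permutations_in_def simple_words_def
  by (rule finite_subset[OF _ finite_subset_distinct[of \<Sigma>]]) auto

section \<open>Runs, halting and the number of comparisons\<close>

lemma run_Suc: "run w orc P (Suc t) s = step w orc P (run w orc P t s)"
  by (simp add: run_def)

lemma run_add: "run w orc P (t + u) s = run w orc P u (run w orc P t s)"
  by (simp add: run_def add.commute[of t] funpow_add)

lemma run_halted: "halted P s \<Longrightarrow> run w orc P t s = s"
  by (induction t) (simp_all add: run_def step_def)

lemma run_after_halt:
  assumes "halted P (run w orc P t s)" "t \<le> u"
  shows "run w orc P u s = run w orc P t s"
  using run_add[of w orc P t "u - t" s] run_halted[OF assms(1)] assms(2) by simp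

definition at_comparison :: "instr list \<Rightarrow> state \<Rightarrow> bool" where
  "at_comparison P s \<longleftrightarrow> \<not> halted P s \<and> (\<exists>d a b. P ! counter s = Compare d a b)"

lemma comparisons_Suc:
  "comparisons w orc P (Suc t) s = comparisons w orc P t s + of_bool (at_comparison P (run w orc P t s))"
proof -
  let ?C = "\<lambda>t. {i. i < t \<and> at_comparison P (run w orc P i s)}"
  have "?C (Suc t) = (if at_comparison P (run w orc P t s) then insert t (?C t) else ?C t)"
    by (auto simp: less_Suc_eq)
  moreover have "finite (?C t)" by simp
  ultimately have "card (?C (Suc t)) = card (?C t) + of_bool (at_comparison P (run w orc P t s))"
    by simp
  thus ?thesis by (simp add: comparisons_def at_comparison_def)
qed


text \<open>An adversary keeps the larger half of the orders that are consistent with its answers so far.\<close>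

lemma adversary:
  fixes orc :: "'q \<Rightarrow> nat \<Rightarrow> nat \<Rightarrow> bool"
  assumes "finite Q" "Q \<noteq> {}"
  shows "\<exists>q\<in>Q. card Q \<le> card {r\<in>Q. \<forall>i\<le>t. run w (orc r) P i s = run w (orc q) P i s}
                        * 2 ^ comparisons w (orc q) P t s"
proof -
  \<comment> \<open>Agreement of whole configurations ensures that all remaining orders stand before
    the same instruction with the same register contents.\<close>
  define agree where "agree t q r \<longleftrightarrow> (\<forall>i\<le>t. run w (orc r) P i s = run w (orc q) P i s)" for t q r
  have "\<exists>q\<in>Q. card Q \<le> card {r\<in>Q. agree t q r} * 2 ^ comparisons w (orc q) P t s"
  proof (induction t)
    case 0
    then show ?case using assms by (auto simp: run_def comparisons_def agree_def)
  next
    case (Suc t)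
    then obtain q where q: "q \<in> Q"
      "card Q \<le> card {r\<in>Q. agree t q r} * 2 ^ comparisons w (orc q) P t s" by blast
    define u where "u = run w (orc q) P t s"
    define S where "S = {r\<in>Q. agree t q r}"
    have fin: "finite S" and qS: "q \<in> S" using assms q by (auto simp: S_def agree_def)
    have S: "r \<in> Q" "\<And>i. i \<le> t \<Longrightarrow> run w (orc r) P i s = run w (orc q) P i s"
      "run w (orc r) P (Suc t) s = step w (orc r) P u" if "r \<in> S" for r
      using that by (auto simp: S_def agree_def run_Suc u_def)
    have ext: "agree (Suc t) r r'" if "r \<in> S" "r' \<in> S" "step w (orc r') P u = step w (orc r) P u" for r r'
      using that S by (auto simp: agree_def le_Suc_eq)
    have comps: "comparisons w (orc r) P (Suc t) s
        = comparisons w (orc q) P t s + of_bool (at_comparison P u)" if "r \<in> S" for r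
    proof -
      have "comparisons w (orc r) P t s = comparisons w (orc q) P t s"
        unfolding comparisons_def by (rule arg_cong[where f = card]) (use S[OF that] in auto)
      thus ?thesis using S(2)[OF that, of t] by (simp add: comparisons_Suc u_def)
    qed
    show ?case
    proof (cases "at_comparison P u")
      case False
      \<comment> \<open>Only \<open>Compare\<close> consults the oracle, so any other instruction
        leaves the class of remaining orders intact.\<close>
      hence "step w (orc r) P u = step w (orc q) P u" for r
        by (cases u; cases "P ! counter u") (auto simp: at_comparison_def step_def)
      hence "S \<subseteq> {r\<in>Q. agree (Suc t) q r}"
        using ext[OF qS] S(1) by blast
      hence "card S \<le> card {r\<in>Q. agree (Suc t) q r}"
        using assms by (intro card_mono) auto
      thus ?thesis
        using q False comps[OF qS] by (intro bexI[of _ q]) (auto simp: S_def intro: order_trans mult_le_mono1)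
    next
      case True
      then obtain d a b where cmp: "P ! counter u = Compare d a b" by (auto simp: at_comparison_def)
      define ans where "ans r = orc r (regs u a) (regs u b)" for r
      have same: "ans r = ans r' \<Longrightarrow> step w (orc r) P u = step w (orc r') P u" for r r'
        using cmp by (cases u) (auto simp: step_def ans_def)
      have "S = {r\<in>S. ans r} \<union> {r\<in>S. \<not> ans r}" by auto
      hence "card S = card {r\<in>S. ans r = True} + card {r\<in>S. ans r = False}"
        using fin card_Un_disjoint[of "{r\<in>S. ans r}" "{r\<in>S. \<not> ans r}"] by auto
      hence "card S \<le> 2 * card {r\<in>S. ans r = True} \<or> card S \<le> 2 * card {r\<in>S. ans r = False}"
        by linarith
      \<comment> \<open>\<open>v\<close> is an answer given by at least half of \<open>S\<close>.
        The representative \<open>q\<close> may lie in the other half, hence a new one is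
        chosen.\<close>
      then obtain v where v: "card S \<le> 2 * card {r\<in>S. ans r = v}" by blast
      have "card S > 0" using fin qS card_gt_0_iff by blast
      hence "{r\<in>S. ans r = v} \<noteq> {}" using v by (metis card.empty mult_0_right not_le)
      then obtain q' where q': "q' \<in> S" "ans q' = v" by blast
      have "{r\<in>S. ans r = v} \<subseteq> {r\<in>Q. agree (Suc t) q' r}"
      proof clarify
        fix r assume "r \<in> S" "v = ans r"
        thus "r \<in> Q \<and> agree (Suc t) q' r" using ext[OF q'(1), of r] S(1) same[of r q'] q'(2) by auto
      qed
      hence "card {r\<in>S. ans r = v} \<le> card {r\<in>Q. agree (Suc t) q' r}"
        using assms by (intro card_mono) auto
      hence "card S \<le> 2 * card {r\<in>Q. agree (Suc t) q' r}" using v by linarith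
      hence "card Q \<le> 2 * card {r\<in>Q. agree (Suc t) q' r} * 2 ^ comparisons w (orc q) P t s"
        using order_trans[OF q(2)[folded S_def] mult_le_mono1] by blast
      thus ?thesis
        using comps[OF q'(1)] True S(1)[OF q'(1)] by (intro bexI[of _ q']) (auto simp: mult_ac)
    qed
  qed
  thus ?thesis by (simp add: agree_def)
qed

text \<open>A final configuration outputs at most one permutation. Once all runs have halted, the
  class kept by the adversary is therefore a single order, and \<open>2 ^ comparisons\<close> is at
  least the number of permutations.\<close>

lemma comparison_lower_bound:
  assumes "finite \<Sigma>" "full_antimatroid \<Sigma> A" "distinct xs" "set xs = \<Sigma>"
    and out: "\<And>\<pi>. \<pi> \<in> permutations_in \<Sigma> A \<Longrightarrow> \<exists>t.
          halted P (run w (comparison_oracle xs \<pi>) P t s) \<and>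
          outputs w xs \<pi> (run w (comparison_oracle xs \<pi>) P t s)"
  shows "\<exists>\<pi>\<in>permutations_in \<Sigma> A. \<exists>t.
          halted P (run w (comparison_oracle xs \<pi>) P t s) \<and>
          log 2 (real (card (permutations_in \<Sigma> A)))
            \<le> real (comparisons w (comparison_oracle xs \<pi>) P t s)"
proof -
  let ?Q = "permutations_in \<Sigma> A" and ?run = "\<lambda>\<pi> t. run w (comparison_oracle xs \<pi>) P t s"
  have fin: "finite ?Q" and ne: "?Q \<noteq> {}"
    using assms finite_permutations_in by (auto simp: full_antimatroid_def)
  obtain h where h: "\<And>\<pi>. \<pi> \<in> ?Q \<Longrightarrow> halted P (?run \<pi> (h \<pi>)) \<and> outputs w xs \<pi> (?run \<pi> (h \<pi>))"
    using out by metis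
  \<comment> \<open>Runs for different orders halt at different times; a common time is harmless
    because a halted run no longer changes.\<close>
  define T where "T = Max (h ` ?Q)"
  have T: "halted P (?run \<pi> T) \<and> outputs w xs \<pi> (?run \<pi> T)" if "\<pi> \<in> ?Q" for \<pi>
  proof -
    have "h \<pi> \<le> T" using that fin by (simp add: T_def)
    thus ?thesis using h[OF that] run_after_halt by metis
  qed
  obtain q where q: "q \<in> ?Q"
    "card ?Q \<le> card {r\<in>?Q. \<forall>i\<le>T. ?run r i = ?run q i} * 2 ^ comparisons w (comparison_oracle xs q) P T s"
    by (rule bexE[OF adversary[OF fin ne, where orc = "comparison_oracle xs" and w = w and P = P and t = T and s = s]])
  have len: "length r = card \<Sigma>" if "r \<in> ?Q" for r
    using that distinct_card[of r] by (auto simp: permutations_in_def simple_words_def)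
  have "{r\<in>?Q. \<forall>i\<le>T. ?run r i = ?run q i} \<subseteq> {q}"
  proof clarify
    fix r assume r: "r \<in> ?Q" and *: "\<forall>i\<le>T. ?run r i = ?run q i"
    have "outputs w xs r (?run q T)" "outputs w xs q (?run q T)"
      using T[OF r] T[OF q(1)] * by auto
    thus "r = q" using len[OF r] len[OF q(1)]
      by (intro nth_equalityI) (auto simp: outputs_def)
  qed
  hence "card {r\<in>?Q. \<forall>i\<le>T. ?run r i = ?run q i} \<le> 1"
    using card_mono[of "{q}"] by fastforce
  hence "card ?Q \<le> 2 ^ comparisons w (comparison_oracle xs q) P T s"
    using order_trans[OF q(2) mult_le_mono1[of _ 1]] by simp
  moreover have "card ?Q > 0" using fin ne card_gt_0_iff by blast
  ultimately have "log 2 (real (card ?Q)) \<le> real (comparisons w (comparison_oracle xs q) P T s)"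
    by (intro log2_of_power_le) auto
  thus ?thesis using q(1) T[OF q(1)] by blast
qed

section \<open>A structured language for the word RAM\<close>

text \<open>\<open>Rd\<close> reads the input, which is never overwritten. \<open>Get\<close> and
  \<open>Put\<close> access a field of a numbered record in the working space, so that programs
  never compute addresses there themselves.\<close>

datatype basic =
    Imm reg nat
  | Cpy reg reg
  | Arith operation reg reg reg
  | Cmp reg reg reg
  | Rd reg reg
  | Get reg nat reg
  | Put nat reg reg

datatype test = Less reg reg | Equal reg reg

text \<open>The flag of \<open>While\<close> is the truth value of the test under which the loop
  continues; it replaces a negation of tests.\<close>

datatype cmd =
    Do basic
  | Seq cmd cmd (infixr ";;" 60)
  | If test cmd cmd
  | While bool test cmd

fun holds_test :: "test \<Rightarrow> (nat \<Rightarrow> nat) \<Rightarrow> bool" where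
  "holds_test (Less a b) R \<longleftrightarrow> R a < R b"
| "holds_test (Equal a b) R \<longleftrightarrow> R a = R b"

text \<open>Registers 2 and 5 hold the constants \<open>e\<close> and \<open>e + N\<close>.
  Registers 3 and 4 are scratch space for address computations and invisible to structured
  programs.\<close>

abbreviation writable :: "reg \<Rightarrow> bool" where
  "writable r \<equiv> r \<noteq> 2 \<and> r \<noteq> 3 \<and> r \<noteq> 4 \<and> r \<noteq> 5"

abbreviation readable :: "reg \<Rightarrow> bool" where
  "readable r \<equiv> r \<noteq> 3 \<and> r \<noteq> 4"

fun wf_basic :: "basic \<Rightarrow> bool" where
  "wf_basic (Imm d k) \<longleftrightarrow> writable d"
| "wf_basic (Cpy d a) \<longleftrightarrow> writable d \<and> readable a"
| "wf_basic (Arith f d a b) \<longleftrightarrow> writable d \<and> readable a \<and> readable b"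
| "wf_basic (Cmp d a b) \<longleftrightarrow> writable d \<and> readable a \<and> readable b"
| "wf_basic (Rd d a) \<longleftrightarrow> writable d \<and> readable a"
| "wf_basic (Get d f a) \<longleftrightarrow> writable d \<and> readable a \<and> f < 8"
| "wf_basic (Put f a b) \<longleftrightarrow> readable a \<and> readable b \<and> f < 8"

fun wf_test :: "test \<Rightarrow> bool" where
  "wf_test (Less a b) \<longleftrightarrow> readable a \<and> readable b"
| "wf_test (Equal a b) \<longleftrightarrow> readable a \<and> readable b"

fun wf_cmd :: "cmd \<Rightarrow> bool" where
  "wf_cmd (Do b) \<longleftrightarrow> wf_basic b"
| "wf_cmd (c ;; d) \<longleftrightarrow> wf_cmd c \<and> wf_cmd d"
| "wf_cmd (If b c d) \<longleftrightarrow> wf_test b \<and> wf_cmd c \<and> wf_cmd d"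
| "wf_cmd (While v b c) \<longleftrightarrow> wf_test b \<and> wf_cmd c"

section \<open>Compilation into jump code\<close>

definition address_code :: "nat \<Rightarrow> reg \<Rightarrow> instr list" where
  "address_code f a = (if f = 0 then [Op Add 3 2 a]
     else [Immediate 4 8, Op Mul 3 4 a, Op Add 3 3 5, Immediate 4 f, Op Add 3 3 4])"

fun basic_code :: "basic \<Rightarrow> instr list" where
  "basic_code (Imm d k) = [Immediate d k]"
| "basic_code (Cpy d a) = [Copy d a]"
| "basic_code (Arith f d a b) = [Op f d a b]"
| "basic_code (Cmp d a b) = [Compare d a b]"
| "basic_code (Rd d a) = [Load d a]"
| "basic_code (Get d f a) = address_code f a @ [Load d 3]"
| "basic_code (Put f a b) = address_code f a @ [Store 3 b]"

fun jump_code :: "test \<Rightarrow> nat \<Rightarrow> instr" where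
  "jump_code (Less a b) l = JumpLess a b l"
| "jump_code (Equal a b) l = JumpEq a b l"

primrec code_length :: "cmd \<Rightarrow> nat" where
  "code_length (Do b) = length (basic_code b)"
| "code_length (c ;; d) = code_length c + code_length d"
| "code_length (If b c d) = code_length c + code_length d + 2"
| "code_length (While v b c) = code_length c + 3"

text \<open>Jumps are absolute, so code depends on its position \<open>p\<close>. The else-branch is
  placed first because the conditional jump is taken when the test succeeds.\<close>

primrec code :: "nat \<Rightarrow> cmd \<Rightarrow> instr list" where
  "code p (Do b) = basic_code b"
| "code p (c ;; d) = code p c @ code (p + code_length c) d"
| "code p (If b c d) =
     [jump_code b (p + code_length d + 2)] @ code (p + 1) d @
     [Jump (p + code_length c + code_length d + 2)] @ code (p + code_length d + 2) c"
| "code p (While v b c) =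
     [jump_code b (if v then p + 2 else p + code_length c + 3),
      Jump (if v then p + code_length c + 3 else p + 2)] @
     code (p + 2) c @ [Jump p]"

lemma length_code: "length (code p c) = code_length c"
  by (induction c arbitrary: p) auto

definition code_at :: "instr list \<Rightarrow> nat \<Rightarrow> instr list \<Rightarrow> bool" where
  "code_at P p cs \<longleftrightarrow> p + length cs \<le> length P \<and> (\<forall>i<length cs. P ! (p + i) = cs ! i)"

lemma code_at_append: "code_at P p (cs @ ds) \<longleftrightarrow> code_at P p cs \<and> code_at P (p + length cs) ds"
proof -
  have "(\<forall>i<length cs + length ds. P ! (p + i) = (cs @ ds) ! i) \<longleftrightarrow>
    (\<forall>i<length cs. P ! (p + i) = cs ! i) \<and> (\<forall>i<length ds. P ! (p + length cs + i) = ds ! i)"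
    (is "?L \<longleftrightarrow> ?R")
  proof
    assume *: ?L
    show ?R
    proof (intro conjI allI impI)
      fix i assume "i < length ds"
      thus "P ! (p + length cs + i) = ds ! i" using *[rule_format, of "length cs + i"]
        by (simp add: add.assoc nth_append)
    qed (use * in \<open>auto simp: nth_append\<close>)
  next
    assume *: ?R
    show ?L
    proof (intro allI impI)
      fix i assume "i < length cs + length ds"
      thus "P ! (p + i) = (cs @ ds) ! i"
        using *[THEN conjunct1, rule_format, of i] *[THEN conjunct2, rule_format, of "i - length cs"]
        by (cases "i < length cs") (auto simp: nth_append)
    qed
  qed
  thus ?thesis by (auto simp: code_at_def)
qed

lemma code_at_Cons: "code_at P p (c # cs) \<longleftrightarrow> p < length P \<and> P ! p = c \<and> code_at P (Suc p) cs"
  using code_at_append[of P p "[c]" cs] by (auto simp: code_at_def)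

lemma run_0: "run w orc P 0 s = s"
  by (simp add: run_def)

section \<open>Semantics of commands over fields, with a step count\<close>

locale machine =
  fixes w :: nat and orc :: "nat \<Rightarrow> nat \<Rightarrow> bool" and N L e :: nat and I :: "nat \<Rightarrow> nat"
begin

fun field_size :: "nat \<Rightarrow> nat" where
  "field_size f = (if f = 0 then N else L)"

text \<open>Under these conditions machine arithmetic coincides with arithmetic of natural numbers,
  so that programs are verified without reduction modulo \<open>2 ^ w\<close>. Bit operations and
  shifts are rejected.\<close>

fun arith_ok :: "operation \<Rightarrow> nat \<Rightarrow> nat \<Rightarrow> bool" where
  "arith_ok Add a b \<longleftrightarrow> a + b < 2 ^ w"
| "arith_ok Sub a b \<longleftrightarrow> b \<le> a"
| "arith_ok Mul a b \<longleftrightarrow> a * b < 2 ^ w"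
| "arith_ok Div a b \<longleftrightarrow> True"
| "arith_ok _ a b \<longleftrightarrow> False"

fun arith :: "operation \<Rightarrow> nat \<Rightarrow> nat \<Rightarrow> nat" where
  "arith Add a b = a + b"
| "arith Sub a b = a - b"
| "arith Mul a b = a * b"
| "arith Div a b = a div b"
| "arith _ a b = 0"

fun ok :: "basic \<Rightarrow> (nat \<Rightarrow> nat) \<Rightarrow> bool" where
  "ok (Imm d k) R \<longleftrightarrow> k < 2 ^ w"
| "ok (Cpy d a) R \<longleftrightarrow> True"
| "ok (Arith f d a b) R \<longleftrightarrow> arith_ok f (R a) (R b)"
| "ok (Cmp d a b) R \<longleftrightarrow> True"
| "ok (Rd d a) R \<longleftrightarrow> R a < e"
| "ok (Get d f a) R \<longleftrightarrow> R a < field_size f"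
| "ok (Put f a b) R \<longleftrightarrow> R a < field_size f"

fun new_regs :: "basic \<Rightarrow> (nat \<Rightarrow> nat) \<Rightarrow> (nat \<Rightarrow> nat \<Rightarrow> nat) \<Rightarrow> (nat \<Rightarrow> nat)" where
  "new_regs (Imm d k) R G = R(d := k)"
| "new_regs (Cpy d a) R G = R(d := R a)"
| "new_regs (Arith f d a b) R G = R(d := arith f (R a) (R b))"
| "new_regs (Cmp d a b) R G = R(d := of_bool (orc (R a) (R b)))"
| "new_regs (Rd d a) R G = R(d := I (R a))"
| "new_regs (Get d f a) R G = R(d := G f (R a))"
| "new_regs (Put f a b) R G = R"

fun new_fields :: "basic \<Rightarrow> (nat \<Rightarrow> nat) \<Rightarrow> (nat \<Rightarrow> nat \<Rightarrow> nat) \<Rightarrow> (nat \<Rightarrow> nat \<Rightarrow> nat)" where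
  "new_fields (Put f a b) R G = G(f := (G f)(R a := R b))"
| "new_fields _ R G = G"

text \<open>The last component of a configuration is an upper bound on the number of steps made so far.\<close>

inductive exec ::
  "cmd \<Rightarrow> (nat \<Rightarrow> nat) \<Rightarrow> (nat \<Rightarrow> nat \<Rightarrow> nat) \<Rightarrow> nat \<Rightarrow>
   (nat \<Rightarrow> nat) \<Rightarrow> (nat \<Rightarrow> nat \<Rightarrow> nat) \<Rightarrow> nat \<Rightarrow> bool" where
  Do: "ok b R \<Longrightarrow> exec (Do b) R G t (new_regs b R G) (new_fields b R G) (t + 6)"
| Seq: "exec c R G t R' G' t' \<Longrightarrow> exec d R' G' t' R'' G'' t'' \<Longrightarrow> exec (c ;; d) R G t R'' G'' t''"
| IfT: "holds_test b R \<Longrightarrow> exec c R G (t + 2) R' G' t' \<Longrightarrow> exec (If b c d) R G t R' G' t'"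
| IfF: "\<not> holds_test b R \<Longrightarrow> exec d R G (t + 2) R' G' t' \<Longrightarrow> exec (If b c d) R G t R' G' t'"
| WhileF: "holds_test b R \<noteq> v \<Longrightarrow> exec (While v b c) R G t R G (t + 2)"
| WhileT: "holds_test b R = v \<Longrightarrow> exec c R G (t + 3) R' G' t' \<Longrightarrow>
    exec (While v b c) R' G' t' R'' G'' t'' \<Longrightarrow> exec (While v b c) R G t R'' G'' t''"

text \<open>The existential quantifier demands a terminating execution. Since the counter is an
  argument of \<open>Q\<close>, running time is part of ordinary postconditions.\<close>

definition wp :: "cmd \<Rightarrow> ((nat \<Rightarrow> nat) \<Rightarrow> (nat \<Rightarrow> nat \<Rightarrow> nat) \<Rightarrow> nat \<Rightarrow> bool) \<Rightarrow>
    (nat \<Rightarrow> nat) \<Rightarrow> (nat \<Rightarrow> nat \<Rightarrow> nat) \<Rightarrow> nat \<Rightarrow> bool" where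
  "wp c Q R G t \<longleftrightarrow> (\<exists>R' G' t'. exec c R G t R' G' t' \<and> Q R' G' t')"

inductive_cases exec_DoE: "exec (Do b) R G t R' G' t'"
inductive_cases exec_SeqE: "exec (c ;; d) R G t R' G' t'"
inductive_cases exec_IfE: "exec (If b c d) R G t R' G' t'"

lemma wp_Do: "wp (Do b) Q R G t \<longleftrightarrow> ok b R \<and> Q (new_regs b R G) (new_fields b R G) (t + 6)"
  unfolding wp_def by (auto intro: exec.Do elim!: exec_DoE)

lemma wp_Seq: "wp (c ;; d) Q R G t \<longleftrightarrow> wp c (wp d Q) R G t"
  unfolding wp_def by (blast intro: exec.Seq elim!: exec_SeqE)

lemma wp_If: "wp (If b c d) Q R G t \<longleftrightarrow>
    (if holds_test b R then wp c Q R G (t + 2) else wp d Q R G (t + 2))"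
  unfolding wp_def
  by (auto intro: exec.IfT[simplified] exec.IfF[simplified] elim!: exec_IfE)

lemmas wp_simps = wp_Do wp_Seq wp_If

text \<open>The measure serves termination only. The number of steps is controlled by the invariant
  \<open>J\<close>, which sees the counter and can express amortised bounds.\<close>

lemma wp_While:
  fixes m :: "(nat \<Rightarrow> nat) \<Rightarrow> (nat \<Rightarrow> nat \<Rightarrow> nat) \<Rightarrow> nat"
  assumes "J R G t"
    and "\<And>R G t. J R G t \<Longrightarrow> holds_test b R = v \<Longrightarrow>
           wp c (\<lambda>R' G' t'. J R' G' t' \<and> m R' G' < m R G) R G (t + 3)"
    and "\<And>R G t. J R G t \<Longrightarrow> holds_test b R \<noteq> v \<Longrightarrow> Q R G (t + 2)"
  shows "wp (While v b c) Q R G t"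
  using assms(1)
proof (induction "m R G" arbitrary: R G t rule: less_induct)
  case less
  show ?case
  proof (cases "holds_test b R = v")
    case True
    then obtain R' G' t' where 1: "exec c R G (t + 3) R' G' t'" "J R' G' t'" "m R' G' < m R G"
      using assms(2)[OF less.prems True] unfolding wp_def by blast
    from less.hyps[OF 1(3,2)] show ?thesis
      using exec.WhileT[OF True 1(1)] unfolding wp_def by blast
  next
    case False
    thus ?thesis using assms(3)[OF less.prems False] exec.WhileF[OF False] unfolding wp_def by blast
  qed
qed

section \<open>Memory layout and simulation by the machine\<close>

definition address :: "nat \<Rightarrow> nat \<Rightarrow> nat" where
  "address f i = (if f = 0 then e + i else e + N + 8 * i + f)"

definition cell :: "nat \<Rightarrow> nat \<Rightarrow> bool" where
  "cell f i \<longleftrightarrow> f < 8 \<and> i < field_size f"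

text \<open>Field 0 has stride one because the output must be an array; it fills the
  \<open>N\<close> words from \<open>e\<close> on. Behind it lie records of eight words, where
  \<open>8 * i + f\<close> determines both \<open>i\<close> and \<open>f\<close> by division with
  remainder.\<close>

lemma address_inject:
  assumes "cell f i" "cell g j"
  shows "address f i = address g j \<longleftrightarrow> f = g \<and> i = j"
proof -
  have "8 * i + f = 8 * j + g \<Longrightarrow> f = g \<and> i = j" if "f < 8" "g < 8"
    using that by presburger
  thus ?thesis using assms by (auto simp: address_def cell_def split: if_splits)
qed

text \<open>\<open>R\<close> and \<open>G\<close> form the abstract state, \<open>R\<^sub>0\<close>
  and \<open>M\<close> the machine state. Comparing only readable registers lets address
  computations disturb registers 3 and 4. The bounds by \<open>2 ^ w\<close> are carried along
  because abstract values are arbitrary natural numbers.\<close>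

definition simulates :: "(nat \<Rightarrow> nat) \<Rightarrow> (nat \<Rightarrow> nat \<Rightarrow> nat) \<Rightarrow> (nat \<Rightarrow> nat) \<Rightarrow> (nat \<Rightarrow> nat) \<Rightarrow> bool" where
  "simulates R G R\<^sub>0 M \<longleftrightarrow>
     (\<forall>r. readable r \<longrightarrow> R\<^sub>0 r = R r) \<and> R 2 = e \<and> R 5 = e + N \<and>
     (\<forall>r. R\<^sub>0 r < 2 ^ w) \<and> (\<forall>a. M a < 2 ^ w) \<and>
     (\<forall>a<e. M a = I a) \<and> (\<forall>f i. cell f i \<longrightarrow> M (address f i) = G f i)"

lemma simulates_bounds:
  assumes "simulates R G R\<^sub>0 M"
  shows "readable r \<Longrightarrow> R r < 2 ^ w" "a < e \<Longrightarrow> I a < 2 ^ w" "cell f i \<Longrightarrow> G f i < 2 ^ w"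
  using assms unfolding simulates_def by metis+

lemma simulates_upd:
  assumes "simulates R G R\<^sub>0 M" "writable d" "v < 2 ^ w"
  shows "simulates (R(d := v)) G (R\<^sub>0(d := v)) M"
  using assms unfolding simulates_def by auto

lemma apply_op_arith:
  assumes "a < 2 ^ w" "b < 2 ^ w" "arith_ok f a b"
  shows "apply_op w f a b = arith f a b \<and> arith f a b < 2 ^ w"
proof (cases f)
  case Sub
  hence b: "b \<le> a" using assms(3) by simp
  have l: "a - b < 2 ^ w" using assms(1) by linarith
  have "2 ^ w + a - b = (a - b) + 2 ^ w" using b by linarith
  hence "(2 ^ w + a - b) mod 2 ^ w = a - b" using l by (simp only: mod_add_self2 mod_less)
  thus ?thesis using Sub l by (simp only: apply_op.simps arith.simps simp_thms)
next
  case Div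
  have "a div b < 2 ^ w" using assms(1) div_le_dividend order.strict_trans1 by blast
  thus ?thesis using Div by simp
qed (use assms in auto)

lemma simulates_tmp:
  assumes "simulates R G R\<^sub>0 M" "\<not> readable r" "v < 2 ^ w"
  shows "simulates R G (R\<^sub>0(r := v)) M"
  using assms unfolding simulates_def by auto

lemma step_at: "p < length P \<Longrightarrow> P ! p = i \<Longrightarrow>
    step w orc P (State p R M) = exec_instr w orc i (State p R M)"
  by (auto simp: step_def halted_def)

lemma run_Suc': "run w orc P (Suc n) s = run w orc P n (step w orc P s)"
  by (simp add: run_def funpow_swap1)

lemma run_steps: "run w orc P (Suc 0) s = step w orc P s" "run w orc P 2 s = step w orc P (step w orc P s)"
  by (simp_all add: run_def numeral_eq_Suc)

text \<open>Since \<open>8 * R a + f\<close> is below \<open>8 * L\<close>, the bound on the working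
  space keeps the computed address from wrapping around.\<close>

lemma run_address_code:
  assumes "code_at P p (address_code f a @ cs)" "simulates R G R\<^sub>0 M" "readable a" "cell f (R a)"
    "e + N + 8 * L \<le> 2 ^ w" "8 < (2::nat) ^ w"
  obtains R\<^sub>1 t where "t \<le> 5"
    "run w orc P t (State p R\<^sub>0 M) = State (p + length (address_code f a)) R\<^sub>1 M"
    "simulates R G R\<^sub>1 M" "R\<^sub>1 3 = address f (R a)"
proof (cases "f = 0")
  case True
  have r: "R\<^sub>0 2 = e" "R\<^sub>0 a = R a" using assms(2,3) by (auto simp: simulates_def)
  have l: "e + R a < 2 ^ w" using assms(4,5) True by (auto simp: cell_def)
  have "P ! p = Op Add 3 2 a" "p < length P"
    using assms(1) True by (auto simp: address_code_def code_at_Cons)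
  hence "run w orc P 1 (State p R\<^sub>0 M) = State (p + length (address_code f a)) (R\<^sub>0(3 := e + R a)) M"
    using True r l by (simp add: address_code_def run_steps run_0 step_at)
  thus ?thesis
    using simulates_tmp[OF assms(2), of 3 "e + R a"] l True by (intro that[of 1 "R\<^sub>0(3 := e + R a)"]) (auto simp: address_def)
next
  case False
  have r: "R\<^sub>0 5 = e + N" "R\<^sub>0 a = R a" using assms(2,3) by (auto simp: simulates_def)
  have b: "R a < L" "f < 8" using assms(4) False by (auto simp: cell_def)
  hence l: "8 * R a + (e + N) + f < 2 ^ w" using assms(5) by linarith
  define x where "x = 8 * R a + (e + N) + f"
  have m: "8 mod 2 ^ w = (8::nat)" "f mod 2 ^ w = f" "8 * R a mod 2 ^ w = 8 * R a"
    "(8 * R a + (e + N)) mod 2 ^ w = 8 * R a + (e + N)"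
    "(8 * R a + (e + N) + f) mod 2 ^ w = x"
    using assms(6) b l order.strict_trans[OF b(2) assms(6)] by (simp_all add: x_def)
  have c: "address_code f a = [Immediate 4 8, Op Mul 3 4 a, Op Add 3 3 5, Immediate 4 f, Op Add 3 3 4]"
    using False by (simp add: address_code_def)
  have at: "P ! p = Immediate 4 8" "P ! Suc p = Op Mul 3 4 a" "P ! Suc (Suc p) = Op Add 3 3 5"
    "P ! Suc (Suc (Suc p)) = Immediate 4 f" "P ! Suc (Suc (Suc (Suc p))) = Op Add 3 3 4"
    "Suc (Suc (Suc (Suc p))) < length P"
    using assms(1) unfolding c by (auto simp: code_at_Cons)
  let ?R1 = "R\<^sub>0(4 := 8)" let ?R2 = "?R1(3 := 8 * R a)" let ?R3 = "?R2(3 := 8 * R a + (e + N))"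
  let ?R4 = "?R3(4 := f)" let ?R5 = "?R4(3 := x)"
  have "step w orc P (State p R\<^sub>0 M) = State (Suc p) ?R1 M"
    using at m by (simp add: step_at)
  moreover have "step w orc P (State (Suc p) ?R1 M) = State (Suc (Suc p)) ?R2 M"
    using at m r assms(3) by (simp add: step_at)
  moreover have "step w orc P (State (Suc (Suc p)) ?R2 M) = State (Suc (Suc (Suc p))) ?R3 M"
    using at m r by (simp add: step_at)
  moreover have "step w orc P (State (Suc (Suc (Suc p))) ?R3 M) = State (Suc (Suc (Suc (Suc p)))) ?R4 M"
    using at m by (simp add: step_at)
  moreover have "step w orc P (State (Suc (Suc (Suc (Suc p)))) ?R4 M) = State (Suc (Suc (Suc (Suc (Suc p))))) ?R5 M"
    using at m by (simp add: step_at)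
  ultimately have "run w orc P 5 (State p R\<^sub>0 M) = State (p + length (address_code f a)) ?R5 M"
    unfolding c by (simp add: numeral_eq_Suc run_Suc' run_0)
  moreover have "simulates R G ?R5 M"
    using assms(2,6) b l by (intro simulates_tmp) (auto simp: x_def)
  ultimately show ?thesis
    using False by (intro that[of 5 ?R5]) (auto simp: address_def x_def)
qed

lemma run_basic:
  assumes "code_at P p (basic_code b)" "simulates R G R\<^sub>0 M" "wf_basic b" "ok b R"
    "e + N + 8 * L \<le> 2 ^ w" "8 < (2::nat) ^ w"
  obtains R\<^sub>1 M\<^sub>1 t where "t \<le> 6"
    "run w orc P t (State p R\<^sub>0 M) = State (p + length (basic_code b)) R\<^sub>1 M\<^sub>1"
    "simulates (new_regs b R G) (new_fields b R G) R\<^sub>1 M\<^sub>1"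
proof (cases b)
  case (Imm d k)
  with assms show ?thesis
    by (intro that[of 1 "R\<^sub>0(d := k)" M])
      (auto simp: code_at_Cons run_steps run_0 step_at intro: simulates_upd)
next
  case (Cpy d a)
  have v: "R\<^sub>0 a = R a" "R a < 2 ^ w" using assms Cpy simulates_bounds(1)[OF assms(2), of a] by (auto simp: simulates_def)
  have "simulates (R(d := R a)) G (R\<^sub>0(d := R a)) M"
    by (rule simulates_upd) (use assms Cpy v in auto)
  moreover have "run w orc P 1 (State p R\<^sub>0 M) = State (p + length (basic_code b)) (R\<^sub>0(d := R a)) M"
    using assms(1) Cpy v by (simp add: code_at_Cons run_steps step_at)
  ultimately show ?thesis using Cpy by (intro that[of 1 "R\<^sub>0(d := R a)" M]) simp_all
next
  case (Arith f d a b)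
  have bd: "R a < 2 ^ w" "R b < 2 ^ w" "R\<^sub>0 a = R a" "R\<^sub>0 b = R b"
    using assms(2,3) Arith simulates_bounds(1)[OF assms(2)] by (simp_all add: simulates_def)
  have *: "apply_op w f (R a) (R b) = arith f (R a) (R b)" "arith f (R a) (R b) < 2 ^ w"
    using apply_op_arith[of "R a" "R b" f] assms(4) Arith bd by auto
  have "simulates (R(d := arith f (R a) (R b))) G (R\<^sub>0(d := arith f (R a) (R b))) M"
    by (rule simulates_upd) (use assms(2,3) Arith bd * in simp_all)
  moreover have "run w orc P 1 (State p R\<^sub>0 M) = State (p + length [()]) (R\<^sub>0(d := arith f (R a) (R b))) M"
    using assms(1) Arith bd * by (simp add: code_at_Cons run_steps step_at)
  ultimately show ?thesis using Arith by (intro that[of 1 "R\<^sub>0(d := arith f (R a) (R b))" M]) simp_all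
next
  case (Cmp d a b)
  have one: "1 < (2::nat) ^ w" using assms(6) by linarith
  have m: "of_bool x mod (2::nat) ^ w = of_bool x" "of_bool x < (2::nat) ^ w" for x
    using one by (simp_all split: split_of_bool)
  have r: "R\<^sub>0 a = R a" "R\<^sub>0 b = R b" using assms(2,3) Cmp by (simp_all add: simulates_def)
  have "simulates (R(d := of_bool (orc (R a) (R b)))) G (R\<^sub>0(d := of_bool (orc (R a) (R b)))) M"
    by (rule simulates_upd) (use assms(2,3) Cmp m r in simp_all)
  moreover have "run w orc P 1 (State p R\<^sub>0 M) = State (p + length [()]) (R\<^sub>0(d := of_bool (orc (R a) (R b)))) M"
    using assms(1) Cmp m r by (simp add: code_at_Cons run_steps step_at)
  ultimately show ?thesis using Cmp by (intro that[of 1 "R\<^sub>0(d := of_bool (orc (R a) (R b)))" M]) simp_all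
next
  case (Rd d a)
  have "R\<^sub>0 a = R a" "M (R a) = I (R a)" "I (R a) < 2 ^ w"
    using assms Rd simulates_bounds(2)[OF assms(2), of "R a"] by (auto simp: simulates_def)
  with assms Rd show ?thesis
    by (intro that[of 1 "R\<^sub>0(d := I (R a))" M])
      (auto simp: code_at_Cons run_steps run_0 step_at intro: simulates_upd)
next
  case (Get d f a)
  have c: "cell f (R a)" using Get assms by (auto simp: cell_def)
  obtain R\<^sub>1 t where 1: "t \<le> 5"
    "run w orc P t (State p R\<^sub>0 M) = State (p + length (address_code f a)) R\<^sub>1 M"
    "simulates R G R\<^sub>1 M" "R\<^sub>1 3 = address f (R a)"
    by (rule run_address_code[of P p f a "[Load d 3]" R G R\<^sub>0 M]) (use assms Get c in auto)
  have "M (address f (R a)) = G f (R a)" "G f (R a) < 2 ^ w"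
    using 1 c simulates_bounds(3)[OF 1(3) c] by (auto simp: simulates_def)
  hence "simulates (R(d := G f (R a))) G (R\<^sub>1(d := G f (R a))) M"
    "run w orc P (t + 1) (State p R\<^sub>0 M) = State (p + length (basic_code b)) (R\<^sub>1(d := G f (R a))) M"
    using 1 assms Get
    by (auto simp: run_Suc code_at_append code_at_Cons step_at intro: simulates_upd)
  with 1 Get show ?thesis by (intro that[of "t + 1" "R\<^sub>1(d := G f (R a))" M]) auto
next
  case (Put f a v)
  have c: "cell f (R a)" using Put assms by (auto simp: cell_def)
  obtain R\<^sub>1 t where 1: "t \<le> 5"
    "run w orc P t (State p R\<^sub>0 M) = State (p + length (address_code f a)) R\<^sub>1 M"
    "simulates R G R\<^sub>1 M" "R\<^sub>1 3 = address f (R a)"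
    by (rule run_address_code[of P p f a "[Store 3 v]" R G R\<^sub>0 M]) (use assms Put c in auto)
  have r: "R\<^sub>1 v = R v" "R v < 2 ^ w"
    using 1(3) assms(3) Put simulates_bounds(1)[OF 1(3), of v] by (auto simp: simulates_def)
  let ?M = "M(address f (R a) := R v)"
  have "e \<le> address f (R a)" by (simp add: address_def)
  hence "\<forall>x<e. ?M x = I x" using 1(3) by (auto simp: simulates_def)
  moreover have "\<forall>g i. cell g i \<longrightarrow> ?M (address g i) = (G(f := (G f)(R a := R v))) g i"
    using 1(3) address_inject[OF _ c] by (auto simp: simulates_def)
  ultimately have "simulates R (G(f := (G f)(R a := R v))) R\<^sub>1 ?M"
    using 1(3) r unfolding simulates_def by auto
  moreover have "run w orc P (t + 1) (State p R\<^sub>0 M) = State (p + length (basic_code b)) R\<^sub>1 ?M"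
    using 1 assms Put r
    by (auto simp: run_Suc code_at_append code_at_Cons step_at)
  ultimately show ?thesis using 1 Put by (intro that[of "t + 1" R\<^sub>1 ?M]) auto
qed

lemma holds_test_sim:
  "simulates R G R\<^sub>0 M \<Longrightarrow> wf_test b \<Longrightarrow> holds_test b R\<^sub>0 = holds_test b R"
  by (cases b) (auto simp: simulates_def)

lemma step_jump_code: "p < length P \<Longrightarrow> P ! p = jump_code b l \<Longrightarrow>
    step w orc P (State p R M) = State (if holds_test b R then l else p + 1) R M"
  by (cases b) (auto simp: step_at)

text \<open>By induction on the execution, the machine makes at most as many steps as the abstract
  counter advances. The position and the machine state vary in the induction because subcommands sit
  at different offsets and a loop re-enters its own code.\<close>

lemma exec_code:
  assumes "exec c R G t R' G' t'" "e + N + 8 * L \<le> 2 ^ w" "8 < (2::nat) ^ w" "wf_cmd c"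
    "code_at P p (code p c)" "simulates R G R\<^sub>0 M"
  shows "\<exists>u R\<^sub>1 M\<^sub>1. t + u \<le> t' \<and>
    run w orc P u (State p R\<^sub>0 M) = State (p + code_length c) R\<^sub>1 M\<^sub>1 \<and> simulates R' G' R\<^sub>1 M\<^sub>1"
  using assms
proof (induction arbitrary: p R\<^sub>0 M rule: exec.induct)
  case (Do b R G t)
  obtain R\<^sub>1 M\<^sub>1 u where "u \<le> 6"
    "run w orc P u (State p R\<^sub>0 M) = State (p + length (basic_code b)) R\<^sub>1 M\<^sub>1"
    "simulates (new_regs b R G) (new_fields b R G) R\<^sub>1 M\<^sub>1"
    by (rule run_basic[of P p b R G R\<^sub>0 M]) (use Do in auto)
  thus ?case by (intro exI[of _ u] exI[of _ R\<^sub>1] exI[of _ M\<^sub>1]) auto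
next
  case (Seq c R G t R' G' t' d R'' G'' t'')
  have at: "code_at P p (code p c)" "code_at P (p + code_length c) (code (p + code_length c) d)"
    using Seq.prems by (auto simp: code_at_append length_code)
  obtain u R\<^sub>1 M\<^sub>1 where 1: "t + u \<le> t'"
    "run w orc P u (State p R\<^sub>0 M) = State (p + code_length c) R\<^sub>1 M\<^sub>1" "simulates R' G' R\<^sub>1 M\<^sub>1"
    using Seq.IH(1)[of p R\<^sub>0 M] Seq.prems at by auto
  obtain v R\<^sub>2 M\<^sub>2 where 2: "t' + v \<le> t''"
    "run w orc P v (State (p + code_length c) R\<^sub>1 M\<^sub>1) = State (p + code_length c + code_length d) R\<^sub>2 M\<^sub>2"
    "simulates R'' G'' R\<^sub>2 M\<^sub>2"
    using Seq.IH(2)[of "p + code_length c" R\<^sub>1 M\<^sub>1] Seq.prems at 1 by auto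
  show ?case
    by (rule exI[of _ "u + v"], rule exI[of _ R\<^sub>2], rule exI[of _ M\<^sub>2])
      (use 1 2 in \<open>auto simp: run_add add.assoc\<close>)
next
  case (IfT b R c G t R' G' t' d)
  let ?q = "p + code_length d + 2"
  have at: "p < length P" "P ! p = jump_code b ?q" "code_at P ?q (code ?q c)"
    using IfT.prems by (auto simp: code_at_append code_at_Cons length_code)
  obtain u R\<^sub>1 M\<^sub>1 where 1: "t + 2 + u \<le> t'"
    "run w orc P u (State ?q R\<^sub>0 M) = State (?q + code_length c) R\<^sub>1 M\<^sub>1" "simulates R' G' R\<^sub>1 M\<^sub>1"
    using IfT.IH[of ?q R\<^sub>0 M] IfT.prems at by auto
  have "holds_test b R\<^sub>0" using IfT holds_test_sim[of R G R\<^sub>0 M b] by auto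
  thus ?case
    by (intro exI[of _ "Suc u"] exI[of _ R\<^sub>1] exI[of _ M\<^sub>1])
      (use 1 at in \<open>auto simp: run_Suc' step_jump_code add_ac\<close>)
next
  case (IfF b R d G t R' G' t' c)
  let ?q = "Suc p + code_length d" and ?r = "p + code_length c + code_length d + 2"
  have at: "p < length P" "P ! p = jump_code b (p + code_length d + 2)" "code_at P (Suc p) (code (Suc p) d)"
    "?q < length P" "P ! ?q = Jump ?r"
    using IfF.prems by (auto simp: code_at_append code_at_Cons length_code)
  obtain u R\<^sub>1 M\<^sub>1 where 1: "t + 2 + u \<le> t'"
    "run w orc P u (State (Suc p) R\<^sub>0 M) = State ?q R\<^sub>1 M\<^sub>1" "simulates R' G' R\<^sub>1 M\<^sub>1"
    using IfF.IH[of "Suc p" R\<^sub>0 M] IfF.prems at by auto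
  have f: "\<not> holds_test b R\<^sub>0" using IfF holds_test_sim[of R G R\<^sub>0 M b] by auto
  have "run w orc P (1 + u + 1) (State p R\<^sub>0 M) = State ?r R\<^sub>1 M\<^sub>1"
    unfolding run_add by (use f 1 at in \<open>simp add: run_steps run_0 step_jump_code step_at\<close>)
  thus ?case
    by (intro exI[of _ "1 + u + 1"] exI[of _ R\<^sub>1] exI[of _ M\<^sub>1]) (use 1 in \<open>auto simp: add_ac\<close>)
next
  case (WhileF b R v c G t)
  let ?r = "p + code_length c + 3"
  have at: "Suc p < length P" "P ! p = jump_code b (if v then p + 2 else ?r)"
    "P ! (Suc p) = Jump (if v then ?r else p + 2)"
    using WhileF.prems by (auto simp: code_at_append code_at_Cons length_code)
  have f: "holds_test b R\<^sub>0 = (\<not> v)" using WhileF holds_test_sim[of R G R\<^sub>0 M b] by auto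
  show ?case
  proof (cases v)
    case True
    thus ?thesis
      by (intro exI[of _ "2"] exI[of _ R\<^sub>0] exI[of _ M])
        (use f at WhileF in \<open>auto simp: run_steps run_0 step_jump_code step_at\<close>)
  next
    case False
    thus ?thesis
      by (intro exI[of _ "1"] exI[of _ R\<^sub>0] exI[of _ M])
        (use f at WhileF in \<open>auto simp: run_steps run_0 step_jump_code step_at\<close>)
  qed
next
  case (WhileT b R v c G t R' G' t' R'' G'' t'')
  let ?r = "p + code_length c + 3" and ?q = "p + 2 + code_length c"
  have at: "Suc p < length P" "P ! p = jump_code b (if v then p + 2 else ?r)"
    "P ! (Suc p) = Jump (if v then ?r else p + 2)"
    "code_at P (p + 2) (code (p + 2) c)" "?q < length P" "P ! ?q = Jump p"
    using WhileT.prems by (auto simp: code_at_append code_at_Cons length_code)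
  have f: "holds_test b R\<^sub>0 = v" using WhileT holds_test_sim[of R G R\<^sub>0 M b] by auto
  \<comment> \<open>A loop that continues on a failed test enters its body through the second jump,
    hence up to two steps.\<close>
  obtain k where k: "k \<le> 2" "run w orc P k (State p R\<^sub>0 M) = State (p + 2) R\<^sub>0 M"
  proof (cases v)
    case True
    thus ?thesis
      by (intro that[of 1]) (use f at in \<open>auto simp: run_steps run_0 step_jump_code step_at\<close>)
  next
    case False
    thus ?thesis
      by (intro that[of 2]) (use f at in \<open>auto simp: run_steps run_0 step_jump_code step_at\<close>)
  qed
  obtain u R\<^sub>1 M\<^sub>1 where 1: "t + 3 + u \<le> t'"
    "run w orc P u (State (p + 2) R\<^sub>0 M) = State ?q R\<^sub>1 M\<^sub>1" "simulates R' G' R\<^sub>1 M\<^sub>1"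
    using WhileT.IH(1)[of "p + 2" R\<^sub>0 M] WhileT.prems at by auto
  obtain x R\<^sub>2 M\<^sub>2 where 2: "t' + x \<le> t''"
    "run w orc P x (State p R\<^sub>1 M\<^sub>1) = State ?r R\<^sub>2 M\<^sub>2" "simulates R'' G'' R\<^sub>2 M\<^sub>2"
    using WhileT.IH(2)[of p R\<^sub>1 M\<^sub>1] WhileT.prems at 1 by auto
  have "run w orc P (k + u + 1 + x) (State p R\<^sub>0 M) = State ?r R\<^sub>2 M\<^sub>2"
    unfolding run_add k by (use 1 2 at in \<open>simp add: run_steps run_0 step_at\<close>)
  thus ?case
    by (intro exI[of _ "k + u + 1 + x"] exI[of _ R\<^sub>2] exI[of _ M\<^sub>2]) (use 1 2 k in \<open>auto simp: add_ac\<close>)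
qed

end

section \<open>Counting permutations\<close>

text \<open>Here the absence of negation enters: a letter stays admissible when further letters are
  moved in front of it.\<close>

lemma holds_mono:
  "holds f Y \<Longrightarrow> Y \<subseteq> Z \<Longrightarrow> holds f Z"
  "holds_conj c Y \<Longrightarrow> Y \<subseteq> Z \<Longrightarrow> holds_conj c Z"
  "holds_atom a Y \<Longrightarrow> Y \<subseteq> Z \<Longrightarrow> holds_atom a Z"
  by (induction f and c and a) auto

text \<open>Draw for every letter a number from its interval. Sorting the letters by these numbers gives a
  word of the antimatroid, and the numbers are determined by this word and the set
  of the \<open>g (s ! k) + k\<close>.\<close>

lemma interval_volume:
  fixes \<Sigma> :: "'a set" and lo hi :: "'a \<Rightarrow> nat"
  assumes fin: "finite \<Sigma>" and rep: "precedence_representation \<Sigma> F A"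
    and hi: "\<And>x. x \<in> \<Sigma> \<Longrightarrow> hi x \<le> card \<Sigma>"
    and F: "\<And>x. x \<in> \<Sigma> \<Longrightarrow> holds (F x) {y\<in>\<Sigma>. hi y \<le> lo x}"
  shows "(\<Prod>x\<in>\<Sigma>. hi x - lo x) \<le> 4 ^ card \<Sigma> * card (permutations_in \<Sigma> A)"
proof -
  obtain ls where ls: "set ls = \<Sigma>" "distinct ls" using finite_distinct_list[OF fin] by blast
  define n where "n = card \<Sigma>"
  define word where "word g = sort_key g ls" for g :: "'a \<Rightarrow> nat"
  have word: "set (word g) = \<Sigma>" "distinct (word g)" "length (word g) = n" "sorted (map g (word g))" for g
    using ls distinct_card[of ls] by (auto simp: word_def n_def)
  \<comment> \<open>Adding the position \<open>k\<close> makes the sorted numbers strictly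
    increasing. The set of the sums can then be sorted back into a list, whereas equal numbers would
    be merged in a set of the bare values.\<close>
  define code where "code g = (word g, {g (word g ! k) + k | k. k < n})" for g
  define B where "B = (\<Pi>\<^sub>E x\<in>\<Sigma>. {lo x..<hi x})"
  have card_B: "card B = (\<Prod>x\<in>\<Sigma>. hi x - lo x)"
    unfolding B_def by (simp add: card_PiE[OF fin])
  have inj: "inj_on code B"
  proof (rule inj_onI)
    fix g h assume B: "g \<in> B" "h \<in> B" and eq: "code g = code h"
    define s where "s = word g"
    have s: "word g = s" "word h = s" using eq by (auto simp: code_def s_def)
    have list: "sorted_list_of_set {f (s ! k) + k | k. k < n} = map (\<lambda>k. f (s ! k) + k) [0..<n]"
      if "word f = s" for f
    proof -
      have "f (s ! i) + i < f (s ! j) + j" if "i < j" "j < n" for i j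
        using word(3,4)[of f] that \<open>word f = s\<close> sorted_nth_mono[of "map f s" i j] by auto
      hence "sorted_wrt (<) (map (\<lambda>k. f (s ! k) + k) [0..<n])"
        by (auto simp: sorted_wrt_iff_nth_less)
      moreover have "set (map (\<lambda>k. f (s ! k) + k) [0..<n]) = {f (s ! k) + k | k. k < n}" by auto
      ultimately show ?thesis
        by (metis (no_types, lifting) sorted_list_of_set.idem_if_sorted_distinct strict_sorted_iff)
    qed
    have "map (\<lambda>k. g (s ! k) + k) [0..<n] = map (\<lambda>k. h (s ! k) + k) [0..<n]"
      using eq s list[of g] list[of h] by (simp add: code_def)
    hence "g (s ! k) = h (s ! k)" if "k < n" for k using that by (auto simp: list_eq_iff_nth_eq)
    hence "g x = h x" if "x \<in> \<Sigma>" for x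
      using that word(1,3)[of g] s by (metis in_set_conv_nth)
    thus "g = h" using B unfolding B_def by (intro PiE_ext) auto
  qed
  have sub: "code ` B \<subseteq> permutations_in \<Sigma> A \<times> Pow {..<2 * n}"
  proof (rule image_subsetI)
    fix g assume g: "g \<in> B"
    define s where "s = word g"
    note s = word[of g, folded s_def]
    have gx: "lo x \<le> g x" "g x < hi x" if "x \<in> \<Sigma>" for x using g that by (auto simp: B_def PiE_def Pi_def)
    have "holds (F (s ! i)) (set (take i s))" if i: "i < n" for i
    proof (rule holds_mono(1)[OF F])
      show x: "s ! i \<in> \<Sigma>" using i s by (metis nth_mem)
      show "{y\<in>\<Sigma>. hi y \<le> lo (s ! i)} \<subseteq> set (take i s)"
      proof clarify
        fix y assume y: "y \<in> \<Sigma>" "hi y \<le> lo (s ! i)"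
        then obtain j where j: "j < n" "y = s ! j" using s by (metis in_set_conv_nth)
        \<comment> \<open>Half-open intervals make this strict, so the order in which
          \<open>sort_key\<close> leaves letters with equal numbers is irrelevant.\<close>
        have "g y < g (s ! i)" using gx[OF x] gx[OF y(1)] y(2) by linarith
        hence "\<not> i \<le> j" using sorted_nth_mono[OF s(4), of i j] i j s(3) by auto
        hence "take i s ! j \<in> set (take i s)" using i s(3) by (intro nth_mem) simp
        thus "y \<in> set (take i s)" using \<open>\<not> i \<le> j\<close> j by simp
      qed
    qed
    hence "s \<in> permutations_in \<Sigma> A"
      using s rep by (auto simp: permutations_in_def precedence_representation_def simple_words_def)
    \<comment> \<open>Both summands are below \<open>n\<close>. The sets are thus subsets of
      \<open>2 * n\<close> numbers, which is the origin of the factor \<open>4 ^ n\<close>.\<close>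
    moreover have "g (s ! k) + k < 2 * n" if "k < n" for k
    proof -
      have "s ! k \<in> \<Sigma>" using that s by (metis nth_mem)
      thus ?thesis using gx hi that by (fastforce simp: n_def)
    qed
    ultimately show "code g \<in> permutations_in \<Sigma> A \<times> Pow {..<2 * n}"
      by (auto simp: code_def s_def)
  qed
  have "finite (permutations_in \<Sigma> A)"
    unfolding permutations_in_def simple_words_def
    by (rule finite_subset[OF _ finite_subset_distinct[OF fin]]) auto
  hence "card B \<le> card (permutations_in \<Sigma> A \<times> Pow {..<2 * n})"
    using card_inj_on_le[OF inj sub] by simp
  also have "\<dots> = 4 ^ n * card (permutations_in \<Sigma> A)"
    by (simp add: card_cartesian_product card_Pow power_mult)
  finally show ?thesis by (simp add: card_B n_def)
qed

section \<open>Reading formulas as gate networks\<close>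

datatype gate = Input nat | AndGate | OrGate

fun is_input :: "gate \<Rightarrow> bool" where
  "is_input (Input z) \<longleftrightarrow> True"
| "is_input _ \<longleftrightarrow> False"

text \<open>
  A net under construction consists of the number of the next node, the conjunction that is
  currently open, the parents and the kinds of the nodes. The constants \<open>1\<close> and \<open>0\<close> are the
  additional inputs \<open>N\<close> and \<open>N + 1\<close>. The parent of the root of a formula is a letter.
\<close>

type_synonym net = "nat \<times> nat \<times> (nat \<Rightarrow> nat) \<times> (nat \<Rightarrow> gate)"

definition input_of :: "nat \<Rightarrow> nat \<Rightarrow> nat" where
  "input_of N c = (if c = 0 then N + 1 else if c = 1 then N else c - 6)"

text \<open>A formula becomes an Or gate with one And gate per conjunction below it, and parent
  pointers double as the stack of the parser. A left parenthesis opens an Or gate with a first And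
  gate below the open conjunction; a right parenthesis climbs over the Or gate back to the enclosing
  conjunction. Code 3 creates nothing because further factors join the open And gate.\<close>

fun read_symbol :: "nat \<Rightarrow> net \<Rightarrow> nat \<Rightarrow> net" where
  "read_symbol N (n, a, p, k) c =
     (if c = 2 then (n + 1, n, p(n := p a), k(n := AndGate))
      else if c = 3 then (n, a, p, k)
      else if c = 4 then (n + 2, n + 1, p(n := a, n + 1 := n), k(n := OrGate, n + 1 := AndGate))
      else if c = 5 then (n, p (p a), p, k)
      else (n + 1, a, p(n := a), k(n := Input (input_of N c))))"

abbreviation read_symbols :: "nat \<Rightarrow> net \<Rightarrow> nat list \<Rightarrow> net" where
  "read_symbols N \<equiv> foldl (read_symbol N)"

lemma read_symbols_size:
  assumes "read_symbols N (n, a, p, k) cs = (n', a', p', k')"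
  shows "n \<le> n' \<and> n' \<le> n + 2 * length cs"
  using assms
proof (induction cs arbitrary: n a p k)
  case (Cons c cs)
  obtain n1 a1 p1 k1 where 1: "read_symbol N (n, a, p, k) c = (n1, a1, p1, k1)"
    by (metis prod.exhaust)
  have "n \<le> n1 \<and> n1 \<le> n + 2" using 1 by (auto split: if_splits)
  moreover have "n1 \<le> n' \<and> n' \<le> n1 + 2 * length cs" using Cons.IH[of n1 a1 p1 k1] Cons.prems 1 by simp
  ultimately show ?case by simp
qed simp

definition agree :: "nat \<Rightarrow> (nat \<Rightarrow> nat) \<Rightarrow> (nat \<Rightarrow> gate) \<Rightarrow> (nat \<Rightarrow> nat) \<Rightarrow> (nat \<Rightarrow> gate) \<Rightarrow> bool" where
  "agree n p k p' k' \<longleftrightarrow> (\<forall>i<n. p' i = p i \<and> k' i = k i)"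

text \<open>Parents precede their children, which excludes cycles. Every And gate must have a child:
  without one it would be true from the start, but no signal would ever reach it.\<close>

definition block :: "nat \<Rightarrow> (nat \<Rightarrow> nat) \<Rightarrow> (nat \<Rightarrow> gate) \<Rightarrow> nat \<Rightarrow> nat \<Rightarrow> nat \<Rightarrow> bool" where
  "block N p k a lo hi \<longleftrightarrow> (\<forall>i. lo \<le> i \<and> i < hi \<longrightarrow>
     (p i = a \<or> lo \<le> p i \<and> p i < i \<and> \<not> is_input (k (p i))) \<and>
     (k i = AndGate \<longrightarrow> (\<exists>j. lo \<le> j \<and> j < hi \<and> p j = i)) \<and>
     (\<forall>z. k i = Input z \<longrightarrow> z \<le> N + 1))"

text \<open>\<open>T\<close> is the set of the true nodes between \<open>lo\<close> and \<open>hi\<close> when \<open>Y\<close> is the set of the true inputs.\<close>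

definition consistent ::
  "(nat \<Rightarrow> nat) \<Rightarrow> (nat \<Rightarrow> gate) \<Rightarrow> nat set \<Rightarrow> nat \<Rightarrow> nat \<Rightarrow> nat set \<Rightarrow> bool" where
  "consistent p k Y lo hi T \<longleftrightarrow> (\<forall>j. lo \<le> j \<and> j < hi \<longrightarrow>
     (case k j of
        Input z \<Rightarrow> j \<in> T \<longleftrightarrow> z \<in> Y
      | AndGate \<Rightarrow> j \<in> T \<longleftrightarrow> (\<forall>i. lo \<le> i \<and> i < hi \<and> p i = j \<longrightarrow> i \<in> T)
      | OrGate \<Rightarrow> j \<in> T \<longleftrightarrow> (\<exists>i. lo \<le> i \<and> i < hi \<and> p i = j \<and> i \<in> T)))"

lemma block_agree:
  assumes "block N p k a lo hi" "agree m p k p' k'" "hi \<le> m"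
  shows "block N p' k' a lo hi"
proof -
  have *: "p' i = p i" "k' i = k i" if "i < hi" for i using assms that by (auto simp: agree_def)
  have e: "(\<exists>j. lo \<le> j \<and> j < hi \<and> p' j = i) = (\<exists>j. lo \<le> j \<and> j < hi \<and> p j = i)" for i
    using * by auto
  show ?thesis
    unfolding block_def e
  proof (intro allI impI)
    fix i assume i: "lo \<le> i \<and> i < hi"
    have "p i < i \<Longrightarrow> k' (p i) = k (p i)" using i * by auto
    thus "(p' i = a \<or> lo \<le> p' i \<and> p' i < i \<and> \<not> is_input (k' (p' i))) \<and>
      (k' i = AndGate \<longrightarrow> (\<exists>j. lo \<le> j \<and> j < hi \<and> p j = i)) \<and> (\<forall>z. k' i = Input z \<longrightarrow> z \<le> N + 1)"
      using assms(1)[unfolded block_def, rule_format, OF i] *[of i] i by auto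
  qed
qed

lemma consistent_agree:
  assumes "agree m p k p' k'" "hi \<le> m"
  shows "consistent p' k' Y lo hi T \<longleftrightarrow> consistent p k Y lo hi T"
proof -
  have *: "p' i = p i" "k' i = k i" if "i < hi" for i using assms that by (auto simp: agree_def)
  have e: "(\<forall>i. lo \<le> i \<and> i < hi \<and> p' i = j \<longrightarrow> i \<in> T) = (\<forall>i. lo \<le> i \<and> i < hi \<and> p i = j \<longrightarrow> i \<in> T)"
    "(\<exists>i. lo \<le> i \<and> i < hi \<and> p' i = j \<and> i \<in> T) = (\<exists>i. lo \<le> i \<and> i < hi \<and> p i = j \<and> i \<in> T)" for j
    using *(1) by auto
  show ?thesis
    unfolding consistent_def e by (rule iff_allI, rule imp_cong[OF refl]) (simp add: *(2))
qed

lemma block_join: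
  assumes "block N p k a lo m" "block N p k a m hi" "lo \<le> m" "m \<le> hi"
  shows "block N p k a lo hi"
  unfolding block_def
proof (intro allI impI)
  fix i assume i: "lo \<le> i \<and> i < hi"
  show "(p i = a \<or> lo \<le> p i \<and> p i < i \<and> \<not> is_input (k (p i))) \<and>
     (k i = AndGate \<longrightarrow> (\<exists>j. lo \<le> j \<and> j < hi \<and> p j = i)) \<and> (\<forall>z. k i = Input z \<longrightarrow> z \<le> N + 1)"
  proof (cases "i < m")
    case True
    thus ?thesis using assms(1,4) i unfolding block_def by (meson order.strict_trans2)
  next
    case False
    thus ?thesis using assms(2,3) i unfolding block_def by (meson order_trans not_le)
  qed
qed

text \<open>No edge crosses \<open>m\<close>: parents of lower nodes stay below \<open>m\<close>,
  and parents of upper nodes stay above it or leave the range altogether. The gate conditions of the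
  two parts are therefore independent.\<close>

lemma consistent_split:
  assumes l: "\<And>i. lo \<le> i \<Longrightarrow> i < m \<Longrightarrow> p i < m"
    and h: "\<And>i. m \<le> i \<Longrightarrow> i < hi \<Longrightarrow> p i < lo \<or> m \<le> p i"
    and "lo \<le> m" "m \<le> hi" "consistent p k Y lo hi T"
  shows "consistent p k Y lo m T" "consistent p k Y m hi T"
proof -
  have low: "i < m" if "p i = j" "j < m" "lo \<le> j" "i < hi" for i j
    using h[of i] that by (cases "m \<le> i") auto
  have high: "m \<le> i" if "p i = j" "m \<le> j" "lo \<le> i" for i j
    using l[of i] that by (cases "i < m") auto
  show "consistent p k Y lo m T"
    unfolding consistent_def
  proof (intro allI impI)
    fix j assume j: "lo \<le> j \<and> j < m"
    have e: "(lo \<le> i \<and> i < m \<and> p i = j) = (lo \<le> i \<and> i < hi \<and> p i = j)" for i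
      using low[of i j] j assms(4) by auto
    have e': "(\<forall>i. lo \<le> i \<and> i < m \<and> p i = j \<longrightarrow> i \<in> T) = (\<forall>i. lo \<le> i \<and> i < hi \<and> p i = j \<longrightarrow> i \<in> T)"
      "(\<exists>i. lo \<le> i \<and> i < m \<and> p i = j \<and> i \<in> T) = (\<exists>i. lo \<le> i \<and> i < hi \<and> p i = j \<and> i \<in> T)"
      using e by blast+
    show "case k j of Input z \<Rightarrow> (j \<in> T) = (z \<in> Y)
         | AndGate \<Rightarrow> (j \<in> T) = (\<forall>i. lo \<le> i \<and> i < m \<and> p i = j \<longrightarrow> i \<in> T)
         | OrGate \<Rightarrow> (j \<in> T) = (\<exists>i. lo \<le> i \<and> i < m \<and> p i = j \<and> i \<in> T)"
      unfolding e' using assms(5)[unfolded consistent_def, rule_format, of j] j assms(4) by simp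
  qed
  show "consistent p k Y m hi T"
    unfolding consistent_def
  proof (intro allI impI)
    fix j assume j: "m \<le> j \<and> j < hi"
    have e: "(m \<le> i \<and> i < hi \<and> p i = j) = (lo \<le> i \<and> i < hi \<and> p i = j)" for i
      using high[of i j] j assms(3) by auto
    have e': "(\<forall>i. m \<le> i \<and> i < hi \<and> p i = j \<longrightarrow> i \<in> T) = (\<forall>i. lo \<le> i \<and> i < hi \<and> p i = j \<longrightarrow> i \<in> T)"
      "(\<exists>i. m \<le> i \<and> i < hi \<and> p i = j \<and> i \<in> T) = (\<exists>i. lo \<le> i \<and> i < hi \<and> p i = j \<and> i \<in> T)"
      using e by blast+
    show "case k j of Input z \<Rightarrow> (j \<in> T) = (z \<in> Y)
         | AndGate \<Rightarrow> (j \<in> T) = (\<forall>i. m \<le> i \<and> i < hi \<and> p i = j \<longrightarrow> i \<in> T)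
         | OrGate \<Rightarrow> (j \<in> T) = (\<exists>i. m \<le> i \<and> i < hi \<and> p i = j \<and> i \<in> T)"
      unfolding e' using assms(5)[unfolded consistent_def, rule_format, of j] j assms(3) by simp
  qed
qed

lemma consistent_split_block:
  assumes "block N p k a lo m" "block N p k a m hi" "lo \<le> m" "m \<le> hi" "a < lo"
    and "consistent p k Y lo hi T"
  shows "consistent p k Y lo m T" "consistent p k Y m hi T"
proof -
  have l: "p i < m" if "lo \<le> i" "i < m" for i
    using assms(1)[unfolded block_def, rule_format, of i] assms(5) that by auto
  have h: "p i < lo \<or> m \<le> p i" if "m \<le> i" "i < hi" for i
    using assms(2)[unfolded block_def, rule_format, of i] assms(5) that by auto
  show "consistent p k Y lo m T" "consistent p k Y m hi T"
    using consistent_split[OF l h assms(3,4,6)] by blast+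
qed

text \<open>The bound on \<open>i\<close> drops the two constant inputs, whose numbers start at
  \<open>length xs\<close>.\<close>

definition letters :: "'a list \<Rightarrow> nat set \<Rightarrow> 'a set" where
  "letters xs Y = {xs ! i | i. i \<in> Y \<and> i < length xs}"

text \<open>The three notions follow the grammar: an atom adds exactly one child to the open
  conjunction, a conjunction adds children that must all be true, and a formula adds children of an
  Or gate, one of which must be true. Truth is described by an arbitrary consistent
  \<open>T\<close>, to which the set of fired gates can later be matched.\<close>

definition reads_atom :: "'a list \<Rightarrow> 'a symbol list \<Rightarrow> ('a set \<Rightarrow> bool) \<Rightarrow> bool" where
  "reads_atom xs ss h \<longleftrightarrow> (\<forall>cs n a p k n' a' p' k'.
     list_all2 (encodes_symbol xs) cs ss \<longrightarrow>
     read_symbols (length xs) (n, a, p, k) cs = (n', a', p', k') \<longrightarrow> a < n \<longrightarrow> k a = AndGate \<longrightarrow>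
     a' = a \<and> n < n' \<and> agree n p k p' k' \<and> block (length xs) p' k' a n n' \<and>
     (\<forall>i. n \<le> i \<and> i < n' \<longrightarrow> (p' i = a \<longleftrightarrow> i = n)) \<and>
     (\<forall>Y T. length xs \<in> Y \<longrightarrow> Suc (length xs) \<notin> Y \<longrightarrow> consistent p' k' Y n n' T \<longrightarrow>
        (n \<in> T \<longleftrightarrow> h (letters xs Y))))"

definition reads_conj :: "'a list \<Rightarrow> 'a symbol list \<Rightarrow> ('a set \<Rightarrow> bool) \<Rightarrow> bool" where
  "reads_conj xs ss h \<longleftrightarrow> (\<forall>cs n a p k n' a' p' k'.
     list_all2 (encodes_symbol xs) cs ss \<longrightarrow>
     read_symbols (length xs) (n, a, p, k) cs = (n', a', p', k') \<longrightarrow> a < n \<longrightarrow> k a = AndGate \<longrightarrow>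
     a' = a \<and> n < n' \<and> agree n p k p' k' \<and> block (length xs) p' k' a n n' \<and>
     (\<exists>i. n \<le> i \<and> i < n' \<and> p' i = a) \<and>
     (\<forall>Y T. length xs \<in> Y \<longrightarrow> Suc (length xs) \<notin> Y \<longrightarrow> consistent p' k' Y n n' T \<longrightarrow>
        ((\<forall>i. n \<le> i \<and> i < n' \<and> p' i = a \<longrightarrow> i \<in> T) \<longleftrightarrow> h (letters xs Y))))"

text \<open>The first And gate \<open>a\<close> exists before reading begins, since it is created
  together with its parent \<open>v\<close>; hence the range starts at \<open>a\<close>. The
  conjunction \<open>a'\<close> open at the end may be a later child of \<open>v\<close>.\<close>

definition reads_formula :: "'a list \<Rightarrow> 'a symbol list \<Rightarrow> ('a set \<Rightarrow> bool) \<Rightarrow> bool" where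
  "reads_formula xs ss h \<longleftrightarrow> (\<forall>cs a v p k n' a' p' k'.
     list_all2 (encodes_symbol xs) cs ss \<longrightarrow>
     read_symbols (length xs) (a + 1, a, p, k) cs = (n', a', p', k') \<longrightarrow>
     p a = v \<longrightarrow> v < a \<longrightarrow> k a = AndGate \<longrightarrow>
     a \<le> a' \<and> a' < n' \<and> p' a' = v \<and> agree (a + 1) p k p' k' \<and> block (length xs) p' k' v a n' \<and>
     (\<forall>Y T. length xs \<in> Y \<longrightarrow> Suc (length xs) \<notin> Y \<longrightarrow> consistent p' k' Y a n' T \<longrightarrow>
        ((\<exists>i. a \<le> i \<and> i < n' \<and> p' i = v \<and> i \<in> T) \<longleftrightarrow> h (letters xs Y))))"

lemma reads_input:
  assumes "\<And>c. encodes_symbol xs c s \<Longrightarrow> c \<notin> {2, 3, 4, 5} \<and> input_of (length xs) c \<le> length xs + 1"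
    and "\<And>c Y. encodes_symbol xs c s \<Longrightarrow> length xs \<in> Y \<Longrightarrow> Suc (length xs) \<notin> Y \<Longrightarrow>
      input_of (length xs) c \<in> Y \<longleftrightarrow> h (letters xs Y)"
  shows "reads_atom xs [s] h"
  unfolding reads_atom_def
proof (intro allI impI)
  fix cs n a p k n' a' p' k'
  assume *: "list_all2 (encodes_symbol xs) cs [s]"
    "read_symbols (length xs) (n, a, p, k) cs = (n', a', p', k')" "a < n" "k a = AndGate"
  then obtain c where c: "cs = [c]" "encodes_symbol xs c s" by (auto simp: list_all2_Cons2)
  note c' = assms(1)[OF c(2)]
  have net: "n' = n + 1" "a' = a" "p' = p(n := a)" "k' = k(n := Input (input_of (length xs) c))"
    using *(2) c' c(1) by auto
  have "\<forall>Y T. length xs \<in> Y \<longrightarrow> Suc (length xs) \<notin> Y \<longrightarrow> consistent p' k' Y n n' T \<longrightarrow>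
        (n \<in> T \<longleftrightarrow> h (letters xs Y))"
    using assms(2)[OF c(2)] unfolding net consistent_def by auto
  moreover have "block (length xs) p' k' a n n'" using c' net by (auto simp: block_def)
  ultimately show "a' = a \<and> n < n' \<and> agree n p k p' k' \<and> block (length xs) p' k' a n n' \<and>
     (\<forall>i. n \<le> i \<and> i < n' \<longrightarrow> (p' i = a \<longleftrightarrow> i = n)) \<and>
     (\<forall>Y T. length xs \<in> Y \<longrightarrow> Suc (length xs) \<notin> Y \<longrightarrow> consistent p' k' Y n n' T \<longrightarrow>
        (n \<in> T \<longleftrightarrow> h (letters xs Y)))"
    using net by (auto simp: agree_def)
qed

lemma reads_zero: "reads_atom xs [SZero] (\<lambda>_. False)"
  by (rule reads_input) (auto simp: input_of_def)

lemma reads_one: "reads_atom xs [SOne] (\<lambda>_. True)"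
  by (rule reads_input) (auto simp: input_of_def)

lemma reads_var:
  assumes "distinct xs"
  shows "reads_atom xs [SVar x] (\<lambda>Y. x \<in> Y)"
  by (rule reads_input) (use assms in \<open>auto simp: input_of_def letters_def nth_eq_iff_index_eq\<close>)

lemma reads_factor:
  assumes "reads_atom xs ss h"
  shows "reads_conj xs ss h"
  unfolding reads_conj_def
proof (intro allI impI)
  fix cs n a p k n' a' p' k'
  assume *: "list_all2 (encodes_symbol xs) cs ss"
    "read_symbols (length xs) (n, a, p, k) cs = (n', a', p', k')" "a < n" "k a = AndGate"
  note r = assms[unfolded reads_atom_def, rule_format, OF *]
  hence "(\<forall>i. n \<le> i \<and> i < n' \<and> p' i = a \<longrightarrow> i \<in> T) \<longleftrightarrow> n \<in> T" for T by auto
  thus "a' = a \<and> n < n' \<and> agree n p k p' k' \<and> block (length xs) p' k' a n n' \<and>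
     (\<exists>i. n \<le> i \<and> i < n' \<and> p' i = a) \<and>
     (\<forall>Y T. length xs \<in> Y \<longrightarrow> Suc (length xs) \<notin> Y \<longrightarrow> consistent p' k' Y n n' T \<longrightarrow>
        ((\<forall>i. n \<le> i \<and> i < n' \<and> p' i = a \<longrightarrow> i \<in> T) \<longleftrightarrow> h (letters xs Y)))"
    using r by auto
qed

lemma agree_trans: "agree n p k p1 k1 \<Longrightarrow> agree m p1 k1 p' k' \<Longrightarrow> n \<le> m \<Longrightarrow> agree n p k p' k'"
  by (auto simp: agree_def)

lemma reads_conj_conj:
  assumes c: "reads_conj xs ss h" and a: "reads_atom xs ts g"
  shows "reads_conj xs (ss @ [SAnd] @ ts) (\<lambda>Y. h Y \<and> g Y)"
  unfolding reads_conj_def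
proof (intro allI impI)
  fix cs n a p k n' a' p' k'
  assume *: "list_all2 (encodes_symbol xs) cs (ss @ [SAnd] @ ts)"
    "read_symbols (length xs) (n, a, p, k) cs = (n', a', p', k')" "a < n" "k a = AndGate"
  then obtain cs1 cs2 where cs: "cs = cs1 @ [3] @ cs2" "list_all2 (encodes_symbol xs) cs1 ss"
    "list_all2 (encodes_symbol xs) cs2 ts"
    by (auto simp: list_all2_append2 list_all2_Cons2)
  obtain m a1 p1 k1 where 1: "read_symbols (length xs) (n, a, p, k) cs1 = (m, a1, p1, k1)"
    by (metis prod.exhaust)
  note r1 = c[unfolded reads_conj_def, rule_format, OF cs(2) 1 *(3,4)]
  have 2: "read_symbols (length xs) (m, a, p1, k1) cs2 = (n', a', p', k')"
    using *(2) cs(1) 1 r1 by simp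
  have "a < m" "k1 a = AndGate" using r1 *(3,4) by (auto simp: agree_def)
  note r2 = a[unfolded reads_atom_def, rule_format, OF cs(3) 2 this]
  have ag: "agree m p1 k1 p' k'" using r2 by blast
  have b1: "block (length xs) p' k' a n m" using r1 ag by (blast intro: block_agree)
  have b2: "block (length xs) p' k' a m n'" using r2 by blast
  have b: "block (length xs) p' k' a n n'" using block_join[OF b1 b2] r1 r2 by simp
  have p1: "i < m \<Longrightarrow> p' i = p1 i" for i using ag by (simp add: agree_def)
  have "(\<forall>i. n \<le> i \<and> i < n' \<and> p' i = a \<longrightarrow> i \<in> T) \<longleftrightarrow> h (letters xs Y) \<and> g (letters xs Y)"
    if "length xs \<in> Y" "Suc (length xs) \<notin> Y" "consistent p' k' Y n n' T" for Y T
  proof -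
    have "consistent p' k' Y n m T" "consistent p' k' Y m n' T"
      using consistent_split_block[OF b1 b2 _ _ *(3) that(3)] r1 r2 by auto
    hence "(\<forall>i. n \<le> i \<and> i < m \<and> p1 i = a \<longrightarrow> i \<in> T) \<longleftrightarrow> h (letters xs Y)" "m \<in> T \<longleftrightarrow> g (letters xs Y)"
      using r1 r2 that consistent_agree[OF ag, of m] by auto
    moreover have "(\<forall>i. n \<le> i \<and> i < n' \<and> p' i = a \<longrightarrow> i \<in> T) \<longleftrightarrow>
      (\<forall>i. n \<le> i \<and> i < m \<and> p1 i = a \<longrightarrow> i \<in> T) \<and> m \<in> T"
    proof -
      have "n \<le> i \<and> i < n' \<and> p' i = a \<longleftrightarrow> (n \<le> i \<and> i < m \<and> p1 i = a) \<or> i = m" for i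
        using r1 r2 p1[of i] by (cases "i < m") auto
      thus ?thesis by blast
    qed
    ultimately show ?thesis by blast
  qed
  moreover have "\<exists>i. n \<le> i \<and> i < n' \<and> p' i = a" using r1 r2 by (intro exI[of _ m]) auto
  ultimately show "a' = a \<and> n < n' \<and> agree n p k p' k' \<and> block (length xs) p' k' a n n' \<and>
     (\<exists>i. n \<le> i \<and> i < n' \<and> p' i = a) \<and>
     (\<forall>Y T. length xs \<in> Y \<longrightarrow> Suc (length xs) \<notin> Y \<longrightarrow> consistent p' k' Y n n' T \<longrightarrow>
        ((\<forall>i. n \<le> i \<and> i < n' \<and> p' i = a \<longrightarrow> i \<in> T) \<longleftrightarrow> h (letters xs Y) \<and> g (letters xs Y)))"
    using b r1 r2 agree_trans[OF _ ag, of n p k] by auto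
qed

text \<open>Puts the And gate itself on top of the nodes of its conjunction. Its own parent lies
  below the range, so enlarging the range downwards by \<open>a\<close> affects no other
  gate.\<close>

lemma reads_conj_node:
  assumes c: "reads_conj xs ss h" "list_all2 (encodes_symbol xs) cs ss"
    "read_symbols (length xs) (a + 1, a, p, k) cs = (n', a', p', k')" "p a = v" "v < a" "k a = AndGate"
  shows "a' = a \<and> a + 1 < n' \<and> agree (a + 1) p k p' k' \<and> block (length xs) p' k' v a n' \<and>
     (\<forall>i. a \<le> i \<and> i < n' \<longrightarrow> (p' i = v \<longleftrightarrow> i = a)) \<and>
     (\<forall>Y T. length xs \<in> Y \<longrightarrow> Suc (length xs) \<notin> Y \<longrightarrow> consistent p' k' Y a n' T \<longrightarrow>
        (a \<in> T \<longleftrightarrow> h (letters xs Y)))"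
proof -
  note r = c(1)[unfolded reads_conj_def, rule_format, OF c(2,3) _ c(6), simplified]
  have ag: "agree (a + 1) p k p' k'" using r by simp
  have a: "p' a = v" "k' a = AndGate" using ag c(4,6) by (auto simp: agree_def)
  have b: "block (length xs) p' k' v a n'"
    unfolding block_def
  proof (intro allI impI)
    fix i assume i: "a \<le> i \<and> i < n'"
    show "(p' i = v \<or> a \<le> p' i \<and> p' i < i \<and> \<not> is_input (k' (p' i))) \<and>
      (k' i = AndGate \<longrightarrow> (\<exists>j. a \<le> j \<and> j < n' \<and> p' j = i)) \<and> (\<forall>z. k' i = Input z \<longrightarrow> z \<le> length xs + 1)"
    proof (cases "i = a")
      case True
      obtain j where "Suc a \<le> j" "j < n'" "p' j = a" using r by auto
      thus ?thesis using a True by (auto intro!: exI[of _ j])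
    next
      case False
      hence "Suc a \<le> i \<and> i < n'" using i by simp
      with r have "(p' i = a \<or> Suc a \<le> p' i \<and> p' i < i \<and> \<not> is_input (k' (p' i))) \<and>
        (k' i = AndGate \<longrightarrow> (\<exists>j. Suc a \<le> j \<and> j < n' \<and> p' j = i)) \<and> (\<forall>z. k' i = Input z \<longrightarrow> z \<le> length xs + 1)"
        unfolding block_def by blast
      thus ?thesis using a(2) False i by (auto dest: Suc_leD)
    qed
  qed
  have par: "a \<le> i \<and> i < n' \<longrightarrow> (p' i = v \<longleftrightarrow> i = a)" for i
  proof (intro impI)
    assume i: "a \<le> i \<and> i < n'"
    show "p' i = v \<longleftrightarrow> i = a"
    proof (cases "i = a")
      case False
      hence "Suc a \<le> i \<and> i < n'" using i by simp
      with r have "p' i = a \<or> Suc a \<le> p' i" unfolding block_def by blast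
      thus ?thesis using False c(5) by auto
    qed (use a in simp)
  qed
  have "a \<in> T \<longleftrightarrow> h (letters xs Y)"
    if Y: "length xs \<in> Y" "Suc (length xs) \<notin> Y" and T: "consistent p' k' Y a n' T" for Y T
  proof -
    have "p' a \<noteq> j" if "a < j" for j using a c(5) that by simp
    hence e: "(Suc a \<le> i \<and> i < n' \<and> p' i = j) = (a \<le> i \<and> i < n' \<and> p' i = j)" if "a \<le> j" for i j
      using that a c(5) by (cases "i = a") auto
    have e': "(\<forall>i. Suc a \<le> i \<and> i < n' \<and> p' i = j \<longrightarrow> i \<in> T) = (\<forall>i. a \<le> i \<and> i < n' \<and> p' i = j \<longrightarrow> i \<in> T)"
      "(\<exists>i. Suc a \<le> i \<and> i < n' \<and> p' i = j \<and> i \<in> T) = (\<exists>i. a \<le> i \<and> i < n' \<and> p' i = j \<and> i \<in> T)"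
      if "a \<le> j" for j using e[OF that] by blast+
    have "consistent p' k' Y (Suc a) n' T"
      unfolding consistent_def
    proof (intro allI impI)
      fix j assume j: "Suc a \<le> j \<and> j < n'"
      hence j': "a \<le> j" by simp
      show "case k' j of Input z \<Rightarrow> (j \<in> T) = (z \<in> Y)
         | AndGate \<Rightarrow> (j \<in> T) = (\<forall>i. Suc a \<le> i \<and> i < n' \<and> p' i = j \<longrightarrow> i \<in> T)
         | OrGate \<Rightarrow> (j \<in> T) = (\<exists>i. Suc a \<le> i \<and> i < n' \<and> p' i = j \<and> i \<in> T)"
        unfolding e'[OF j'] using T[unfolded consistent_def, rule_format, of j] j by simp
    qed
    hence "(\<forall>i. Suc a \<le> i \<and> i < n' \<and> p' i = a \<longrightarrow> i \<in> T) \<longleftrightarrow> h (letters xs Y)"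
      using r Y by blast
    moreover have "a < n'" using r by simp
    ultimately show ?thesis
      using T[unfolded consistent_def, rule_format, of a] a(2) e'(1)[of a] by simp
  qed
  thus ?thesis using r b par by auto
qed

lemma reads_single:
  assumes "reads_conj xs ss h"
  shows "reads_formula xs ss h"
  unfolding reads_formula_def
proof (intro allI impI)
  fix cs a v p k n' a' p' k'
  assume *: "list_all2 (encodes_symbol xs) cs ss"
    "read_symbols (length xs) (a + 1, a, p, k) cs = (n', a', p', k')" "p a = v" "v < a" "k a = AndGate"
  note r = reads_conj_node[OF assms *]
  have par: "a \<le> i \<Longrightarrow> i < n' \<Longrightarrow> p' i = v \<longleftrightarrow> i = a" for i using r by blast
  have lt: "a < n'" using r by simp
  hence e: "(\<exists>i. a \<le> i \<and> i < n' \<and> p' i = v \<and> i \<in> T) \<longleftrightarrow> a \<in> T" for T using par by blast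
  have "p' a = v" "a' = a" using r lt par by blast+
  thus "a \<le> a' \<and> a' < n' \<and> p' a' = v \<and> agree (a + 1) p k p' k' \<and> block (length xs) p' k' v a n' \<and>
     (\<forall>Y T. length xs \<in> Y \<longrightarrow> Suc (length xs) \<notin> Y \<longrightarrow> consistent p' k' Y a n' T \<longrightarrow>
        ((\<exists>i. a \<le> i \<and> i < n' \<and> p' i = v \<and> i \<in> T) \<longleftrightarrow> h (letters xs Y)))"
    unfolding e using r lt by blast
qed

text \<open>The open conjunction after \<open>ss\<close> is a child of \<open>v\<close>. Copying its
  parent pointer therefore places the new And gate below the same Or gate.\<close>

lemma reads_disj:
  assumes f: "reads_formula xs ss h" and c: "reads_conj xs ts g"
  shows "reads_formula xs (ss @ [SOr] @ ts) (\<lambda>Y. h Y \<or> g Y)"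
  unfolding reads_formula_def
proof (intro allI impI)
  fix cs a v p k n' a' p' k'
  assume *: "list_all2 (encodes_symbol xs) cs (ss @ [SOr] @ ts)"
    "read_symbols (length xs) (a + 1, a, p, k) cs = (n', a', p', k')" "p a = v" "v < a" "k a = AndGate"
  then obtain cs1 cs2 where cs: "cs = cs1 @ [2] @ cs2" "list_all2 (encodes_symbol xs) cs1 ss"
    "list_all2 (encodes_symbol xs) cs2 ts"
    by (auto simp: list_all2_append2 list_all2_Cons2)
  obtain m a1 p1 k1 where 1: "read_symbols (length xs) (a + 1, a, p, k) cs1 = (m, a1, p1, k1)"
    by (metis prod.exhaust)
  note r1 = f[unfolded reads_formula_def, rule_format, OF cs(2) 1 *(3-5)]
  define p2 k2 where "p2 = p1(m := v)" and "k2 = k1(m := AndGate)"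
  have 2: "read_symbols (length xs) (m + 1, m, p2, k2) cs2 = (n', a', p', k')"
    using *(2) cs(1) 1 r1 by (simp add: p2_def k2_def)
  have am: "a < m" "v < m" "p2 m = v" "k2 m = AndGate" using r1 *(4) by (auto simp: p2_def k2_def)
  note r2 = reads_conj_node[OF c cs(3) 2 am(3,2,4)]
  have ag12: "agree m p1 k1 p2 k2" by (simp add: agree_def p2_def k2_def)
  have ag: "agree m p1 k1 p' k'" using agree_trans[OF ag12, of "m + 1" p' k'] r2
    by (auto simp: agree_def p2_def k2_def)
  have b1: "block (length xs) p' k' v a m" using r1 ag by (blast intro: block_agree)
  have b2: "block (length xs) p' k' v m n'" using r2 by blast
  have b: "block (length xs) p' k' v a n'" using block_join[OF b1 b2] am r2 by simp
  have p1: "i < m \<Longrightarrow> p' i = p1 i" for i using ag by (simp add: agree_def)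
  have "(\<exists>i. a \<le> i \<and> i < n' \<and> p' i = v \<and> i \<in> T) \<longleftrightarrow> h (letters xs Y) \<or> g (letters xs Y)"
    if "length xs \<in> Y" "Suc (length xs) \<notin> Y" "consistent p' k' Y a n' T" for Y T
  proof -
    have "consistent p' k' Y a m T" "consistent p' k' Y m n' T"
      using consistent_split_block[OF b1 b2 _ _ *(4) that(3)] am r2 by auto
    hence "(\<exists>i. a \<le> i \<and> i < m \<and> p1 i = v \<and> i \<in> T) \<longleftrightarrow> h (letters xs Y)" "m \<in> T \<longleftrightarrow> g (letters xs Y)"
      using r1 r2 that consistent_agree[OF ag, of m] by auto
    moreover have "(\<exists>i. a \<le> i \<and> i < n' \<and> p' i = v \<and> i \<in> T) \<longleftrightarrow>
      (\<exists>i. a \<le> i \<and> i < m \<and> p1 i = v \<and> i \<in> T) \<or> m \<in> T"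
    proof -
      have "a \<le> i \<and> i < n' \<and> p' i = v \<longleftrightarrow> (a \<le> i \<and> i < m \<and> p1 i = v) \<or> i = m" for i
        using am r2 p1[of i] by (cases "i < m") auto
      thus ?thesis by blast
    qed
    ultimately show ?thesis by blast
  qed
  moreover have "agree (a + 1) p k p' k'" using r1 agree_trans[OF _ ag, of "a + 1" p k] am by simp
  ultimately show "a \<le> a' \<and> a' < n' \<and> p' a' = v \<and> agree (a + 1) p k p' k' \<and> block (length xs) p' k' v a n' \<and>
     (\<forall>Y T. length xs \<in> Y \<longrightarrow> Suc (length xs) \<notin> Y \<longrightarrow> consistent p' k' Y a n' T \<longrightarrow>
        ((\<exists>i. a \<le> i \<and> i < n' \<and> p' i = v \<and> i \<in> T) \<longleftrightarrow> h (letters xs Y) \<or> g (letters xs Y)))"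
    using b r1 r2 am by auto
qed

text \<open>Puts the Or gate \<open>v\<close> on top of a formula. Its parent \<open>u\<close> may
  be an open conjunction or a letter, so parenthesised subformulas and whole formulas are covered
  together.\<close>

lemma reads_formula_node:
  assumes f: "reads_formula xs ss h" "list_all2 (encodes_symbol xs) cs ss"
    "read_symbols (length xs) (v + 2, v + 1, p, k) cs = (n', a', p', k')"
    "p (v + 1) = v" "k (v + 1) = AndGate" "k v = OrGate" "p v = u" "u < v"
  shows "v + 1 < n' \<and> p' a' = v \<and> a' < n' \<and> agree (v + 1) p k p' k' \<and> block (length xs) p' k' u v n' \<and>
     (\<forall>i. v \<le> i \<and> i < n' \<longrightarrow> (p' i = u \<longleftrightarrow> i = v)) \<and>
     (\<forall>Y T. length xs \<in> Y \<longrightarrow> Suc (length xs) \<notin> Y \<longrightarrow> consistent p' k' Y v n' T \<longrightarrow>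
        (v \<in> T \<longleftrightarrow> h (letters xs Y)))"
proof -
  have 1: "read_symbols (length xs) (v + 1 + 1, v + 1, p, k) cs = (n', a', p', k')" using f(3) by simp
  note r = f(1)[unfolded reads_formula_def, rule_format, OF f(2) 1 f(4) _ f(5), simplified]
  have ag: "agree (v + 1) p k p' k'" using r by (auto simp: agree_def)
  have a: "p' v = u" "k' v = OrGate" using ag f(6,7) by (auto simp: agree_def)
  have b: "block (length xs) p' k' u v n'"
    unfolding block_def
  proof (intro allI impI)
    fix i assume i: "v \<le> i \<and> i < n'"
    show "(p' i = u \<or> v \<le> p' i \<and> p' i < i \<and> \<not> is_input (k' (p' i))) \<and>
      (k' i = AndGate \<longrightarrow> (\<exists>j. v \<le> j \<and> j < n' \<and> p' j = i)) \<and> (\<forall>z. k' i = Input z \<longrightarrow> z \<le> length xs + 1)"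
    proof (cases "i = v")
      case True
      thus ?thesis using a by auto
    next
      case False
      hence "Suc v \<le> i \<and> i < n'" using i by simp
      with r have "(p' i = v \<or> Suc v \<le> p' i \<and> p' i < i \<and> \<not> is_input (k' (p' i))) \<and>
        (k' i = AndGate \<longrightarrow> (\<exists>j. Suc v \<le> j \<and> j < n' \<and> p' j = i)) \<and> (\<forall>z. k' i = Input z \<longrightarrow> z \<le> length xs + 1)"
        unfolding block_def by blast
      thus ?thesis using a(2) False i by (auto dest: Suc_leD)
    qed
  qed
  have par: "v \<le> i \<and> i < n' \<longrightarrow> (p' i = u \<longleftrightarrow> i = v)" for i
  proof (intro impI)
    assume i: "v \<le> i \<and> i < n'"
    show "p' i = u \<longleftrightarrow> i = v"
    proof (cases "i = v")
      case False
      hence "Suc v \<le> i \<and> i < n'" using i by simp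
      with r have "p' i = v \<or> Suc v \<le> p' i" unfolding block_def by blast
      thus ?thesis using False f(8) by auto
    qed (use a in simp)
  qed
  have "v \<in> T \<longleftrightarrow> h (letters xs Y)"
    if Y: "length xs \<in> Y" "Suc (length xs) \<notin> Y" and T: "consistent p' k' Y v n' T" for Y T
  proof -
    have e: "(Suc v \<le> i \<and> i < n' \<and> p' i = j) = (v \<le> i \<and> i < n' \<and> p' i = j)" if "v \<le> j" for i j
      using that a f(8) by (cases "i = v") auto
    have e': "(\<forall>i. Suc v \<le> i \<and> i < n' \<and> p' i = j \<longrightarrow> i \<in> T) = (\<forall>i. v \<le> i \<and> i < n' \<and> p' i = j \<longrightarrow> i \<in> T)"
      "(\<exists>i. Suc v \<le> i \<and> i < n' \<and> p' i = j \<and> i \<in> T) = (\<exists>i. v \<le> i \<and> i < n' \<and> p' i = j \<and> i \<in> T)"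
      if "v \<le> j" for j using e[OF that] by blast+
    have "consistent p' k' Y (Suc v) n' T"
      unfolding consistent_def
    proof (intro allI impI)
      fix j assume j: "Suc v \<le> j \<and> j < n'"
      hence j': "v \<le> j" by simp
      show "case k' j of Input z \<Rightarrow> (j \<in> T) = (z \<in> Y)
         | AndGate \<Rightarrow> (j \<in> T) = (\<forall>i. Suc v \<le> i \<and> i < n' \<and> p' i = j \<longrightarrow> i \<in> T)
         | OrGate \<Rightarrow> (j \<in> T) = (\<exists>i. Suc v \<le> i \<and> i < n' \<and> p' i = j \<and> i \<in> T)"
        unfolding e'[OF j'] using T[unfolded consistent_def, rule_format, of j] j by simp
    qed
    hence "(\<exists>i. Suc v \<le> i \<and> i < n' \<and> p' i = v \<and> i \<in> T) \<longleftrightarrow> h (letters xs Y)"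
      using r Y by blast
    moreover have "v < n'" using r by simp
    ultimately show ?thesis
      using T[unfolded consistent_def, rule_format, of v] a(2) e'(2)[of v] by simp
  qed
  thus ?thesis using r b par ag by auto
qed

lemma reads_paren:
  assumes f: "reads_formula xs ss h"
  shows "reads_atom xs ([SLeft] @ ss @ [SRight]) h"
  unfolding reads_atom_def
proof (intro allI impI)
  fix cs n a p k n' a' p' k'
  assume *: "list_all2 (encodes_symbol xs) cs ([SLeft] @ ss @ [SRight])"
    "read_symbols (length xs) (n, a, p, k) cs = (n', a', p', k')" "a < n" "k a = AndGate"
  then obtain cs1 where cs: "cs = [4] @ cs1 @ [5]" "list_all2 (encodes_symbol xs) cs1 ss"
    by (auto simp: list_all2_append2 list_all2_Cons2)
  define p1 k1 where "p1 = p(n := a, n + 1 := n)" and "k1 = k(n := OrGate, n + 1 := AndGate)"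
  obtain m a2 p2 k2 where 1: "read_symbols (length xs) (n + 2, n + 1, p1, k1) cs1 = (m, a2, p2, k2)"
    by (metis prod.exhaust)
  note r = reads_formula_node[OF f cs(2) 1, of a]
  have net: "n' = m" "a' = p' (p' a2)" "p' = p2" "k' = k2"
    using *(2) cs(1) 1 by (auto simp: p1_def k1_def)
  have r': "n + 1 < m \<and> p' a2 = n \<and> a2 < m \<and> agree (n + 1) p1 k1 p' k' \<and> block (length xs) p' k' a n m \<and>
     (\<forall>i. n \<le> i \<and> i < m \<longrightarrow> (p' i = a \<longleftrightarrow> i = n)) \<and>
     (\<forall>Y T. length xs \<in> Y \<longrightarrow> Suc (length xs) \<notin> Y \<longrightarrow> consistent p' k' Y n m T \<longrightarrow>
        (n \<in> T \<longleftrightarrow> h (letters xs Y)))"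
    using r *(3) unfolding net by (simp add: p1_def k1_def)
  have "agree n p k p' k'" "p' n = a" using r' by (auto simp: agree_def p1_def k1_def)
  thus "a' = a \<and> n < n' \<and> agree n p k p' k' \<and> block (length xs) p' k' a n n' \<and>
     (\<forall>i. n \<le> i \<and> i < n' \<longrightarrow> (p' i = a \<longleftrightarrow> i = n)) \<and>
     (\<forall>Y T. length xs \<in> Y \<longrightarrow> Suc (length xs) \<notin> Y \<longrightarrow> consistent p' k' Y n n' T \<longrightarrow>
        (n \<in> T \<longleftrightarrow> h (letters xs Y)))"
    using r' net by auto
qed

lemma reads_symbols:
  assumes "distinct xs"
  shows "reads_formula xs (symbols f) (holds f)"
    "reads_conj xs (symbols_conj c) (holds_conj c)"
    "reads_atom xs (symbols_atom t) (holds_atom t)"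
proof (induction f and c and t)
  case (Disj f c)
  show ?case using reads_disj[OF Disj] by simp
next
  case (Conj c a)
  show ?case using reads_conj_conj[OF Conj] by simp
next
  case (Paren f)
  show ?case using reads_paren[OF Paren] by simp
qed (simp_all add: reads_single reads_factor reads_zero reads_one reads_var assms)

section \<open>The tournament\<close>

text \<open>\<open>rk\<close> is the hidden rank of a letter. The bound \<open>2 * N + 4\<close>
  leaves room for the tournament nodes, whose numbers are at most \<open>2 * N + 2\<close>.\<close>

locale sorter = machine +
  fixes rk :: "nat \<Rightarrow> nat"
  assumes orc: "orc a b \<longleftrightarrow> a < N \<and> b < N \<and> rk a < rk b"
    and room: "e + N + 8 * L \<le> 2 ^ w" "2 * N + 4 \<le> L"
begin

definition std :: "(nat \<Rightarrow> nat) \<Rightarrow> bool" where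
  "std R \<longleftrightarrow> R 0 = N \<and> R 6 = 1 \<and> R 7 = 2 \<and> R 8 = 0"

definition same :: "nat set \<Rightarrow> (nat \<Rightarrow> nat) \<Rightarrow> (nat \<Rightarrow> nat) \<Rightarrow> bool" where
  "same X R R' \<longleftrightarrow> (\<forall>r. r \<notin> X \<longrightarrow> R' r = R r)"

lemma same_std: "same X R R' \<Longrightarrow> X \<inter> {0, 6, 7, 8} = {} \<Longrightarrow> std R \<Longrightarrow> std R'"
  by (auto simp: same_def std_def)

definition skip_code :: cmd where
  "skip_code = Do (Cpy 20 20)"

text \<open>The number \<open>N\<close> stands for a missing letter. Only the second argument is
  tested for it: if the first is missing, the oracle answers no and the second is returned
  anyway.\<close>

definition best :: "nat \<Rightarrow> nat \<Rightarrow> nat" where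
  "best v u = (if u = N then v else if orc v u then v else u)"

definition min_code :: cmd where
  "min_code =
     If (Equal 19 0) skip_code
       (Do (Cmp 20 18 19) ;; If (Equal 20 8) (Do (Cpy 18 19)) skip_code)"

lemma wp_min:
  assumes "std R"
    and "\<And>R' s. same {18, 20} R R' \<Longrightarrow> R' 18 = best (R 18) (R 19) \<Longrightarrow> s \<le> t + 20 \<Longrightarrow> Q R' G s"
  shows "wp min_code Q R G t"
proof -
  have r: "R 0 = N" "R 8 = 0" using assms(1) by (simp_all add: std_def)
  have post: "Q (R(20 := y, 18 := best (R 18) (R 19))) G s" if "s \<le> t + 20" for y s
    by (rule assms(2)) (use that in \<open>simp_all add: same_def\<close>)
  have "R(20 := 1) = R(20 := 1, 18 := R 18)" "R = R(20 := R 20, 18 := R 18)"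
    by auto
  thus ?thesis
    unfolding min_code_def skip_code_def wp_simps
    using r post[of "8 + t" "R 20"] post[of "16 + t" 1] post[of "16 + t" 0]
    by (auto simp: best_def)
qed

lemma wp_skip: "wp skip_code Q R G t \<longleftrightarrow> Q R G (t + 6)"
  by (simp add: skip_code_def wp_simps)

definition is_min :: "nat \<Rightarrow> nat set \<Rightarrow> bool" where
  "is_min v X \<longleftrightarrow> (if X = {} then v = N else v \<in> X \<and> (\<forall>y\<in>X. rk v \<le> rk y))"

lemma is_min_best:
  assumes "is_min v X" "is_min u Y" "X \<subseteq> {..<N}" "Y \<subseteq> {..<N}"
  shows "is_min (best v u) (X \<union> Y)"
proof -
  have "u = N \<longleftrightarrow> Y = {}" using assms(2,4) by (auto simp: is_min_def split: if_splits)
  moreover have "v = N \<longleftrightarrow> X = {}" using assms(1,3) by (auto simp: is_min_def split: if_splits)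
  ultimately consider "Y = {}" "u = N" | "X = {}" "v = N" "Y \<noteq> {}" "u \<noteq> N" | "X \<noteq> {}" "Y \<noteq> {}" "u \<noteq> N"
    by blast
  thus ?thesis
  proof cases
    case 3
    hence v: "v \<in> X" "v < N" "\<forall>y\<in>X. rk v \<le> rk y" and u: "u \<in> Y" "u < N" "\<forall>y\<in>Y. rk u \<le> rk y"
      using assms by (auto simp: is_min_def)
    have "best v u = (if rk v < rk u then v else u)" using v u 3 by (simp add: best_def orc)
    moreover have "rk (if rk v < rk u then v else u) \<le> rk y" if "y \<in> X \<union> Y" for y
      using that bspec[OF v(3), of y] bspec[OF u(3), of y] by auto
    ultimately show ?thesis using v(1) u(1) 3 by (simp add: is_min_def)
  qed (use assms in \<open>auto simp: best_def orc\<close>)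
qed

section \<open>Segments of the insertion order and tournament nodes\<close>

definition seg :: "nat list \<Rightarrow> nat set \<Rightarrow> nat \<Rightarrow> nat \<Rightarrow> nat set" where
  "seg ins S lo hi = {ins ! j | j. lo \<le> j \<and> j < hi \<and> j < length ins \<and> ins ! j \<in> S}"

lemma seg_union: "lo \<le> mid \<Longrightarrow> mid \<le> hi \<Longrightarrow> seg ins S lo mid \<union> seg ins S mid hi = seg ins S lo hi"
  unfolding seg_def by (auto simp: not_less) (metis le_less_trans not_le order.strict_trans2 order.trans)+

lemma seg_bound: "set ins \<subseteq> {..<N} \<Longrightarrow> seg ins S lo hi \<subseteq> {..<N}"
  unfolding seg_def by (auto dest!: subsetD[OF _ nth_mem])

text \<open>A positive number is an odd number times a power of two in exactly one way. All levels
  thus share one array of linear size, and the children of \<open>node (Suc k) j\<close> lie at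
  distance \<open>2 ^ k\<close> to its left and right.\<close>

definition node :: "nat \<Rightarrow> nat \<Rightarrow> nat" where
  "node k j = (2 * j + 1) * 2 ^ k"

lemma node_inject: "node k j = node k' j' \<longleftrightarrow> k = k' \<and> j = j'"
proof
  have *: "k = k' \<and> j = j'" if "node k j = node k' j'" for k j k' j'
    using that
  proof (induction k arbitrary: k')
    case 0
    show ?case
    proof (cases k')
      case (Suc l)
      have "odd (node 0 j)" by (simp add: node_def)
      moreover have "even (node k' j')" by (simp add: node_def Suc)
      ultimately show ?thesis using 0 by simp
    qed (use 0 in \<open>simp add: node_def\<close>)
  next
    case (Suc k)
    show ?case
    proof (cases k')
      case 0
      have "odd (node k' j')" by (simp add: node_def 0)
      moreover have "even (node (Suc k) j)" by (simp add: node_def)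
      ultimately show ?thesis using Suc by simp
    next
      case (Suc l)
      hence "node k j = node l j'" using Suc.prems by (simp add: node_def)
      thus ?thesis using Suc.IH Suc by blast
    qed
  qed
  assume "node k j = node k' j'"
  thus "k = k' \<and> j = j'" by (rule *)
qed simp

text \<open>
  The letters are the leaves of a tournament in the order of their insertion. The node \<open>(k, j)\<close>
  covers the leaves from \<open>j * 2 ^ k\<close> up to \<open>(j + 1) * 2 ^ k\<close>. It is in use as soon as
  \<open>2 ^ k\<close> - 1 further letters have been inserted, so that a letter inserted a short time ago lies
  in a small tree only.
\<close>

definition formed :: "nat \<Rightarrow> nat \<Rightarrow> nat \<Rightarrow> bool" where
  "formed m k j \<longleftrightarrow> (j + 2) * 2 ^ k \<le> m + 1"

definition node_ok :: "(nat \<Rightarrow> nat) \<Rightarrow> nat list \<Rightarrow> nat set \<Rightarrow> nat \<Rightarrow> nat \<Rightarrow> bool" where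
  "node_ok V ins S k j \<longleftrightarrow> is_min (V (node k j)) (seg ins S (j * 2 ^ k) ((j + 1) * 2 ^ k))"

text \<open>With \<open>q = (m + 1) div 2 ^ k\<close>, the formed nodes of level \<open>k\<close>
  are those with \<open>j + 2 \<le> q\<close>; the entry is the minimum over all their leaves. At
  level 0 these are all leaves, so \<open>T 0\<close> is the overall minimum.\<close>

definition spine_ok :: "(nat \<Rightarrow> nat) \<Rightarrow> nat list \<Rightarrow> nat set \<Rightarrow> nat \<Rightarrow> bool" where
  "spine_ok T ins S k \<longleftrightarrow>
     is_min (T k) (seg ins S 0 (((length ins + 1) div 2 ^ k - 1) * 2 ^ k))"

lemma node_ok_step:
  assumes "node_ok V ins S k (2 * j)" "node_ok V ins S k (2 * j + 1)" "set ins \<subseteq> {..<N}"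
    and "V' (node (Suc k) j) = best (V (node k (2 * j))) (V (node k (2 * j + 1)))"
  shows "node_ok V' ins S (Suc k) j"
proof -
  have "is_min (best (V (node k (2 * j))) (V (node k (2 * j + 1))))
    (seg ins S (2 * j * 2 ^ k) ((2 * j + 1) * 2 ^ k) \<union> seg ins S ((2 * j + 1) * 2 ^ k) ((2 * j + 1 + 1) * 2 ^ k))"
    using assms(1,2)[unfolded node_ok_def] seg_bound[OF assms(3)] by (intro is_min_best) auto
  also have "seg ins S (2 * j * 2 ^ k) ((2 * j + 1) * 2 ^ k) \<union> seg ins S ((2 * j + 1) * 2 ^ k) ((2 * j + 1 + 1) * 2 ^ k)
    = seg ins S (j * 2 ^ Suc k) ((j + 1) * 2 ^ Suc k)"
    by (subst seg_union) (auto simp: algebra_simps)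
  finally show ?thesis by (simp only: node_ok_def assms(4))
qed

text \<open>Of the \<open>q - 1\<close> formed nodes of level \<open>k\<close>, the first
  \<open>2 * (q div 2 - 1)\<close> are covered by the entry one level up. One or two remain. For
  even \<open>q\<close> both index expressions denote the same node, and taking its minimum twice is
  harmless.\<close>

definition spine_value :: "nat \<Rightarrow> (nat \<Rightarrow> nat) \<Rightarrow> (nat \<Rightarrow> nat) \<Rightarrow> nat \<Rightarrow> nat" where
  "spine_value m V T k = (let q = (m + 1) div 2 ^ k in
     if q < 2 then N else best (best (T (Suc k)) (V (node k (2 * (q div 2 - 1))))) (V (node k (q - 2))))"

lemma spine_ok_step:
  assumes V: "\<And>j. formed (length ins) k j \<Longrightarrow> node_ok V ins S k j" and ins: "set ins \<subseteq> {..<N}"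
    and k: "2 ^ k \<le> length ins + 1"
    and T: "2 ^ Suc k \<le> length ins + 1 \<Longrightarrow> spine_ok T ins S (Suc k)"
    and T': "T' k = spine_value (length ins) V T k"
  shows "spine_ok T' ins S k"
proof -
  define m q where "m = length ins" and "q = (m + 1) div 2 ^ k"
  have q: "q * 2 ^ k \<le> m + 1" by (simp add: q_def)
  have q2: "(m + 1) div 2 ^ Suc k = q div 2" by (simp only: q_def power_Suc2 div_mult2_eq)
  note T' = T'[unfolded spine_value_def Let_def, folded m_def, folded q_def]
  show ?thesis
  proof (cases "q < 2")
    case True
    hence "seg ins S 0 ((q - 1) * 2 ^ k) = {}" by (auto simp: seg_def)
    thus ?thesis using True T' by (simp add: spine_ok_def is_min_def q_def m_def)
  next
    case False
    define h where "h = q div 2"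
    have h: "h \<ge> 1" "2 * h \<le> q" "q \<le> 2 * h + 1" using False by (auto simp: h_def)
    have "2 * 2 ^ k \<le> q * 2 ^ k" using False by (intro mult_le_mono1) simp
    hence "2 ^ Suc k \<le> length ins + 1" using order_trans[OF _ q] by (simp only: power_Suc m_def)
    hence "spine_ok T ins S (Suc k)" by (rule T)
    hence 1: "is_min (T (Suc k)) (seg ins S 0 (2 * (h - 1) * 2 ^ k))"
      unfolding spine_ok_def m_def[symmetric] q2 h_def[symmetric] by (simp add: mult.assoc mult.left_commute)
    have f: "node_ok V ins S k j" if "j + 2 \<le> q" for j
      using order_trans[OF mult_le_mono1[OF that] q] by (intro V) (simp add: formed_def m_def)
    have 2: "is_min (V (node k (2 * (h - 1)))) (seg ins S (2 * (h - 1) * 2 ^ k) ((2 * (h - 1) + 1) * 2 ^ k))"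
      using f[of "2 * (h - 1)"] h by (simp add: node_ok_def)
    have 3: "is_min (V (node k (q - 2))) (seg ins S ((q - 2) * 2 ^ k) ((q - 2 + 1) * 2 ^ k))"
      using f[of "q - 2"] False by (simp add: node_ok_def)
    have "is_min (T' k) (seg ins S 0 (2 * (h - 1) * 2 ^ k) \<union>
      seg ins S (2 * (h - 1) * 2 ^ k) ((2 * (h - 1) + 1) * 2 ^ k) \<union> seg ins S ((q - 2) * 2 ^ k) ((q - 2 + 1) * 2 ^ k))"
      using T' False 1 2 3 seg_bound[OF ins] by (auto simp: h_def intro!: is_min_best)
    also have "seg ins S 0 (2 * (h - 1) * 2 ^ k) \<union>
      seg ins S (2 * (h - 1) * 2 ^ k) ((2 * (h - 1) + 1) * 2 ^ k) = seg ins S 0 ((2 * (h - 1) + 1) * 2 ^ k)"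
      by (rule seg_union) auto
    also have "seg ins S 0 ((2 * (h - 1) + 1) * 2 ^ k) \<union> seg ins S ((q - 2) * 2 ^ k) ((q - 2 + 1) * 2 ^ k)
      = seg ins S 0 ((q - 1) * 2 ^ k)"
    proof (cases "q = 2 * h")
      case True
      hence "2 * (h - 1) + 1 = q - 1" "q - 2 + 1 = q - 1" using h by auto
      thus ?thesis by (auto simp: seg_def)
    next
      case False
      hence "2 * (h - 1) + 1 = q - 2" "q - 2 + 1 = q - 1" using h by auto
      thus ?thesis by (simp only:) (rule seg_union; simp)
    qed
    finally show ?thesis by (simp add: spine_ok_def q_def m_def)
  qed
qed


section \<open>Programs for insertion and removal\<close>

text \<open>
  Conventions of the programs. Field 0 is the output. Field 1 holds for every input the list of
  its occurrences, linked by field 4; fields 2 and 3 hold the parent of a node and the number of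
  signals it waits for. Fields 5 and 6 hold the tournament and its spine, and field 7 the
  insertion time of a letter. Registers 0, 6, 7, 8 are the constants \<open>N\<close>, 1, 2, 0, and
  register 9 counts the insertions.
\<close>

definition node_code :: cmd where
  "node_code = Do (Arith Add 22 17 17) ;; Do (Arith Add 22 22 6) ;; Do (Arith Mul 22 22 15)"

text \<open>Register 15 is \<open>2 ^ k\<close> for the level of the children and register 17 the
  index of the parent. Doubling \<open>node k j\<close> gives \<open>node (Suc k) j\<close>.\<close>

definition recompute_code :: cmd where
  "recompute_code = node_code ;; Do (Arith Add 22 22 22) ;;
     Do (Arith Sub 23 22 15) ;; Do (Get 18 5 23) ;;
     Do (Arith Add 23 22 15) ;; Do (Get 19 5 23) ;;
     min_code ;; Do (Put 5 22 18)"

text \<open>Register 14 is one more than the level treated, so that the descent can stop at 0, while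
  register 15 is the power of two for that level itself.\<close>

definition spine_body :: cmd where
  "spine_body =
     Do (Arith Div 16 24 15) ;;
     If (Less 16 7) (Do (Cpy 18 0))
       (Do (Get 18 6 14) ;;
        Do (Arith Div 17 16 7) ;; Do (Arith Sub 17 17 6) ;; Do (Arith Add 17 17 17) ;;
        node_code ;; Do (Get 19 5 22) ;; min_code ;;
        Do (Arith Sub 17 16 7) ;; node_code ;; Do (Get 19 5 22) ;; min_code) ;;
     Do (Arith Sub 14 14 6) ;; Do (Put 6 14 18) ;; Do (Arith Div 15 15 7)"

definition spine_code :: cmd where
  "spine_code = Do (Arith Add 24 9 6) ;; Do (Arith Add 14 14 6) ;;
     While False (Equal 14 8) spine_body"

text \<open>With \<open>m\<close> earlier insertions, the loop runs once for every factor two of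
  \<open>m + 2\<close>. Only at these levels can a new node meet the condition of
  \<open>formed\<close>, with equality; a quotient below 2 means that there is no such node. Parity
  is tested by doubling the half.\<close>

definition insert_code :: cmd where
  "insert_code =
     Do (Arith Add 22 9 9) ;; Do (Arith Add 22 22 6) ;; Do (Put 5 22 13) ;; Do (Put 7 13 9) ;;
     Do (Arith Add 9 9 6) ;; Do (Cpy 14 8) ;; Do (Cpy 15 6) ;; Do (Arith Add 16 9 6) ;;
     Do (Arith Div 21 16 7) ;; Do (Arith Add 18 21 21) ;;
     While True (Equal 18 16)
       (Do (Arith Add 14 14 6) ;; Do (Cpy 16 21) ;;
        If (Less 16 7) skip_code (Do (Arith Sub 17 16 7) ;; recompute_code) ;;
        Do (Arith Add 15 15 15) ;; Do (Arith Div 21 16 7) ;; Do (Arith Add 18 21 21)) ;;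
     spine_code"

text \<open>The climb continues while the next ancestor is formed, that is, while its index plus 2
  is at most the quotient in register 16. Spine entries above the last formed ancestor do not cover
  the leaf and remain valid.\<close>

definition delete_code :: cmd where
  "delete_code =
     Do (Get 21 7 13) ;;
     Do (Arith Add 22 21 21) ;; Do (Arith Add 22 22 6) ;; Do (Put 5 22 0) ;;
     Do (Cpy 14 8) ;; Do (Cpy 15 6) ;; Do (Arith Add 16 9 6) ;;
     Do (Arith Div 16 16 7) ;; Do (Arith Div 21 21 7) ;; Do (Arith Add 19 21 7) ;;
     While False (Less 16 19)
       (Do (Arith Add 14 14 6) ;; Do (Cpy 17 21) ;; recompute_code ;;
        Do (Arith Add 15 15 15) ;;
        Do (Arith Div 16 16 7) ;; Do (Arith Div 21 21 7) ;; Do (Arith Add 19 21 7)) ;;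
     spine_code"

lemma small: "x \<le> 8 * N + 16 \<Longrightarrow> x < 2 ^ w"
  using room by linarith

lemma wp_node:
  assumes "std R" "(2 * R 17 + 1) * R 15 < 2 ^ w" "R 15 > 0"
  shows "wp node_code Q R G t \<longleftrightarrow> Q (R(22 := (2 * R 17 + 1) * R 15)) G (t + 18)"
proof -
  have "2 * R 17 + 1 \<le> (2 * R 17 + 1) * R 15" using assms(3) by (cases "R 15") auto
  hence "2 * R 17 + 1 < 2 ^ w" using assms(2) by linarith
  moreover have e: "2 * R 17 + 1 = R 17 + R 17 + 1" by simp
  ultimately show ?thesis using assms unfolding node_code_def wp_simps std_def e
    by (simp add: add.commute)
qed

lemma node_bound:
  assumes "(j + 1) * 2 ^ k \<le> m + 1" "m \<le> N"
  shows "node k j < L" "node k j < 2 ^ w"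
proof -
  have "node k j \<le> 2 * ((j + 1) * 2 ^ k)" by (simp add: node_def algebra_simps)
  hence "node k j \<le> 2 * N + 2" using assms by linarith
  thus "node k j < L" "node k j < 2 ^ w" using room small[of "node k j"] by auto
qed

lemma wp_recompute:
  assumes "std R" "R 15 = 2 ^ k" "R 17 = j" "formed m (Suc k) j" "m \<le> N"
    and post: "\<And>R' s. same {18, 19, 20, 22, 23} R R' \<Longrightarrow> s \<le> t + 100 \<Longrightarrow>
      Q R' (G(5 := (G 5)(node (Suc k) j := best (G 5 (node k (2 * j))) (G 5 (node k (2 * j + 1)))))) s"
  shows "wp recompute_code Q R G t"
proof -
  define c where "c = (2 * j + 1) * 2 ^ k"
  have f: "(j + 2) * 2 ^ Suc k \<le> m + 1" using assms(4) by (simp add: formed_def)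
  have c: "node (Suc k) j = c + c" "node k (2 * j) = c + c - 2 ^ k" "node k (2 * j + 1) = c + c + 2 ^ k"
    by (auto simp: node_def c_def algebra_simps)
  have b: "node (Suc k) j < L" "node (Suc k) j < 2 ^ w"
    using node_bound[of j "Suc k" m] f assms(5) by auto
  have b1: "node k (2 * j + 1) < L" "node k (2 * j + 1) < 2 ^ w"
    using node_bound[of "2 * j + 1" k m] f assms(5) by (auto simp: algebra_simps)
  have b0: "node k (2 * j) < L" using c b1 by linarith
  have k: "2 ^ k \<le> c" by (simp add: c_def)
  have e: "(2 * R 17 + 1) * R 15 = c" by (simp only: assms(2,3) c_def)
  show ?thesis
    unfolding recompute_code_def wp_Seq
  proof (subst wp_node)
    show "std R" "R 15 > 0" using assms by auto
    show "(2 * R 17 + 1) * R 15 < 2 ^ w" using b(2) unfolding c e by simp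
    show "wp (Do (Arith Add 22 22 22)) (wp (Do (Arith Sub 23 22 15)) (wp (Do (Get 18 5 23))
      (wp (Do (Arith Add 23 22 15)) (wp (Do (Get 19 5 23)) (wp min_code (wp (Do (Put 5 22 18)) Q))))))
      (R(22 := (2 * R 17 + 1) * R 15)) G (t + 18)"
      using assms(1,2) b b0 b1 k unfolding c e
      apply (simp add: wp_Do)
      apply (rule wp_min)
       apply (simp add: std_def)
      apply (simp add: wp_Do same_def)
      apply (rule post[unfolded c, simplified])
      apply (simp_all add: same_def)
      done
  qed
qed

lemma wp_spine_body:
  assumes "std R" "R 14 = Suc k" "R 15 = 2 ^ k" "R 24 = m + 1" "2 ^ k \<le> m + 1" "m \<le> N"
    and post: "\<And>R' s. same {14..23} R R' \<Longrightarrow> R' 14 = k \<Longrightarrow> R' 15 = 2 ^ k div 2 \<Longrightarrow> s \<le> t + 200 \<Longrightarrow>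
      Q R' (G(6 := (G 6)(k := spine_value m (G 5) (G 6) k))) s"
  shows "wp spine_body Q R G t"
proof -
  let ?tail = "Do (Arith Sub 14 14 6) ;; Do (Put 6 14 18) ;; Do (Arith Div 15 15 7)"
  define q where "q = (m + 1) div 2 ^ k"
  have qd: "Suc m div 2 ^ k = q" by (simp add: q_def)
  have "k < 2 ^ k" by (rule less_exp)
  hence kL: "k < L" "Suc k < L" using assms(5,6) room by linarith+
  have sv: "spine_value m V T k = (if q < 2 then N else
    best (best (T (Suc k)) (V (node k (2 * (q div 2 - 1))))) (V (node k (q - 2))))" for V T
    by (simp only: spine_value_def q_def Let_def)
  have tail: "wp ?tail Q R' G s"
    if "same {14..23} R R'" "R' 14 = Suc k" "R' 15 = 2 ^ k" "R' 18 = spine_value m (G 5) (G 6) k"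
      "s \<le> t + 182" for R' s
  proof -
    have "std R'" using that(1) assms(1) by (auto simp: same_def std_def)
    moreover have "same {14..23} R (R'(14 := k, 15 := 2 ^ k div 2))"
      using that(1) by (auto simp: same_def)
    hence "Q (R'(14 := k, 15 := 2 ^ k div 2)) (G(6 := (G 6)(k := R' 18))) (s + 18)"
      unfolding that(4) by (rule post) (use that(5) in auto)
    ultimately show ?thesis using that(2,3) kL
      unfolding wp_simps by (simp add: std_def add.commute)
  qed
  show ?thesis
  proof (cases "q < 2")
    case True
    have "wp ?tail Q (R(16 := q, 18 := N)) G (14 + t)"
      by (rule tail) (use assms True in \<open>auto simp: same_def sv\<close>)
    thus ?thesis
      using assms(1-4) True unfolding spine_body_def wp_simps by (simp add: std_def qd)
  next
    case False
    define h where "h = q div 2"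
    have h: "h \<ge> 1" "2 * h \<le> q" "q \<ge> 2" using False by (auto simp: h_def)
    have q: "q * 2 ^ k \<le> m + 1" by (simp add: q_def)
    have j: "node k j < L" "node k j < 2 ^ w" if "j + 1 \<le> q" for j
      using node_bound[of j k m] order_trans[OF mult_le_mono1[OF that] q] assms(6) by auto
    have qN: "q \<le> N + 1" using div_le_dividend[of "m + 1" "2 ^ k"] assms(6) unfolding q_def by linarith
    have sm: "h - 1 + (h - 1) < 2 ^ w" using qN h small by auto
    define j1 where "j1 = 2 * (h - 1)"
    have j1: "node k j1 < L" "node k j1 < 2 ^ w" "node k (q - 2) < L" "node k (q - 2) < 2 ^ w"
      using j[of j1] j[of "q - 2"] h by (auto simp: j1_def)
    let ?R1 = "R(16 := q, 18 := G 6 (Suc k), 17 := j1)"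
    have rest2: "wp (Do (Arith Sub 17 16 7)) (wp node_code (wp (Do (Get 19 5 22)) (wp min_code (wp ?tail Q)))) R' G s"
      if R': "same {14..23} R R'" "R' 14 = Suc k" "R' 15 = 2 ^ k" "R' 16 = q"
        "R' 18 = best (G 6 (Suc k)) (G 5 (node k j1))" "s \<le> t + 100" for R' s
    proof -
      have std: "std R'" using R'(1) assms(1) by (auto simp: same_def std_def)
      let ?R2 = "R'(17 := q - 2)" 
      let ?R3 = "?R2(22 := node k (q - 2))"
      let ?R4 = "?R3(19 := G 5 (node k (q - 2)))"
      have "wp min_code (wp ?tail Q) ?R4 G (30 + s)"
      proof (rule wp_min)
        show "std ?R4" using std by (simp add: std_def)
        fix R5 s5
        assume 5: "same {18, 20} ?R4 R5" "R5 18 = best (?R4 18) (?R4 19)" "s5 \<le> 30 + s + 20"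
        show "wp ?tail Q R5 G s5"
        proof (rule tail)
          show "same {14..23} R R5" using R'(1) 5(1) by (auto simp: same_def)
          show "R5 14 = Suc k" "R5 15 = 2 ^ k" using R' 5(1) by (auto simp: same_def)
          show "R5 18 = spine_value m (G 5) (G 6) k" using 5(2) R' False by (simp add: sv j1_def h_def)
          show "s5 \<le> t + 182" using 5(3) R' by simp
        qed
      qed
      hence "wp (Do (Get 19 5 22)) (wp min_code (wp ?tail Q)) ?R3 G (24 + s)"
        using j1 by (simp add: wp_Do)
      moreover have "(2 * (q - 2) + 1) * 2 ^ k = node k (q - 2)" by (simp add: node_def)
      ultimately have "wp node_code (wp (Do (Get 19 5 22)) (wp min_code (wp ?tail Q))) ?R2 G (s + 6)"
        using std R' j1 by (subst wp_node) (simp_all add: std_def)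
      thus ?thesis using std R' h by (simp add: wp_Do std_def)
    qed
    let ?R2 = "?R1(22 := node k j1)"
    let ?R3 = "?R2(19 := G 5 (node k j1))"
    have "wp min_code (wp (Do (Arith Sub 17 16 7)) (wp node_code (wp (Do (Get 19 5 22)) (wp min_code (wp ?tail Q))))) ?R3 G (56 + t)"
    proof (rule wp_min)
      show "std ?R3" using assms(1) by (simp add: std_def)
      fix R5 s5
      assume 5: "same {18, 20} ?R3 R5" "R5 18 = best (?R3 18) (?R3 19)" "s5 \<le> 56 + t + 20"
      show "wp (Do (Arith Sub 17 16 7)) (wp node_code (wp (Do (Get 19 5 22)) (wp min_code (wp ?tail Q)))) R5 G s5"
        by (rule rest2) (use 5 assms in \<open>auto simp: same_def\<close>)
    qed
    hence "wp (Do (Get 19 5 22)) (wp min_code (wp (Do (Arith Sub 17 16 7)) (wp node_code (wp (Do (Get 19 5 22)) (wp min_code (wp ?tail Q)))))) ?R2 G (50 + t)"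
      using j1 by (simp add: wp_Do)
    moreover have "(2 * j1 + 1) * 2 ^ k = node k j1" by (simp add: node_def)
    ultimately have "wp node_code (wp (Do (Get 19 5 22)) (wp min_code (wp (Do (Arith Sub 17 16 7)) (wp node_code (wp (Do (Get 19 5 22)) (wp min_code (wp ?tail Q))))))) ?R1 G (32 + t)"
      using assms(1,3) j1 by (subst wp_node) (simp_all add: std_def)
    moreover have "R(16 := q, 18 := G 6 (Suc k), 17 := h - Suc 0 + (h - Suc 0)) = ?R1" by (simp add: j1_def mult_2)
    ultimately show ?thesis
      using assms(1-4) False kL h sm
      unfolding spine_body_def wp_Seq wp_If
      by (simp add: wp_Do std_def qd flip: h_def)
  qed
qed


section \<open>Correctness and cost of the tournament operations\<close>

definition heap_ok :: "nat list \<Rightarrow> nat set \<Rightarrow> (nat \<Rightarrow> nat \<Rightarrow> nat) \<Rightarrow> bool" where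
  "heap_ok ins S G \<longleftrightarrow> distinct ins \<and> set ins \<subseteq> {..<N} \<and> S \<subseteq> set ins \<and>
     (\<forall>j<length ins. G 7 (ins ! j) = j) \<and>
     (\<forall>k j. formed (length ins) k j \<longrightarrow> node_ok (G 5) ins S k j) \<and>
     (\<forall>k. 2 ^ k \<le> length ins + 1 \<longrightarrow> spine_ok (G 6) ins S k)"

lemma length_ins:
  assumes "distinct ins" "set ins \<subseteq> {..<N}"
  shows "length ins \<le> N"
  using card_mono[OF _ assms(2)] distinct_card[OF assms(1)] by simp

text \<open>Entries above level \<open>k\<close> are taken over from the previous state. This makes
  the cost proportional to \<open>k\<close> instead of the height of the tournament.\<close>

lemma wp_spine:
  assumes R: "std R" "R 9 = length ins" "R 14 = k" "R 15 = 2 ^ k" "2 ^ k \<le> length ins + 1"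
    and ins: "distinct ins" "set ins \<subseteq> {..<N}"
    and V: "\<And>k j. formed (length ins) k j \<Longrightarrow> node_ok (G 5) ins S k j"
    and T: "\<And>k'. k < k' \<Longrightarrow> 2 ^ k' \<le> length ins + 1 \<Longrightarrow> spine_ok (G 6) ins S k'"
    and post: "\<And>R' T s. same {14..24} R R' \<Longrightarrow>
      (\<And>k'. 2 ^ k' \<le> length ins + 1 \<Longrightarrow> spine_ok T ins S k') \<Longrightarrow>
      s \<le> t + 300 + 300 * k \<Longrightarrow> Q R' (G(6 := T)) s"
  shows "wp spine_code Q R G t"
proof -
  define m where "m = length ins"
  have mN: "m \<le> N" using length_ins[OF ins] by (simp add: m_def)
  \<comment> \<open>Register 15 is described only while a level remains, because the last halving
    turns 1 into 0.\<close>
  define J where "J R1 G1 t1 \<longleftrightarrow> (\<exists>k1 T1. G1 = G(6 := T1) \<and> R1 14 = k1 \<and> k1 \<le> k + 1 \<and>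
    (\<forall>i. k1 = Suc i \<longrightarrow> R1 15 = 2 ^ i) \<and> R1 24 = m + 1 \<and> same {14..24} R R1 \<and>
    (\<forall>k'. k1 \<le> k' \<and> 2 ^ k' \<le> m + 1 \<longrightarrow> spine_ok T1 ins S k') \<and> t1 + 210 * k1 \<le> t + 222 + 210 * k)"
    for R1 :: "nat \<Rightarrow> nat" and G1 :: "nat \<Rightarrow> nat \<Rightarrow> nat" and t1 :: nat
  have loop: "wp (While False (Equal 14 8) spine_body) Q (R(24 := m + 1, 14 := k + 1)) G (12 + t)"
  proof (rule wp_While[where J = J and m = "\<lambda>R G. R 14"])
    show "J (R(24 := m + 1, 14 := k + 1)) G (12 + t)"
      unfolding J_def
      by (rule exI[of _ "k + 1"], rule exI[of _ "G 6"]) (use R T in \<open>auto simp: same_def m_def\<close>)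
  next
    fix R1 :: "nat \<Rightarrow> nat" and G1 :: "nat \<Rightarrow> nat \<Rightarrow> nat" and t1 :: nat
    assume "J R1 G1 t1" and c: "holds_test (Equal 14 8) R1 = False"
    then obtain k1 T1 where J: "G1 = G(6 := T1)" "R1 14 = k1" "k1 \<le> k + 1"
      "\<And>i. k1 = Suc i \<Longrightarrow> R1 15 = 2 ^ i" "R1 24 = m + 1" "same {14..24} R R1"
      "\<And>k'. k1 \<le> k' \<Longrightarrow> 2 ^ k' \<le> m + 1 \<Longrightarrow> spine_ok T1 ins S k'" "t1 + 210 * k1 \<le> t + 222 + 210 * k"
      unfolding J_def by auto
    have std: "std R1" using same_std[OF J(6) _ R(1)] by simp
    then obtain i where i: "k1 = Suc i" using c J(2) by (cases k1) (auto simp: std_def)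
    have "(2::nat) ^ i \<le> 2 ^ k" using J(3) i by (intro power_increasing) auto
    hence im: "2 ^ i \<le> m + 1" using R(5) unfolding m_def by linarith
    show "wp spine_body (\<lambda>R' G' t'. J R' G' t' \<and> R' 14 < R1 14) R1 G1 (t1 + 3)"
    proof (rule wp_spine_body[OF std _ _ J(5) im mN])
      show "R1 14 = Suc i" "R1 15 = 2 ^ i" using J i by auto
      fix R' s assume *: "same {14..23} R1 R'" "R' 14 = i" "R' 15 = 2 ^ i div 2" "s \<le> t1 + 3 + 200"
      define T2 where "T2 = T1(i := spine_value m (G 5) T1 i)"
      have "spine_ok T2 ins S k'" if "i \<le> k'" "2 ^ k' \<le> m + 1" for k'
      proof (cases "k' = i")
        case True
        show ?thesis unfolding True
          by (rule spine_ok_step[OF V ins(2)]) (use im J(7) i in \<open>auto simp: m_def T2_def\<close>)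
      next
        case False
        thus ?thesis using J(7)[of k'] that i by (simp add: spine_ok_def T2_def)
      qed
      moreover have "G1(6 := (G1 6)(i := spine_value m (G1 5) (G1 6) i)) = G(6 := T2)"
        using J(1) by (simp add: T2_def)
      moreover have "R' 24 = m + 1" "same {14..24} R R'" using *(1) J(5,6) by (auto simp: same_def)
      ultimately have "J R' (G1(6 := (G1 6)(i := spine_value m (G1 5) (G1 6) i))) s"
        unfolding J_def using * J i by (intro exI[of _ i] exI[of _ T2]) auto
      thus "J R' (G1(6 := (G1 6)(i := spine_value m (G1 5) (G1 6) i))) s \<and> R' 14 < R1 14"
        using * J i by simp
    qed
  next
    fix R1 :: "nat \<Rightarrow> nat" and G1 :: "nat \<Rightarrow> nat \<Rightarrow> nat" and t1 :: nat
    assume "J R1 G1 t1" and c: "holds_test (Equal 14 8) R1 \<noteq> False"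
    then obtain k1 T1 where J: "G1 = G(6 := T1)" "R1 14 = k1" "same {14..24} R R1"
      "\<And>k'. k1 \<le> k' \<Longrightarrow> 2 ^ k' \<le> m + 1 \<Longrightarrow> spine_ok T1 ins S k'" "t1 + 210 * k1 \<le> t + 222 + 210 * k"
      unfolding J_def by auto
    have "std R1" using same_std[OF J(3) _ R(1)] by simp
    hence "k1 = 0" using c J(2) by (simp add: std_def)
    thus "Q R1 G1 (t1 + 2)" unfolding J(1) using J by (intro post) (auto simp: m_def)
  qed
  have "k < 2 ^ k" by (rule less_exp)
  hence "k \<le> m" using R(5) unfolding m_def by linarith
  hence "m + 1 < 2 ^ w" "k + 1 < 2 ^ w" using mN small by auto
  thus ?thesis using loop R unfolding spine_code_def wp_simps
    by (simp add: std_def m_def)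
qed

lemma pow_cancel: "a * 2 ^ k \<le> b * 2 ^ k \<Longrightarrow> a \<le> (b::nat)"
  by simp

lemma seg_append: "hi \<le> length ins \<Longrightarrow> x \<notin> set ins \<Longrightarrow> seg (ins @ [x]) (insert x S) lo hi = seg ins S lo hi"
  unfolding seg_def by (auto simp: nth_append)

lemma seg_remove:
  assumes "distinct ins" "j < length ins" "j < lo \<or> hi \<le> j"
  shows "seg ins (S - {ins ! j}) lo hi = seg ins S lo hi"
  unfolding seg_def using assms by (auto simp: nth_eq_iff_index_eq)

lemma formed_bound: "formed m k j \<Longrightarrow> (j + 1) * 2 ^ k \<le> m"
proof -
  assume "formed m k j"
  hence "(j + 1) * 2 ^ k + 2 ^ k \<le> m + 1" by (simp add: formed_def algebra_simps)
  thus ?thesis using one_le_power[of "2::nat" k] by linarith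
qed

text \<open>The work follows a carry: \<open>k\<close> levels are touched only if
  \<open>2 ^ k\<close> divides \<open>length ins + 2\<close>. The divisibility is exported so that
  \<open>popcount_carry\<close> can amortise the cost.\<close>

lemma wp_insert:
  assumes R: "std R" "R 9 = length ins" "R 13 = x" and x: "x \<notin> set ins" "x < N"
    and H: "heap_ok ins S G"
    and post: "\<And>R' G' s k. same (insert 9 {14..24}) R R' \<Longrightarrow> R' 9 = length ins + 1 \<Longrightarrow>
      heap_ok (ins @ [x]) (insert x S) G' \<Longrightarrow> (\<And>f. f \<notin> {5, 6, 7} \<Longrightarrow> G' f = G f) \<Longrightarrow>
      2 ^ k dvd length ins + 2 \<Longrightarrow> s \<le> t + 500 + 500 * k \<Longrightarrow> Q R' G' s"
  shows "wp insert_code Q R G t"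
proof -
  define m where "m = length ins"
  let ?ins = "ins @ [x]" and ?S = "insert x S"
  have ins: "distinct ?ins" "set ?ins \<subseteq> {..<N}" "?S \<subseteq> set ?ins" "distinct ins" "set ins \<subseteq> {..<N}"
    using H x by (auto simp: heap_ok_def)
  have mN: "m + 1 \<le> N" using length_ins[OF ins(1,2)] by (simp add: m_def)
  define G0 where "G0 = G(5 := (G 5)(node 0 m := x), 7 := (G 7)(x := m))"
  have keep: "node_ok V ?ins ?S k j" if "node_ok V ins S k j" "formed m k j" for V k j
    using that formed_bound[OF that(2)] seg_append[OF _ x(1), of _ S]
    by (simp add: node_ok_def m_def)
  have "seg ?ins ?S m (m + 1) = {x}" by (auto simp: seg_def m_def nth_append)
  hence leaf: "node_ok (G0 5) ?ins ?S 0 m" by (simp add: node_ok_def G0_def is_min_def)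
  have old: "node_ok (G0 5) ?ins ?S k j" if "formed m k j" for k j
  proof -
    have "k \<noteq> 0 \<or> j \<noteq> m" using formed_bound[OF that] by (cases "k = 0") auto
    hence "G0 5 (node k j) = G 5 (node k j)" by (auto simp: G0_def node_inject)
    moreover have "node_ok (G 5) ins S k j" using H that by (simp add: heap_ok_def m_def)
    hence "node_ok (G 5) ?ins ?S k j" using keep that by blast
    ultimately show ?thesis by (simp add: node_ok_def)
  qed
  define body where "body =
       Do (Arith Add 14 14 6) ;; Do (Cpy 16 21) ;;
        If (Less 16 7) skip_code (Do (Arith Sub 17 16 7) ;; recompute_code) ;;
        Do (Arith Add 15 15 15) ;; Do (Arith Div 21 16 7) ;; Do (Arith Add 18 21 21)"
  define J where "J R1 G1 t1 \<longleftrightarrow> (\<exists>k V. G1 = G0(5 := V) \<and> R1 14 = k \<and> R1 15 = 2 ^ k \<and> 2 ^ k dvd m + 2 \<and>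
     R1 16 = (m + 2) div 2 ^ k \<and> R1 21 = R1 16 div 2 \<and> R1 18 = R1 21 + R1 21 \<and> R1 9 = m + 1 \<and>
     same (insert 9 {14..24}) R R1 \<and>
     (\<forall>k' j. formed (m + 1) k' j \<and> (k' \<le> k \<or> formed m k' j) \<longrightarrow> node_ok V ?ins ?S k' j) \<and>
     t1 \<le> t + 60 + 170 * k)"
    for R1 :: "nat \<Rightarrow> nat" and G1 :: "nat \<Rightarrow> nat \<Rightarrow> nat" and t1 :: nat
  have loop: "wp (While True (Equal 18 16) body) (wp spine_code Q) R1 G1 t1" if "J R1 G1 t1" for R1 G1 t1
  proof (rule wp_While[where J = J and m = "\<lambda>R G. R 16"])
    show "J R1 G1 t1" by fact
  next
    fix R1 :: "nat \<Rightarrow> nat" and G1 :: "nat \<Rightarrow> nat \<Rightarrow> nat" and t1 :: nat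
    assume "J R1 G1 t1" and c: "holds_test (Equal 18 16) R1 = True"
    then obtain k V where J: "G1 = G0(5 := V)" "R1 14 = k" "R1 15 = 2 ^ k" "2 ^ k dvd m + 2"
     "R1 16 = (m + 2) div 2 ^ k" "R1 21 = R1 16 div 2" "R1 18 = R1 21 + R1 21" "R1 9 = m + 1"
     "same (insert 9 {14..24}) R R1"
     "\<forall>k' j. formed (m + 1) k' j \<and> (k' \<le> k \<or> formed m k' j) \<longrightarrow> node_ok V ?ins ?S k' j"
     "t1 \<le> t + 60 + 170 * k"
      unfolding J_def by blast
    have J10: "formed (m + 1) k' j \<Longrightarrow> k' \<le> k \<or> formed m k' j \<Longrightarrow> node_ok V ?ins ?S k' j" for k' j
      using J(10) by blast
    have std: "std R1" using same_std[OF J(9) _ R(1)] by simp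
    define h where "h = R1 21"
    have q: "R1 16 = h + h" using c J(7) by (simp add: h_def)
    have "m + 2 = (h + h) * 2 ^ k" using J(4,5) q by (metis dvd_div_mult_self)
    hence mh: "m + 2 = h * 2 ^ Suc k" by (simp add: algebra_simps)
    have h0: "h > 0" using mh by (cases h) auto
    have hm: "h \<le> m + 2" "2 ^ Suc k \<le> m + 2" "k < m + 2"
    proof -
      show "h \<le> m + 2" unfolding mh by simp
      show 1: "2 ^ Suc k \<le> m + 2" unfolding mh using h0 by simp
      have "k < 2 ^ k" by (rule less_exp)
      thus "k < m + 2" using 1 unfolding power_Suc by linarith
    qed
    have hdiv: "(m + 2) div 2 ^ Suc k = h" unfolding mh by simp
    have sm: "h < 2 ^ w" "h div 2 + h div 2 < 2 ^ w" "2 ^ k + 2 ^ k < (2::nat) ^ w" "k + 1 < 2 ^ w"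
      using hm mN by (auto intro!: small)
    let ?R2 = "R1(14 := k + 1, 16 := h)"
    let ?fin = "Do (Arith Add 15 15 15) ;; Do (Arith Div 21 16 7) ;; Do (Arith Add 18 21 21)"
    let ?P = "\<lambda>R' G' t'. J R' G' t' \<and> R' 16 < R1 16"
    have fin: "wp ?fin ?P R' (G0(5 := V')) s"
      if R': "same {17, 18, 19, 20, 22, 23} ?R2 R'" "s \<le> t1 + 140"
        and V': "\<And>j. formed (m + 1) (Suc k) j \<Longrightarrow> node_ok V' ?ins ?S (Suc k) j"
          "\<And>k' j. k' \<noteq> Suc k \<or> j + 2 < h \<Longrightarrow> V' (node k' j) = V (node k' j)" for R' V' s
    proof -
      let ?R3 = "R'(15 := 2 ^ k + 2 ^ k, 21 := h div 2, 18 := h div 2 + h div 2)"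
      have r: "R' 14 = k + 1" "R' 15 = 2 ^ k" "R' 16 = h" "R' 9 = m + 1" "R' 7 = 2"
        using R' J std by (auto simp: same_def std_def)
      have "node_ok V' ?ins ?S k' j"
        if f: "formed (m + 1) k' j" "k' \<le> Suc k \<or> formed m k' j" for k' j
      proof (cases "k' = Suc k")
        case True
        thus ?thesis using V'(1) f by simp
      next
        case False
        hence "k' \<le> k \<or> formed m k' j" using f by auto
        thus ?thesis using J10[OF f(1)] V'(2)[of k' j] False by (simp add: node_ok_def)
      qed
      moreover have "same (insert 9 {14..24}) R ?R3" using R'(1) J(9) by (auto simp: same_def)
      ultimately have "J ?R3 (G0(5 := V')) (s + 18)"
        unfolding J_def using r R'(2) J(11) hdiv mh
        by (intro exI[of _ "Suc k"] exI[of _ V']) auto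
      thus ?thesis using r sm h0 q unfolding wp_simps by (simp add: add.commute)
    qed
    have "wp (If (Less 16 7) skip_code (Do (Arith Sub 17 16 7) ;; recompute_code)) (wp ?fin ?P)
      ?R2 G1 (t1 + 15)"
    proof (cases "h < 2")
      case True
      \<comment> \<open>Here \<open>h = 1\<close>, so \<open>m + 2\<close> is exactly
        \<open>2 ^ Suc k\<close>, while the first node of this level needs twice as much.\<close>
      have "\<not> formed (m + 1) (Suc k) j" for j
      proof
        assume "formed (m + 1) (Suc k) j"
        hence "(j + 2) * 2 ^ Suc k \<le> h * 2 ^ Suc k" using mh by (simp add: formed_def)
        hence "j + 2 \<le> h" by (rule pow_cancel)
        thus False using True by simp
      qed
      hence "wp ?fin ?P ?R2 G1 (t1 + 23)" unfolding J(1)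
        by (intro fin) (auto simp: same_def)
      moreover have "?R2 16 < ?R2 7" using std True by (simp add: std_def)
      ultimately show ?thesis unfolding wp_If wp_skip by (simp add: add.commute)
    next
      case False
      let ?R3 = "?R2(17 := h - 2)"
      have "wp recompute_code (wp ?fin ?P) ?R3 G1 (t1 + 23)"
      proof (rule wp_recompute[where k = k and j = "h - 2" and m = "m + 1"])
        show "std ?R3" using std by (simp add: std_def)
        show "formed (m + 1) (Suc k) (h - 2)" unfolding formed_def using mh False
          by (subst le_add_diff_inverse2) auto
        show "?R3 15 = 2 ^ k" "?R3 17 = h - 2" "m + 1 \<le> N" using J mN by auto
        fix R' s assume *: "same {18, 19, 20, 22, 23} ?R3 R'" "s \<le> t1 + 23 + 100"
        define V' where "V' = V(node (Suc k) (h - 2) := best (V (node k (2 * (h - 2)))) (V (node k (2 * (h - 2) + 1))))"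
        have G': "G1(5 := (G1 5)(node (Suc k) (h - 2) :=
            best (G1 5 (node k (2 * (h - 2)))) (G1 5 (node k (2 * (h - 2) + 1))))) = G0(5 := V')"
          using J(1) by (simp add: V'_def)
        show "wp ?fin ?P R' (G1(5 := (G1 5)(node (Suc k) (h - 2) :=
            best (G1 5 (node k (2 * (h - 2)))) (G1 5 (node k (2 * (h - 2) + 1)))))) s"
          unfolding G'
        proof (rule fin)
          show "same {17, 18, 19, 20, 22, 23} ?R2 R'" "s \<le> t1 + 140" using * by (auto simp: same_def)
          show "V' (node k' j) = V (node k' j)" if "k' \<noteq> Suc k \<or> j + 2 < h" for k' j
            using that by (auto simp: V'_def node_inject)
          show "node_ok V' ?ins ?S (Suc k) j" if f: "formed (m + 1) (Suc k) j" for j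
          proof (cases "j = h - 2")
            case True
            have "(2 * j + 1 + 2) * 2 ^ k \<le> m + 2" unfolding mh using True False
              by (simp add: algebra_simps)
            hence "formed (m + 1) k (2 * j)" "formed (m + 1) k (2 * j + 1)"
              by (auto simp: formed_def algebra_simps)
            hence "node_ok V ?ins ?S k (2 * j)" "node_ok V ?ins ?S k (2 * j + 1)" using J10 by auto
            thus ?thesis using ins(2) True
              by (intro node_ok_step[of V ?ins ?S k j V']) (auto simp: V'_def)
          next
            case False
            have "(j + 2) * 2 ^ Suc k \<le> h * 2 ^ Suc k" using f mh by (simp add: formed_def)
            hence "j + 2 \<le> h" by (rule pow_cancel)
            hence j: "j + 3 \<le> h" using False by simp
            have "(j + 2) * 2 ^ Suc k + 2 ^ Suc k \<le> m + 2"
              unfolding mh using mult_le_mono1[OF j, of "2 ^ Suc k"] by (simp add: algebra_simps)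
            moreover have "1 \<le> (2::nat) ^ Suc k" by (rule one_le_power) simp
            ultimately have "formed m (Suc k) j" unfolding formed_def by linarith
            hence "node_ok V ?ins ?S (Suc k) j" using J10 f by blast
            moreover have "j \<noteq> h - 2" using j by linarith
            hence "V' (node (Suc k) j) = V (node (Suc k) j)" by (simp add: V'_def node_inject)
            ultimately show ?thesis by (simp add: node_ok_def)
          qed
        qed
      qed
      moreover have "?R2 7 = 2" "?R2 16 = h" using std by (auto simp: std_def)
      ultimately show ?thesis using False unfolding wp_simps by (simp add: add.commute)
    qed
    thus "wp body ?P R1 G1 (t1 + 3)" using J std sm unfolding body_def wp_Seq wp_Do
      by (simp add: std_def h_def[symmetric] add.commute)
  next
    fix R1 :: "nat \<Rightarrow> nat" and G1 :: "nat \<Rightarrow> nat \<Rightarrow> nat" and t1 :: nat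
    assume "J R1 G1 t1" and c: "holds_test (Equal 18 16) R1 \<noteq> True"
    then obtain k V where J: "G1 = G0(5 := V)" "R1 14 = k" "R1 15 = 2 ^ k" "2 ^ k dvd m + 2"
     "R1 16 = (m + 2) div 2 ^ k" "R1 21 = R1 16 div 2" "R1 18 = R1 21 + R1 21" "R1 9 = m + 1"
     "same (insert 9 {14..24}) R R1"
     "\<forall>k' j. formed (m + 1) k' j \<and> (k' \<le> k \<or> formed m k' j) \<longrightarrow> node_ok V ?ins ?S k' j"
     "t1 \<le> t + 60 + 170 * k"
      unfolding J_def by blast
    have J10: "formed (m + 1) k' j \<Longrightarrow> k' \<le> k \<or> formed m k' j \<Longrightarrow> node_ok V ?ins ?S k' j" for k' j
      using J(10) by blast
    have std: "std R1" using same_std[OF J(9) _ R(1)] by simp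
    have odd: "\<not> 2 dvd (m + 2) div 2 ^ k" using c J by auto
    have nd: "\<not> 2 ^ k' dvd m + 2" if "k < k'" for k'
    proof
      assume "2 ^ k' dvd m + 2"
      hence "2 ^ Suc k dvd m + 2" using that by (meson Suc_leI le_imp_power_dvd dvd_trans)
      then obtain z where "m + 2 = 2 ^ Suc k * z" by blast
      hence "(m + 2) div 2 ^ k = 2 * z" by simp
      thus False using odd by simp
    qed
    have V: "node_ok V ?ins ?S k' j" if f: "formed (m + 1) k' j" for k' j
    proof (cases "k' \<le> k")
      case False
      \<comment> \<open>A node that is formed now but was not before would meet its bound with
        equality, which is impossible above the carry.\<close>
      hence "m + 2 \<noteq> (j + 2) * 2 ^ k'" using nd[of k'] by (metis dvd_triv_right not_le)
      hence "formed m k' j" using f unfolding formed_def by linarith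
      thus ?thesis using J10 f by blast
    qed (use J10 f in blast)
    \<comment> \<open>Above the carry the quotient is the same as before the insertion, so the entry
      covers the same old leaves.\<close>
    have T: "spine_ok (G 6) ?ins ?S k'" if k': "k < k'" "2 ^ k' \<le> m + 2" for k'
    proof -
      have "(m + 2) div 2 ^ k' = (m + 1) div 2 ^ k'"
        using nd[OF k'(1)] by (simp add: div_Suc dvd_eq_mod_eq_0)
      moreover have "2 ^ k' \<noteq> m + 2" using nd[OF k'(1)] by auto
      hence "spine_ok (G 6) ins S k'" using k'(2) H by (simp add: heap_ok_def m_def)
      moreover have "((m + 1) div 2 ^ k' - 1) * 2 ^ k' \<le> m"
      proof -
        define d where "d = (m + 1) div 2 ^ k'"
        have d: "d * 2 ^ k' \<le> m + 1" by (simp only: d_def div_times_less_eq_dividend)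
        have "1 \<le> (2::nat) ^ k'" by (rule one_le_power) simp
        moreover have "d = 0 \<or> (d - 1) * 2 ^ k' + 2 ^ k' \<le> m + 1" using d by (cases d) auto
        ultimately show ?thesis unfolding d_def[symmetric]
          by (elim disjE) (simp, linarith)
      qed
      ultimately show ?thesis unfolding spine_ok_def using seg_append[OF _ x(1)] by (simp add: m_def)
    qed
    show "wp spine_code Q R1 G1 (t1 + 2)"
    proof (rule wp_spine[where ins = ?ins and S = ?S and k = k])
      show "std R1" "R1 9 = length ?ins" "R1 14 = k" "R1 15 = 2 ^ k" "distinct ?ins" "set ?ins \<subseteq> {..<N}"
        using std J ins by (auto simp: m_def)
      show "2 ^ k \<le> length ?ins + 1" using dvd_imp_le[OF J(4)] by (simp add: m_def)
      show "node_ok (G1 5) ?ins ?S k j" if "formed (length ?ins) k j" for k j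
        using V that J(1) by (simp add: m_def)
      show "spine_ok (G1 6) ?ins ?S k'" if "k < k'" "2 ^ k' \<le> length ?ins + 1" for k'
        using T that J(1) by (simp add: m_def G0_def)
      fix R' T s
      assume *: "same {14..24} R1 R'" "\<And>k'. 2 ^ k' \<le> length ?ins + 1 \<Longrightarrow> spine_ok T ?ins ?S k'"
        "s \<le> t1 + 2 + 300 + 300 * k"
      show "Q R' (G1(6 := T)) s"
      proof (rule post)
        show "same (insert 9 {14..24}) R R'" "R' 9 = length ins + 1"
          using *(1) J(8,9) by (auto simp: same_def m_def)
        show "2 ^ k dvd length ins + 2" "s \<le> t + 500 + 500 * k" using J *(3) by (auto simp: m_def)
        show "(G1(6 := T)) f = G f" if "f \<notin> {5, 6, 7}" for f using that J(1) by (simp add: G0_def)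
        have "G0 7 (?ins ! j) = j" if "j < length ?ins" for j
        proof (cases "j < m")
          case True
          hence "ins ! j \<noteq> x" using x(1) by (metis m_def nth_mem)
          thus ?thesis using True H by (simp add: G0_def heap_ok_def m_def nth_append)
        qed (use that in \<open>simp add: G0_def m_def nth_append not_less\<close>)
        thus "heap_ok ?ins ?S (G1(6 := T))"
          unfolding heap_ok_def using ins V *(2) J(1) by (auto simp: m_def)
      qed
    qed
  qed
  let ?R1 = "R(22 := m + m + 1, 9 := m + 1, 14 := 0, 15 := 1, 16 := m + 2, 21 := (m + 2) div 2,
    18 := (m + 2) div 2 + (m + 2) div 2)"
  have "J ?R1 G0 (t + 60)"
    unfolding J_def
  proof (rule exI[of _ 0], rule exI[of _ "G0 5"], intro conjI)
    show "\<forall>k' j. formed (m + 1) k' j \<and> (k' \<le> 0 \<or> formed m k' j) \<longrightarrow> node_ok (G0 5) ?ins ?S k' j"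
    proof (intro allI impI)
      fix k' j assume *: "formed (m + 1) k' j \<and> (k' \<le> 0 \<or> formed m k' j)"
      show "node_ok (G0 5) ?ins ?S k' j"
      proof (cases "formed m k' j")
        case False
        hence "k' = 0" "j = m" using * by (auto simp: formed_def)
        thus ?thesis using leaf by simp
      qed (rule old)
    qed
  qed (auto simp: same_def)
  from loop[OF this]
  have "wp (While True (Equal 18 16) body) (wp spine_code Q) ?R1 G0 (60 + t)" by (simp add: add.commute)
  moreover have "node 0 m = m + m + 1" by (simp add: node_def)
  moreover have "m + m + 1 < L" "m + m + 1 < 2 ^ w" "m + 2 < 2 ^ w" "(m + 2) div 2 + (m + 2) div 2 < 2 ^ w"
    "x < L"
    using mN room x(2) small by auto
  ultimately show ?thesis
    using R x(2) unfolding insert_code_def body_def[symmetric] wp_Seq wp_Do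
    by (simp add: std_def m_def[symmetric] G0_def)
qed


text \<open>A parent is never in use before its children. The formed ancestors of a leaf are
  therefore an initial piece of its path upwards, and the climb may stop at the first unformed
  one.\<close>

lemma formed_parent:
  assumes "formed m (Suc k) (j div 2 ^ Suc k)"
  shows "formed m k (j div 2 ^ k)"
proof -
  define i where "i = j div 2 ^ k"
  have "j div 2 ^ Suc k = i div 2" by (simp only: i_def power_Suc2 div_mult2_eq)
  hence "(2 * (i div 2 + 2)) * 2 ^ k \<le> m + 1" using assms by (simp add: formed_def mult_ac)
  moreover have "i + 2 \<le> 2 * (i div 2 + 2)" by presburger
  hence "(i + 2) * 2 ^ k \<le> (2 * (i div 2 + 2)) * 2 ^ k" by (rule mult_le_mono1)
  ultimately show ?thesis unfolding formed_def i_def by linarith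
qed

lemma formed_ancestor:
  assumes "formed m k' (j div 2 ^ k')" "k \<le> k'"
  shows "formed m k (j div 2 ^ k)"
  using assms(2,1) by (induction rule: inc_induct) (auto intro: formed_parent)

text \<open>A formed ancestor at level \<open>k\<close> had to wait for \<open>2 ^ k - 1\<close>
  insertions after its last leaf, hence \<open>2 ^ k \<le> length ins - j\<close>. This ties the
  cost of a removal to the age of the letter.\<close>

lemma wp_delete:
  assumes R: "std R" "R 9 = length ins" "R 13 = ins ! j" and j: "j < length ins"
    and H: "heap_ok ins S G"
    and post: "\<And>R' G' s k. same {14..24} R R' \<Longrightarrow>
      heap_ok ins (S - {ins ! j}) G' \<Longrightarrow> (\<And>f. f \<notin> {5, 6} \<Longrightarrow> G' f = G f) \<Longrightarrow>
      2 ^ k \<le> length ins - j \<Longrightarrow> s \<le> t + 500 + 500 * k \<Longrightarrow> Q R' G' s"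
  shows "wp delete_code Q R G t"
proof -
  define m x where "m = length ins" and "x = ins ! j"
  let ?S = "S - {ins ! j}"
  have ins: "distinct ins" "set ins \<subseteq> {..<N}" "S \<subseteq> set ins" using H by (auto simp: heap_ok_def)
  have mN: "m \<le> N" "j < m" using length_ins[OF ins(1,2)] j by (auto simp: m_def)
  have x: "x < N" using subsetD[OF ins(2) nth_mem[OF j]] by (simp add: x_def)
  have pos: "G 7 x = j" using H j by (simp add: heap_ok_def x_def)
  define V0 where "V0 = (G 5)(node 0 j := N)"
  have "seg ins ?S j (j + 1) = {}" using j ins(1) by (auto simp: seg_def nth_eq_iff_index_eq less_Suc_eq)
  hence leaf: "node_ok V0 ins ?S 0 j" by (simp add: node_ok_def V0_def is_min_def)
  have keep: "node_ok (G 5) ins ?S k i" if "formed m k i" "i \<noteq> j div 2 ^ k" for k i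
  proof -
    have "node_ok (G 5) ins S k i" using H that by (simp add: heap_ok_def m_def)
    moreover have "j < i * 2 ^ k \<or> (i + 1) * 2 ^ k \<le> j"
    proof (rule ccontr)
      assume "\<not> ?thesis"
      hence "j div 2 ^ k = i" by (intro div_nat_eqI) (auto simp: mult.commute)
      thus False using that by simp
    qed
    ultimately show ?thesis using seg_remove[OF ins(1) j] by (simp add: node_ok_def)
  qed
  define body where "body =
       Do (Arith Add 14 14 6) ;; Do (Cpy 17 21) ;; recompute_code ;;
        Do (Arith Add 15 15 15) ;;
        Do (Arith Div 16 16 7) ;; Do (Arith Div 21 21 7) ;; Do (Arith Add 19 21 7)"
  define J where "J R1 G1 t1 \<longleftrightarrow> (\<exists>k V. G1 = G(5 := V) \<and> R1 14 = k \<and> R1 15 = 2 ^ k \<and>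
     R1 16 = (m + 1) div 2 ^ Suc k \<and> R1 21 = j div 2 ^ Suc k \<and> R1 19 = R1 21 + 2 \<and> R1 9 = m \<and>
     same {14..24} R R1 \<and> formed m k (j div 2 ^ k) \<and>
     (\<forall>k' i. formed m k' i \<and> (k' \<le> k \<or> i \<noteq> j div 2 ^ k') \<longrightarrow> node_ok V ins ?S k' i) \<and>
     t1 \<le> t + 60 + 170 * k)"
    for R1 :: "nat \<Rightarrow> nat" and G1 :: "nat \<Rightarrow> nat \<Rightarrow> nat" and t1 :: nat
  have loop: "wp (While False (Less 16 19) body) (wp spine_code Q) R1 G1 t1" if "J R1 G1 t1" for R1 G1 t1
  proof (rule wp_While[where J = J and m = "\<lambda>R G. m - R 14"])
    show "J R1 G1 t1" by fact
  next
    fix R1 :: "nat \<Rightarrow> nat" and G1 :: "nat \<Rightarrow> nat \<Rightarrow> nat" and t1 :: nat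
    assume "J R1 G1 t1" and c: "holds_test (Less 16 19) R1 = False"
    then obtain k V where J: "G1 = G(5 := V)" "R1 14 = k" "R1 15 = 2 ^ k"
     "R1 16 = (m + 1) div 2 ^ Suc k" "R1 21 = j div 2 ^ Suc k" "R1 19 = R1 21 + 2" "R1 9 = m"
     "same {14..24} R R1" "formed m k (j div 2 ^ k)"
     "\<forall>k' i. formed m k' i \<and> (k' \<le> k \<or> i \<noteq> j div 2 ^ k') \<longrightarrow> node_ok V ins ?S k' i"
     "t1 \<le> t + 60 + 170 * k"
      unfolding J_def by blast
    have J10: "formed m k' i \<Longrightarrow> k' \<le> k \<or> i \<noteq> j div 2 ^ k' \<Longrightarrow> node_ok V ins ?S k' i" for k' i
      using J(10) by blast
    have std: "std R1" using same_std[OF J(8) _ R(1)] by simp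
    define i where "i = j div 2 ^ Suc k"
    have "i + 2 \<le> (m + 1) div 2 ^ Suc k" using c J(4-6) by (simp add: i_def)
    hence "(i + 2) * 2 ^ Suc k \<le> (m + 1) div 2 ^ Suc k * 2 ^ Suc k" by (rule mult_le_mono1)
    hence f: "formed m (Suc k) i" unfolding formed_def using div_times_less_eq_dividend order_trans by blast
    have km: "2 ^ Suc k \<le> m" "k < m" "i \<le> m"
    proof -
      have "(i + 1) * 2 ^ Suc k \<le> m" by (rule formed_bound[OF f])
      thus 1: "2 ^ Suc k \<le> m" using mult_le_mono1[of 1 "i + 1" "2 ^ Suc k"] by linarith
      have "k < 2 ^ k" by (rule less_exp)
      thus "k < m" using 1 unfolding power_Suc by linarith
      show "i \<le> m" using mN(2) div_le_dividend[of j "2 ^ Suc k"] unfolding i_def by linarith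
    qed
    have sm: "k + 1 < 2 ^ w" "2 ^ k + 2 ^ k < (2::nat) ^ w" "i div 2 + 2 < 2 ^ w"
      using km mN by (auto intro!: small)
    let ?P = "\<lambda>R' G' t'. J R' G' t' \<and> m - R' 14 < m - R1 14"
    let ?fin = "Do (Arith Add 15 15 15) ;;
        Do (Arith Div 16 16 7) ;; Do (Arith Div 21 21 7) ;; Do (Arith Add 19 21 7)"
    let ?R2 = "R1(14 := k + 1, 17 := i)"
    have "wp recompute_code (wp ?fin ?P) ?R2 G1 (15 + t1)"
    proof (rule wp_recompute[where k = k and j = i and m = m])
      show "std ?R2" using std by (simp add: std_def)
      show "?R2 15 = 2 ^ k" "?R2 17 = i" "formed m (Suc k) i" "m \<le> N" using J f mN by auto
      fix R' s assume *: "same {18, 19, 20, 22, 23} ?R2 R'" "s \<le> 15 + t1 + 100"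
      define V' where "V' = V(node (Suc k) i := best (V (node k (2 * i))) (V (node k (2 * i + 1))))"
      let ?G2 = "G1(5 := (G1 5)(node (Suc k) i := best (G1 5 (node k (2 * i))) (G1 5 (node k (2 * i + 1)))))"
      have G': "?G2 = G(5 := V')" using J(1) by (simp add: V'_def)
      let ?R3 = "R'(15 := 2 ^ k + 2 ^ k, 16 := (m + 1) div 2 ^ Suc k div 2, 21 := i div 2, 19 := i div 2 + 2)"
      have r: "R' 14 = k + 1" "R' 15 = 2 ^ k" "R' 16 = (m + 1) div 2 ^ Suc k" "R' 9 = m" "R' 7 = 2" "R' 21 = i"
        using * J std by (auto simp: same_def std_def i_def)
      have "node_ok V' ins ?S k' l" if fl: "formed m k' l" "k' \<le> Suc k \<or> l \<noteq> j div 2 ^ k'" for k' l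
      proof (cases "k' = Suc k \<and> l = i")
        case True
        have "(2 * i + 1 + 2) * 2 ^ k \<le> (i + 2) * 2 ^ Suc k" by (simp add: algebra_simps)
        hence "formed m k (2 * i)" "formed m k (2 * i + 1)"
          using f by (auto simp: formed_def algebra_simps)
        hence "node_ok V ins ?S k (2 * i)" "node_ok V ins ?S k (2 * i + 1)" using J10 by auto
        hence "node_ok V' ins ?S (Suc k) i" using ins(2)
          by (intro node_ok_step[of V ins ?S k i V']) (auto simp: V'_def)
        thus ?thesis using True by simp
      next
        case False
        hence "V' (node k' l) = V (node k' l)" by (auto simp: V'_def node_inject)
        moreover have "k' \<le> k \<or> l \<noteq> j div 2 ^ k'" using False fl(2) i_def by (cases "k' = Suc k") auto
        hence "node_ok V ins ?S k' l" using J10 fl(1) by blast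
        ultimately show ?thesis by (simp add: node_ok_def)
      qed
      moreover have "same {14..24} R ?R3" using *(1) J(8) by (auto simp: same_def)
      moreover have "y div 2 ^ Suc k div 2 = y div 2 ^ Suc (Suc k)" for y :: nat
        by (simp only: power_Suc2[of _ "Suc k"] div_mult2_eq)
      moreover have "2 ^ k + 2 ^ k = (2::nat) ^ Suc k" by simp
      ultimately have "J ?R3 (G(5 := V')) (24 + s)"
        unfolding J_def using r *(2) J(11) f
        by (intro exI[of _ "Suc k"] exI[of _ V']) (auto simp: i_def simp del: power_Suc)
      thus "wp ?fin ?P R' ?G2 s" unfolding G' using r sm km J(2) unfolding wp_simps by (simp del: power_Suc)
    qed
    thus "wp body ?P R1 G1 (t1 + 3)" using J std sm unfolding body_def wp_Seq wp_Do
      by (simp add: std_def i_def[symmetric] add.commute del: power_Suc)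
  next
    fix R1 :: "nat \<Rightarrow> nat" and G1 :: "nat \<Rightarrow> nat \<Rightarrow> nat" and t1 :: nat
    assume "J R1 G1 t1" and c: "holds_test (Less 16 19) R1 \<noteq> False"
    then obtain k V where J: "G1 = G(5 := V)" "R1 14 = k" "R1 15 = 2 ^ k"
     "R1 16 = (m + 1) div 2 ^ Suc k" "R1 21 = j div 2 ^ Suc k" "R1 19 = R1 21 + 2" "R1 9 = m"
     "same {14..24} R R1" "formed m k (j div 2 ^ k)"
     "\<forall>k' i. formed m k' i \<and> (k' \<le> k \<or> i \<noteq> j div 2 ^ k') \<longrightarrow> node_ok V ins ?S k' i"
     "t1 \<le> t + 60 + 170 * k"
      unfolding J_def by blast
    have std: "std R1" using same_std[OF J(8) _ R(1)] by simp
    have top: "\<not> j div 2 ^ k' + 2 \<le> (m + 1) div 2 ^ k'" if "k < k'" for k'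
    proof
      assume "j div 2 ^ k' + 2 \<le> (m + 1) div 2 ^ k'"
      hence "(j div 2 ^ k' + 2) * 2 ^ k' \<le> (m + 1) div 2 ^ k' * 2 ^ k'" by (rule mult_le_mono1)
      hence "formed m k' (j div 2 ^ k')"
        unfolding formed_def using div_times_less_eq_dividend order_trans by blast
      hence "formed m (Suc k) (j div 2 ^ Suc k)" by (rule formed_ancestor) (use that in simp)
      hence "j div 2 ^ Suc k + 2 \<le> (m + 1) div 2 ^ Suc k"
        unfolding formed_def by (subst less_eq_div_iff_mult_less_eq) auto
      thus False using c J(4-6) by simp
    qed
    have V: "node_ok V ins ?S k' i" if f: "formed m k' i" for k' i
    proof (cases "k' \<le> k")
      case False
      have "i + 2 \<le> (m + 1) div 2 ^ k'"
        using f unfolding formed_def by (subst less_eq_div_iff_mult_less_eq) auto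
      hence "i \<noteq> j div 2 ^ k'" using top[of k'] False by auto
      thus ?thesis using J(10) f by blast
    qed (use J(10) f in blast)
    \<comment> \<open>The ancestor at level \<open>k'\<close> is not formed, so the segment of this
      entry ends before it and does not contain \<open>j\<close>.\<close>
    have T: "spine_ok (G 6) ins ?S k'" if k': "k < k'" "2 ^ k' \<le> m + 1" for k'
    proof -
      have "(m + 1) div 2 ^ k' - 1 \<le> j div 2 ^ k'" using top[OF k'(1)] by linarith
      hence "((m + 1) div 2 ^ k' - 1) * 2 ^ k' \<le> j div 2 ^ k' * 2 ^ k'" by (rule mult_le_mono1)
      also have "\<dots> \<le> j" by (rule div_times_less_eq_dividend)
      finally have "seg ins ?S 0 (((m + 1) div 2 ^ k' - 1) * 2 ^ k') = seg ins S 0 (((m + 1) div 2 ^ k' - 1) * 2 ^ k')"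
        using seg_remove[OF ins(1) j] by blast
      moreover have "spine_ok (G 6) ins S k'" using H k'(2) by (simp add: heap_ok_def m_def)
      ultimately show ?thesis by (simp add: spine_ok_def m_def)
    qed
    have age: "2 ^ k \<le> m - j"
    proof -
      have "j < (j div 2 ^ k + 1) * 2 ^ k" using dividend_less_div_times[of "2 ^ k" j] by simp
      thus ?thesis using J(9) unfolding formed_def by (simp add: algebra_simps)
    qed
    show "wp spine_code Q R1 G1 (t1 + 2)"
    proof (rule wp_spine[where ins = ins and S = ?S and k = k])
      show "std R1" "R1 9 = length ins" "R1 14 = k" "R1 15 = 2 ^ k" "distinct ins" "set ins \<subseteq> {..<N}"
        using std J ins by (auto simp: m_def)
      show "2 ^ k \<le> length ins + 1" using age by (simp add: m_def)
      show "node_ok (G1 5) ins ?S k j" if "formed (length ins) k j" for k j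
        using V that J(1) by (simp add: m_def)
      show "spine_ok (G1 6) ins ?S k'" if "k < k'" "2 ^ k' \<le> length ins + 1" for k'
        using T that J(1) by (simp add: m_def)
      fix R' T s
      assume *: "same {14..24} R1 R'" "\<And>k'. 2 ^ k' \<le> length ins + 1 \<Longrightarrow> spine_ok T ins ?S k'"
        "s \<le> t1 + 2 + 300 + 300 * k"
      show "Q R' (G1(6 := T)) s"
      proof (rule post)
        show "same {14..24} R R'" using *(1) J(8) by (auto simp: same_def)
        show "2 ^ k \<le> length ins - j" "s \<le> t + 500 + 500 * k" using age J *(3) by (auto simp: m_def)
        show "(G1(6 := T)) f = G f" if "f \<notin> {5, 6}" for f using that J(1) by simp
        show "heap_ok ins ?S (G1(6 := T))"
          unfolding heap_ok_def using ins V *(2) J(1) H by (auto simp: m_def heap_ok_def)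
      qed
    qed
  qed
  let ?R1 = "R(21 := j div 2, 22 := j + j + 1, 14 := 0, 15 := 1, 16 := (m + 1) div 2, 19 := j div 2 + 2)"
  have "J ?R1 (G(5 := V0)) (60 + t)"
    unfolding J_def
  proof (rule exI[of _ 0], rule exI[of _ V0], intro conjI)
    show "\<forall>k' i. formed m k' i \<and> (k' \<le> 0 \<or> i \<noteq> j div 2 ^ k') \<longrightarrow> node_ok V0 ins ?S k' i"
    proof (intro allI impI)
      fix k' i assume *: "formed m k' i \<and> (k' \<le> 0 \<or> i \<noteq> j div 2 ^ k')"
      show "node_ok V0 ins ?S k' i"
      proof (cases "i = j div 2 ^ k'")
        case True
        thus ?thesis using * leaf by simp
      next
        case False
        hence "V0 (node k' i) = G 5 (node k' i)" by (auto simp: V0_def node_inject)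
        thus ?thesis using keep[of k' i] * False by (simp add: node_ok_def)
      qed
    qed
    show "formed m 0 (j div 2 ^ 0)" using mN by (simp add: formed_def)
  qed (use R in \<open>auto simp: same_def m_def\<close>)
  from loop[OF this]
  have "wp (While False (Less 16 19) body) (wp spine_code Q) ?R1 (G(5 := V0)) (60 + t)" .
  moreover have "?R1 = R(21 := j, 22 := j + j + 1, 14 := 0, 15 := 1, 16 := (m + 1) div 2, 21 := j div 2, 19 := j div 2 + 2)"
    by auto
  moreover have "node 0 j = j + j + 1" by (simp add: node_def)
  moreover have "j + j + 1 < L" "j + j + 1 < 2 ^ w" "m + 1 < 2 ^ w" "j div 2 + 2 < 2 ^ w" "x < L"
    using mN room x by (auto intro!: small)
  ultimately show ?thesis
    using R pos unfolding delete_code_def body_def[symmetric] wp_Seq wp_Do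
    by (simp add: std_def m_def[symmetric] x_def[symmetric] V0_def fun_upd_twist[of 21])
qed

section \<open>Propagating true inputs\<close>


text \<open>Register 26 is a node that has just become true; register 27 tells whether to go on. A
  parent below \<open>N\<close> is a letter whose formula is now satisfied. Counters treat both
  kinds of gates alike: an And gate waits for all its children, an Or gate for one, and 0 means that
  the gate has fired.\<close>

definition signal_code :: cmd where
  "signal_code = Do (Cpy 27 6) ;;
     While False (Equal 27 8)
       (Do (Get 30 2 26) ;;
        If (Less 30 0) (Do (Cpy 13 30) ;; insert_code ;; Do (Cpy 27 8))
          (Do (Get 31 3 30) ;;
           If (Equal 31 8) (Do (Cpy 27 8))
             (Do (Arith Sub 31 31 6) ;; Do (Put 3 30 31) ;;
              If (Equal 31 8) (Do (Cpy 26 30)) (Do (Cpy 27 8)))))"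

definition process_code :: cmd where
  "process_code = Do (Get 25 1 13) ;;
     While False (Equal 25 8) (Do (Cpy 26 25) ;; signal_code ;; Do (Get 25 4 25))"

text \<open>
  The net consists of the nodes above \<open>N\<close> and below \<open>n\<close>. The set \<open>D\<close> contains the nodes
  that are already known to be true.
\<close>

definition gate_ok :: "(nat \<Rightarrow> nat) \<Rightarrow> (nat \<Rightarrow> gate) \<Rightarrow> nat \<Rightarrow> (nat \<Rightarrow> nat) \<Rightarrow> nat set \<Rightarrow> nat \<Rightarrow> bool" where
  "gate_ok p k n c D u \<longleftrightarrow> (case k u of Input z \<Rightarrow> True
     | AndGate \<Rightarrow> c u = card {i. N < i \<and> i < n \<and> p i = u \<and> i \<notin> D} \<and> (u \<in> D \<longleftrightarrow> c u = 0)
     | OrGate \<Rightarrow> c u = (if u \<in> D then 0 else 1) \<and>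
         (u \<in> D \<longleftrightarrow> (\<exists>i. N < i \<and> i < n \<and> p i = u \<and> i \<in> D)))"

fun chain :: "(nat \<Rightarrow> nat) \<Rightarrow> nat \<Rightarrow> nat list \<Rightarrow> bool" where
  "chain f h [] \<longleftrightarrow> h = 0"
| "chain f h (i # l) \<longleftrightarrow> h = i \<and> i \<noteq> 0 \<and> chain f (f i) l"

text \<open>Two roots never share a letter as parent, so a letter cannot be inserted twice. The
  lists of occurrences include those of the two constants.\<close>

definition net_ok :: "(nat \<Rightarrow> nat) \<Rightarrow> (nat \<Rightarrow> gate) \<Rightarrow> nat \<Rightarrow> (nat \<Rightarrow> nat \<Rightarrow> nat) \<Rightarrow> bool" where
  "net_ok p k n G \<longleftrightarrow> n \<le> L \<and>
     (\<forall>i. N < i \<and> i < n \<longrightarrow> G 2 i = p i \<and>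
        (p i < N \<or> N < p i \<and> p i < i \<and> \<not> is_input (k (p i)))) \<and>
     (\<forall>i j. N < i \<and> i < n \<and> N < j \<and> j < n \<and> p i = p j \<and> p i < N \<longrightarrow> i = j) \<and>
     (\<forall>z\<le>N + 1. \<exists>l. chain (G 4) (G 1 z) l \<and> distinct l \<and> set l = {i. N < i \<and> i < n \<and> k i = Input z})"

definition sorter_inv ::
  "(nat \<Rightarrow> nat) \<Rightarrow> (nat \<Rightarrow> gate) \<Rightarrow> nat \<Rightarrow> nat list \<Rightarrow> nat set \<Rightarrow> nat set \<Rightarrow>
   (nat \<Rightarrow> nat) \<Rightarrow> (nat \<Rightarrow> nat \<Rightarrow> nat) \<Rightarrow> bool" where
  "sorter_inv p k n ins S D R G \<longleftrightarrow> std R \<and> R 9 = length ins \<and> heap_ok ins S G \<and> net_ok p k n G \<and>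
     D \<subseteq> {i. N < i \<and> i < n} \<and> (\<forall>x<N. x \<in> set ins \<longleftrightarrow> (\<exists>i\<in>D. p i = x))"

section \<open>Amortised propagation of signals\<close>

fun popcount :: "nat \<Rightarrow> nat" where
  "popcount m = (if m = 0 then 0 else m mod 2 + popcount (m div 2))"

declare popcount.simps [simp del]

text \<open>An increment with a carry through \<open>k\<close> positions turns \<open>k\<close> ones
  into zeros and creates a single one. The number of ones in \<open>length ins + 1\<close> thus
  serves as a potential that pays for all but a constant part of an insertion.\<close>

lemma popcount_carry: "2 ^ k dvd Suc m \<Longrightarrow> k + popcount (Suc m) \<le> popcount m + 1"
proof (induction k arbitrary: m)
  case 0
  show ?case
  proof (induction m rule: less_induct)
    case (less m)
    show ?case
    proof (cases "even m")
      case True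
      hence "Suc m div 2 = m div 2" "Suc m mod 2 = 1" "m mod 2 = 0" by presburger+
      thus ?thesis using popcount.simps[of "Suc m"] popcount.simps[of m] by (cases "m = 0") auto
    next
      case False
      hence e: "Suc m div 2 = Suc (m div 2)" "Suc m mod 2 = 0" "m mod 2 = 1" "m \<noteq> 0" by presburger+
      have "m div 2 < m" using e(4) by simp
      from less.IH[OF this] show ?thesis
        using popcount.simps[of "Suc m"] popcount.simps[of m] e by simp
    qed
  qed
next
  case (Suc k)
  then obtain z where z: "Suc m = 2 * (2 ^ k * z)" by (auto simp: mult.assoc)
  define y where "y = 2 ^ k * z"
  have y: "Suc m = 2 * y" "y \<noteq> 0" using z unfolding y_def[symmetric] by auto
  hence m: "m div 2 = y - 1" "m mod 2 = 1" "m \<noteq> 0" by presburger+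
  have "2 ^ k dvd Suc (y - 1)" using y by (simp add: y_def)
  from Suc.IH[OF this] show ?case
    using y m popcount.simps[of "Suc m"] popcount.simps[of m] by simp
qed

text \<open>Each node that becomes true grants 2000 steps once, and \<open>popcount\<close> pays for
  the carry of the insertion that may end the walk. The walk terminates because a parent that is a
  gate has a smaller number than its child.\<close>

lemma wp_signal:
  assumes inv: "sorter_inv p k n ins S D R G"
    and gates: "\<And>u. N < u \<Longrightarrow> u < n \<Longrightarrow> gate_ok p k n (G 3) D u"
    and i: "R 26 = i" "N < i" "i < n" "i \<notin> D" "is_input (k i)"
    and post: "\<And>R' G' s D' new. same ({9, 13, 26, 27, 30, 31} \<union> {14..24}) R R' \<Longrightarrow>
      (\<And>f. f \<notin> {3, 5, 6, 7} \<Longrightarrow> G' f = G f) \<Longrightarrow>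
      sorter_inv p k n (ins @ new) (S \<union> set new) D' R' G' \<Longrightarrow>
      (\<And>u. N < u \<Longrightarrow> u < n \<Longrightarrow> gate_ok p k n (G' 3) D' u) \<Longrightarrow>
      D \<subseteq> D' \<Longrightarrow> i \<in> D' \<Longrightarrow> (\<And>u. u \<in> D' \<Longrightarrow> u \<noteq> i \<Longrightarrow> is_input (k u) \<Longrightarrow> u \<in> D) \<Longrightarrow>
      s + 500 * popcount (length (ins @ new) + 1) + 2000 * card D
        \<le> t + 500 * popcount (length ins + 1) + 2000 * card D' \<Longrightarrow> Q R' G' s"
  shows "wp signal_code Q R G t"
proof -
  let ?U = "{i. N < i \<and> i < n}" and ?X = "{9, 13, 26, 27, 30, 31} \<union> {14..24} :: nat set"
  let ?body = "Do (Get 30 2 26) ;;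
        If (Less 30 0) (Do (Cpy 13 30) ;; insert_code ;; Do (Cpy 27 8))
          (Do (Get 31 3 30) ;;
           If (Equal 31 8) (Do (Cpy 27 8))
             (Do (Arith Sub 31 31 6) ;; Do (Put 3 30 31) ;;
              If (Equal 31 8) (Do (Cpy 26 30)) (Do (Cpy 27 8))))"
  define finished where "finished R1 G1 s \<longleftrightarrow> (\<exists>D' new. same ?X R R1 \<and>
      (\<forall>f. f \<notin> {3, 5, 6, 7} \<longrightarrow> G1 f = G f) \<and>
      sorter_inv p k n (ins @ new) (S \<union> set new) D' R1 G1 \<and>
      (\<forall>u. N < u \<and> u < n \<longrightarrow> gate_ok p k n (G1 3) D' u) \<and>
      D \<subseteq> D' \<and> i \<in> D' \<and> (\<forall>u. u \<in> D' \<and> u \<noteq> i \<and> is_input (k u) \<longrightarrow> u \<in> D) \<and>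
      s + 500 * popcount (length (ins @ new) + 1) + 2000 * card D
        \<le> t + 500 * popcount (length ins + 1) + 2000 * card D')"
    for R1 :: "nat \<Rightarrow> nat" and G1 :: "nat \<Rightarrow> nat \<Rightarrow> nat" and s :: nat
  \<comment> \<open>The node \<open>v\<close> is true but its parent has not been informed. It is
    therefore kept out of \<open>D'\<close>, and only its own gate condition is stated as if it
    belonged to it.\<close>
  define going where "going R1 G1 s \<longleftrightarrow> (\<exists>D' v. same ?X R R1 \<and>
      (\<forall>f. f \<noteq> 3 \<longrightarrow> G1 f = G f) \<and> R1 26 = v \<and> v \<in> ?U \<and> v \<notin> D' \<and>
      sorter_inv p k n ins S D' R1 G1 \<and>
      (\<forall>u. N < u \<and> u < n \<longrightarrow> gate_ok p k n (G1 3) (if u = v then insert v D' else D') u) \<and>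
      D \<subseteq> D' \<and> i \<in> insert v D' \<and> (\<forall>u. u \<in> insert v D' \<and> u \<noteq> i \<and> is_input (k u) \<longrightarrow> u \<in> D) \<and>
      s + 2000 * card D \<le> t + 6 + 2000 * card D')"
    for R1 :: "nat \<Rightarrow> nat" and G1 :: "nat \<Rightarrow> nat \<Rightarrow> nat" and s :: nat
  \<comment> \<open>The summand 2 anticipates the cost of the test that leaves the loop.\<close>
  define J where "J R1 G1 s \<longleftrightarrow> R1 8 = 0 \<and> (if R1 27 = 0 then finished R1 G1 (s + 2) else going R1 G1 s)"
    for R1 :: "nat \<Rightarrow> nat" and G1 :: "nat \<Rightarrow> nat \<Rightarrow> nat" and s :: nat
  have finD: "finite D'" if "sorter_inv p k n ins' S' D' R' G'" for ins' S' D' R' G'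
    using that by (auto simp: sorter_inv_def intro: finite_subset)
  have "wp (While False (Equal 27 8) ?body) Q (R(27 := 1)) G (t + 6)"
  proof (rule wp_While[where J = J and m = "\<lambda>R G. if R 27 = 0 then 0 else R 26"])
    have std: "std (R(27 := 1))" using inv by (simp add: sorter_inv_def std_def)
    have "gate_ok p k n (G 3) (if u = i then insert i D else D) u" if "N < u" "u < n" for u
      using gates[OF that] i(5) by (cases "k u"; cases "u = i") (auto simp: gate_ok_def)
    hence "going (R(27 := 1)) G (t + 6)"
      unfolding going_def using inv i std
      by (intro exI[of _ D] exI[of _ i]) (auto simp: same_def sorter_inv_def)
    thus "J (R(27 := 1)) G (t + 6)" using std by (simp add: J_def std_def)
  next
    fix R1 :: "nat \<Rightarrow> nat" and G1 :: "nat \<Rightarrow> nat \<Rightarrow> nat" and s :: nat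
    assume J: "J R1 G1 s" and "holds_test (Equal 27 8) R1 \<noteq> False"
    hence "R1 27 = 0" by (simp add: J_def)
    hence "finished R1 G1 (s + 2)" using J by (simp add: J_def)
    thus "Q R1 G1 (s + 2)" unfolding finished_def by (elim exE conjE) (rule post; blast)
  next
    fix R1 :: "nat \<Rightarrow> nat" and G1 :: "nat \<Rightarrow> nat \<Rightarrow> nat" and s :: nat
    assume J: "J R1 G1 s" and "holds_test (Equal 27 8) R1 = False"
    hence go: "R1 27 \<noteq> 0" by (simp add: J_def)
    hence "going R1 G1 s" using J by (simp add: J_def)
    then obtain D' v where g: "same ?X R R1" "\<forall>f. f \<noteq> 3 \<longrightarrow> G1 f = G f" "R1 26 = v" "v \<in> ?U" "v \<notin> D'"
      "sorter_inv p k n ins S D' R1 G1"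
      "\<forall>u. N < u \<and> u < n \<longrightarrow> gate_ok p k n (G1 3) (if u = v then insert v D' else D') u"
      "D \<subseteq> D'" "i \<in> insert v D'" "\<forall>u. u \<in> insert v D' \<and> u \<noteq> i \<and> is_input (k u) \<longrightarrow> u \<in> D"
      "s + 2000 * card D \<le> t + 6 + 2000 * card D'"
      unfolding going_def by blast
    have std: "R1 0 = N" "R1 6 = 1" "R1 7 = 2" "R1 8 = 0" and sR: "std R1" and H: "heap_ok ins S G1"
      and net: "net_ok p k n G1" and ins: "\<forall>x<N. x \<in> set ins \<longleftrightarrow> (\<exists>i\<in>D'. p i = x)" and R9: "R1 9 = length ins"
      and DU: "D' \<subseteq> ?U"
      using g(6) by (auto simp: sorter_inv_def std_def)
    have v: "v < L" "G1 2 v = p v" "p v < N \<or> N < p v \<and> p v < v \<and> \<not> is_input (k (p v))"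
      using net g(4) by (auto simp: net_ok_def)
    have cardD: "card (insert v D') = Suc (card D')" using g(5) finD[OF g(6)] by simp
    let ?P = "\<lambda>R' G' t'. J R' G' t' \<and> (if R' 27 = 0 then 0 else R' 26) < (if R1 27 = 0 then 0 else R1 26)"
    have v0: "0 < v" using g(4) by simp
    have fin: "?P R' G' s'" if "finished R' G' (s' + 2)" "R' 8 = 0" "R' 27 = 0" for R' G' s'
      using that v0 go g(3) by (simp add: J_def)
    have other: "gate_ok p k n c (insert v D') u"
      if "N < u" "u < n" "u \<noteq> p v" "c u = G1 3 u" for u c
    proof (cases "u = v")
      case True
      have "gate_ok p k n (G1 3) (insert v D') v" using g(7)[rule_format, of v] g(4) by simp
      moreover have "c v = G1 3 v" using that(4) True by simp
      ultimately show ?thesis unfolding True gate_ok_def by (simp only:)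
    next
      case False
      have *: "gate_ok p k n (G1 3) D' u" using g(7) that False by auto
      have e: "{j. N < j \<and> j < n \<and> p j = u \<and> j \<notin> insert v D'} = {j. N < j \<and> j < n \<and> p j = u \<and> j \<notin> D'}"
        "(\<exists>j. N < j \<and> j < n \<and> p j = u \<and> j \<in> insert v D') = (\<exists>j. N < j \<and> j < n \<and> p j = u \<and> j \<in> D')"
        using that(3) by auto
      have m: "u \<in> insert v D' \<longleftrightarrow> u \<in> D'" using False by simp
      show ?thesis using * by (simp only: gate_ok_def e m that(4))
    qed
    have new: "sorter_inv p k n ins S (insert v D') R' (G1(3 := c))"
      if "N \<le> p v" "same {13, 26, 27, 30, 31} R1 R'" for R' c
    proof -
      have "std R'" "R' 9 = length ins" using that(2) sR R9 by (auto simp: same_def std_def)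
      moreover have "heap_ok ins S (G1(3 := c))" "net_ok p k n (G1(3 := c))"
        using H net by (auto simp: heap_ok_def net_ok_def)
      ultimately show ?thesis using ins DU g(4) that(1) unfolding sorter_inv_def by auto
    qed
    show "wp ?body ?P R1 G1 (s + 3)"
    proof (cases "p v < N")
      case True
      let ?R2 = "R1(30 := p v, 13 := p v)"
      have pv_new: "p v \<notin> set ins"
      proof
        assume "p v \<in> set ins"
        then obtain j where j: "j \<in> D'" "p j = p v" using ins True by blast
        have "j = v"
          by (rule net[unfolded net_ok_def, THEN conjunct2, THEN conjunct2, THEN conjunct1, rule_format])
            (use j g(4) DU True in auto)
        thus False using j(1) g(5) by simp
      qed
      have "wp insert_code (wp (Do (Cpy 27 8)) ?P) ?R2 G1 (s + 17)"
      proof (rule wp_insert[where ins = ins and S = S and x = "p v"])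
        show "std ?R2" "?R2 9 = length ins" "?R2 13 = p v" using sR R9 by (auto simp: std_def)
        show "p v \<notin> set ins" "p v < N" "heap_ok ins S G1" using pv_new True H by simp_all
        fix R' G' s' l
        assume *: "same (insert 9 {14..24}) ?R2 R'" "R' 9 = length ins + 1"
          "heap_ok (ins @ [p v]) (insert (p v) S) G'" "\<And>f. f \<notin> {5, 6, 7} \<Longrightarrow> G' f = G1 f"
          "2 ^ l dvd length ins + 2" "s' \<le> s + 17 + 500 + 500 * l"
        have r: "R' 8 = 0" "std (R'(27 := 0))" using *(1) sR by (auto simp: same_def std_def)
        have "finished (R'(27 := 0)) G' (s' + 6 + 2)"
          unfolding finished_def
        proof (intro exI[of _ "insert v D'"] exI[of _ "[p v]"] conjI)
          show "same ?X R (R'(27 := 0))" using *(1) g(1) by (auto simp: same_def)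
          show "\<forall>f. f \<notin> {3, 5, 6, 7} \<longrightarrow> G' f = G f" using *(4) g(2) by auto
          have "net_ok p k n G'" using net *(4) by (simp add: net_ok_def)
          moreover have "\<forall>x<N. x \<in> set (ins @ [p v]) \<longleftrightarrow> (\<exists>i\<in>insert v D'. p i = x)" using ins by auto
          ultimately show "sorter_inv p k n (ins @ [p v]) (S \<union> set [p v]) (insert v D') (R'(27 := 0)) G'"
            using r *(2,3) DU g(4) by (auto simp: sorter_inv_def)
          show "\<forall>u. N < u \<and> u < n \<longrightarrow> gate_ok p k n (G' 3) (insert v D') u"
            using True *(4) by (auto intro!: other)
          show "D \<subseteq> insert v D'" "i \<in> insert v D'" using g by auto
          show "\<forall>u. u \<in> insert v D' \<and> u \<noteq> i \<and> is_input (k u) \<longrightarrow> u \<in> D" by fact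
          have "l + popcount (length ins + 2) \<le> popcount (length ins + 1) + 1"
            using popcount_carry[of l "length ins + 1"] *(5) by simp
          thus "s' + 6 + 2 + 500 * popcount (length (ins @ [p v]) + 1) + 2000 * card D
            \<le> t + 500 * popcount (length ins + 1) + 2000 * card (insert v D')"
            using *(6) g(11) cardD by simp
        qed
        thus "wp (Do (Cpy 27 8)) ?P R' G' s'" using fin[of "R'(27 := 0)" G' "s' + 6"] r
          unfolding wp_Do by simp
      qed
      thus ?thesis using True v g(3) std unfolding wp_Seq wp_Do wp_If by (simp add: add.commute)
    next
      case False
      hence pv: "N < p v" "p v < v" "\<not> is_input (k (p v))" "p v < n" "p v < L" using v g(4) by auto
      have gp: "gate_ok p k n (G1 3) D' (p v)" using g(7) pv by auto
      define u where "u = p v"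
      have ch: "{j. N < j \<and> j < n \<and> p j = u \<and> j \<notin> D'} = insert v {j. N < j \<and> j < n \<and> p j = u \<and> j \<notin> insert v D'}"
        using g(4,5) by (auto simp: u_def)
      have fin': "finite {j. N < j \<and> j < n \<and> p j = u \<and> j \<notin> insert v D'}" by simp
      have cch: "card {j. N < j \<and> j < n \<and> p j = u \<and> j \<notin> D'} = Suc (card {j. N < j \<and> j < n \<and> p j = u \<and> j \<notin> insert v D'})"
        unfolding ch using fin' by simp
      have dn: "finished R' (G1(3 := c)) s'"
        if "same {13, 26, 27, 30, 31} R1 R'" "\<And>u'. u' \<noteq> u \<Longrightarrow> c u' = G1 3 u'"
          "gate_ok p k n c (insert v D') u" "s' \<le> s + 100" for R' c s'
        unfolding finished_def
      proof (intro exI[of _ "insert v D'"] exI[of _ "[]"] conjI)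
        show "same ?X R R'" using that(1) g(1) by (auto simp: same_def)
        show "\<forall>f. f \<notin> {3, 5, 6, 7} \<longrightarrow> (G1(3 := c)) f = G f" using g(2) by auto
        show "sorter_inv p k n (ins @ []) (S \<union> set []) (insert v D') R' (G1(3 := c))"
          using new[of R' c] that(1) False by simp
        show "\<forall>u. N < u \<and> u < n \<longrightarrow> gate_ok p k n ((G1(3 := c)) 3) (insert v D') u"
        proof (intro allI impI)
          fix u' assume "N < u' \<and> u' < n"
          thus "gate_ok p k n ((G1(3 := c)) 3) (insert v D') u'"
            using other[of u' c] that(2,3) by (cases "u' = u") (auto simp: u_def)
        qed
        show "D \<subseteq> insert v D'" "i \<in> insert v D'" using g by auto
        show "\<forall>u. u \<in> insert v D' \<and> u \<noteq> i \<and> is_input (k u) \<longrightarrow> u \<in> D" by fact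
        show "s' + 500 * popcount (length (ins @ []) + 1) + 2000 * card D
            \<le> t + 500 * popcount (length ins + 1) + 2000 * card (insert v D')"
          using that(4) g(11) cardD by simp
      qed
      show ?thesis
      proof (cases "G1 3 u = 0")
        case True
        \<comment> \<open>An And gate cannot have fired yet, because its child \<open>v\<close> is
          still counted as missing.\<close>
        have "k u = OrGate"
          using gp True cch pv unfolding u_def[symmetric] by (cases "k u") (auto simp: gate_ok_def)
        hence "gate_ok p k n (G1 3) (insert v D') u"
          using gp True pv g(4) unfolding u_def[symmetric] by (auto simp: gate_ok_def split: if_splits)
        hence "finished (R1(30 := u, 31 := 0, 27 := 0)) (G1(3 := G1 3)) (s + 25 + 2)"
          by (intro dn) (auto simp: same_def)
        hence "?P (R1(30 := u, 31 := 0, 27 := 0)) G1 (s + 25)"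
          using std by (intro fin) auto
        thus ?thesis
          using True v pv g(3) std False unfolding wp_Seq wp_Do wp_If u_def[symmetric] by (simp add: add.commute)
      next
        case nz: False
        define c where "c = (G1 3)(u := G1 3 u - 1)"
        have cu: "c u = G1 3 u - 1" by (simp add: c_def)
        show ?thesis
        proof (cases "c u = 0")
          case True
          let ?R2 = "R1(30 := u, 31 := 0, 26 := u)"
          have one: "G1 3 u = 1" using nz True cu by simp
          have uD: "u \<notin> D'" using gp one unfolding u_def[symmetric]
            by (cases "k u") (use pv in \<open>auto simp: gate_ok_def u_def\<close>)
          have uv: "u \<noteq> v" using pv by (simp add: u_def)
          have gu: "gate_ok p k n c (insert u (insert v D')) u"
          proof (cases "k u")
            case AndGate
            have "p u \<noteq> u"
              using net[unfolded net_ok_def, THEN conjunct2, THEN conjunct1, rule_format, of u] pv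
              by (auto simp: u_def)
            hence "{j. N < j \<and> j < n \<and> p j = u \<and> j \<notin> insert u (insert v D')} = {j. N < j \<and> j < n \<and> p j = u \<and> j \<notin> insert v D'}"
              by auto
            thus ?thesis using AndGate gp one cch True unfolding u_def[symmetric] by (simp add: gate_ok_def)
          next
            case OrGate
            have "\<exists>j. N < j \<and> j < n \<and> p j = u \<and> j \<in> insert u (insert v D')" using g(4) by (auto simp: u_def)
            thus ?thesis using OrGate True by (simp add: gate_ok_def)
          qed (simp add: gate_ok_def)
          have "going ?R2 (G1(3 := c)) (s + 39)"
            unfolding going_def
          proof (intro exI[of _ "insert v D'"] exI[of _ u] conjI)
            show "same ?X R ?R2" using g(1) by (auto simp: same_def)
            show "\<forall>f. f \<noteq> 3 \<longrightarrow> (G1(3 := c)) f = G f" using g(2) by simp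
            show "?R2 26 = u" "u \<in> ?U" "u \<notin> insert v D'" using pv uD uv by (auto simp: u_def)
            show "sorter_inv p k n ins S (insert v D') ?R2 (G1(3 := c))"
              using new[of ?R2 c] False by (simp add: same_def)
            show "\<forall>u'. N < u' \<and> u' < n \<longrightarrow>
              gate_ok p k n ((G1(3 := c)) 3) (if u' = u then insert u (insert v D') else insert v D') u'"
            proof (intro allI impI)
              fix u' assume "N < u' \<and> u' < n"
              thus "gate_ok p k n ((G1(3 := c)) 3) (if u' = u then insert u (insert v D') else insert v D') u'"
                using other[of u' c] gu by (cases "u' = u") (auto simp: u_def c_def)
            qed
            show "D \<subseteq> insert v D'" "i \<in> insert u (insert v D')" using g by auto
            show "\<forall>u'. u' \<in> insert u (insert v D') \<and> u' \<noteq> i \<and> is_input (k u') \<longrightarrow> u' \<in> D"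
              using g(10) pv(3) by (auto simp: u_def)
            show "s + 39 + 2000 * card D \<le> t + 6 + 2000 * card (insert v D')"
              using g(11) cardD by simp
          qed
          hence "J ?R2 (G1(3 := c)) (s + 39)" using go std by (simp add: J_def)
          moreover have "u < v" using pv by (simp add: u_def)
          ultimately have "?P ?R2 (G1(3 := c)) (s + 39)" using go g(3) by simp
          thus ?thesis
            using True nz v pv g(3) std False one go unfolding wp_Seq wp_Do wp_If u_def[symmetric] c_def
            by (simp add: add.commute)
        next
          case nz2: False
          let ?R2 = "R1(30 := u, 31 := c u, 27 := 0)"
          have and_gate: "k u = AndGate"
            using gp nz2 nz cu pv unfolding u_def[symmetric] by (cases "k u") (auto simp: gate_ok_def split: if_splits)
          have "u \<noteq> v" using pv by (simp add: u_def)
          hence "gate_ok p k n c (insert v D') u"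
            using gp nz nz2 and_gate cch cu unfolding u_def[symmetric] by (simp add: gate_ok_def)
          hence "finished ?R2 (G1(3 := c)) (s + 39 + 2)"
            by (intro dn) (auto simp: same_def c_def)
          hence "?P ?R2 (G1(3 := c)) (s + 39)"
            using std by (intro fin) auto
          thus ?thesis
            using nz2 nz v pv g(3) std False cu go unfolding wp_Seq wp_Do wp_If u_def[symmetric] c_def
            by (simp add: add.commute)
        qed
      qed
    qed
  qed
  thus ?thesis using inv unfolding signal_code_def wp_Seq wp_Do by (simp add: sorter_inv_def std_def)
qed


text \<open>A loop rule with a ghost measure: the length of the list still to be traversed is known
  to the invariant but is not a readily available function of the state.\<close>

lemma wp_While_index:
  fixes x :: nat
  assumes "J x R G t"
    and "\<And>x R G t. J x R G t \<Longrightarrow> holds_test b R = v \<Longrightarrow>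
           wp c (\<lambda>R' G' t'. \<exists>y<x. J y R' G' t') R G (t + 3)"
    and "\<And>x R G t. J x R G t \<Longrightarrow> holds_test b R \<noteq> v \<Longrightarrow> Q R G (t + 2)"
  shows "wp (While v b c) Q R G t"
  using assms(1)
proof (induction x arbitrary: R G t rule: less_induct)
  case (less x)
  show ?case
  proof (cases "holds_test b R = v")
    case True
    then obtain R' G' t' y where 1: "exec c R G (t + 3) R' G' t'" "J y R' G' t'" "y < x"
      using assms(2)[OF less.prems True] unfolding wp_def by blast
    from less.IH[OF 1(3,2)] show ?thesis
      using exec.WhileT[OF True 1(1)] unfolding wp_def by blast
  next
    case False
    thus ?thesis using assms(3)[OF less.prems False] exec.WhileF[OF False] unfolding wp_def by blast
  qed
qed

text \<open>The occurrences of \<open>z\<close> are distinct nodes that were not true before, so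
  each of them can be charged for the 30 extra steps of the list traversal.\<close>

lemma wp_process:
  assumes inv: "sorter_inv p k n ins S D R G"
    and gates: "\<And>u. N < u \<Longrightarrow> u < n \<Longrightarrow> gate_ok p k n (G 3) D u"
    and z: "R 13 = z" "z \<le> N + 1" "\<And>i. N < i \<Longrightarrow> i < n \<Longrightarrow> k i = Input z \<Longrightarrow> i \<notin> D"
    and post: "\<And>R' G' s D' new. same ({9, 13} \<union> {14..31}) R R' \<Longrightarrow>
      (\<And>f. f \<notin> {3, 5, 6, 7} \<Longrightarrow> G' f = G f) \<Longrightarrow>
      sorter_inv p k n (ins @ new) (S \<union> set new) D' R' G' \<Longrightarrow>
      (\<And>u. N < u \<Longrightarrow> u < n \<Longrightarrow> gate_ok p k n (G' 3) D' u) \<Longrightarrow> D \<subseteq> D' \<Longrightarrow>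
      (\<And>u. N < u \<Longrightarrow> u < n \<Longrightarrow> is_input (k u) \<Longrightarrow> u \<in> D' \<longleftrightarrow> u \<in> D \<or> k u = Input z) \<Longrightarrow>
      s + 500 * popcount (length (ins @ new) + 1) + 2030 * card D
        \<le> t + 20 + 500 * popcount (length ins + 1) + 2030 * card D' \<Longrightarrow> Q R' G' s"
  shows "wp process_code Q R G t"
proof -
  let ?U = "{i. N < i \<and> i < n}" and ?X = "{9, 13} \<union> {14..31} :: nat set"
  let ?body = "Do (Cpy 26 25) ;; signal_code ;; Do (Get 25 4 25)"
  define J where "J x R1 G1 s \<longleftrightarrow> (\<exists>D' new l. length l = x \<and> same ?X R R1 \<and>
      (\<forall>f. f \<notin> {3, 5, 6, 7} \<longrightarrow> G1 f = G f) \<and>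
      sorter_inv p k n (ins @ new) (S \<union> set new) D' R1 G1 \<and>
      (\<forall>u. N < u \<and> u < n \<longrightarrow> gate_ok p k n (G1 3) D' u) \<and> D \<subseteq> D' \<and>
      chain (G 4) (R1 25) l \<and> distinct l \<and> (\<forall>i\<in>set l. N < i \<and> i < n \<and> k i = Input z) \<and>
      (\<forall>u. N < u \<and> u < n \<and> is_input (k u) \<longrightarrow> (u \<in> D' \<longleftrightarrow> u \<in> D \<or> k u = Input z \<and> u \<notin> set l)) \<and>
      s + 500 * popcount (length (ins @ new) + 1) + 2030 * card D
        \<le> t + 6 + 500 * popcount (length ins + 1) + 2030 * card D')"
    for x :: nat and R1 :: "nat \<Rightarrow> nat" and G1 :: "nat \<Rightarrow> nat \<Rightarrow> nat" and s :: nat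
  have net: "net_ok p k n G" and std: "std R" using inv by (auto simp: sorter_inv_def)
  obtain l where l: "chain (G 4) (G 1 z) l" "distinct l" "set l = {i. N < i \<and> i < n \<and> k i = Input z}"
    using net[unfolded net_ok_def, THEN conjunct2, THEN conjunct2, THEN conjunct2] z(2) by blast
  have "wp (While False (Equal 25 8) ?body) Q (R(25 := G 1 z)) G (t + 6)"
  proof (rule wp_While_index[where J = J and x = "length l"])
    have "sorter_inv p k n (ins @ []) (S \<union> set []) D (R(25 := G 1 z)) G"
      using inv by (simp add: sorter_inv_def std_def)
    moreover have "\<forall>u. N < u \<and> u < n \<and> is_input (k u) \<longrightarrow> (u \<in> D \<longleftrightarrow> u \<in> D \<or> k u = Input z \<and> u \<notin> set l)"
      using l(3) by auto
    ultimately show "J (length l) (R(25 := G 1 z)) G (t + 6)"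
      unfolding J_def using gates l
      by (intro exI[of _ D] exI[of _ "[]"] exI[of _ l]) (simp add: same_def)
  next
    fix x R1 G1 s
    assume "J x R1 G1 s" and c: "holds_test (Equal 25 8) R1 \<noteq> False"
    then obtain D' new l where J: "same ?X R R1" "\<forall>f. f \<notin> {3, 5, 6, 7} \<longrightarrow> G1 f = G f"
      "sorter_inv p k n (ins @ new) (S \<union> set new) D' R1 G1"
      "\<forall>u. N < u \<and> u < n \<longrightarrow> gate_ok p k n (G1 3) D' u" "D \<subseteq> D'"
      "chain (G 4) (R1 25) l"
      "\<forall>i\<in>set l. N < i \<and> i < n \<and> k i = Input z"
      "\<forall>u. N < u \<and> u < n \<and> is_input (k u) \<longrightarrow> (u \<in> D' \<longleftrightarrow> u \<in> D \<or> k u = Input z \<and> u \<notin> set l)"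
      "s + 500 * popcount (length (ins @ new) + 1) + 2030 * card D
        \<le> t + 6 + 500 * popcount (length ins + 1) + 2030 * card D'"
      unfolding J_def by blast
    have "R1 25 = 0" using c J(3) by (simp add: sorter_inv_def std_def)
    hence "l = []" using J(6) by (cases l) auto
    thus "Q R1 G1 (s + 2)" using J by (intro post[of R1 G1 new D' "s + 2"]) auto
  next
    fix x R1 G1 s
    assume "J x R1 G1 s" and c: "holds_test (Equal 25 8) R1 = False"
    then obtain D' new l where J: "length l = x" "same ?X R R1" "\<forall>f. f \<notin> {3, 5, 6, 7} \<longrightarrow> G1 f = G f"
      "sorter_inv p k n (ins @ new) (S \<union> set new) D' R1 G1"
      "\<forall>u. N < u \<and> u < n \<longrightarrow> gate_ok p k n (G1 3) D' u" "D \<subseteq> D'"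
      "chain (G 4) (R1 25) l" "distinct l"
      "\<forall>i\<in>set l. N < i \<and> i < n \<and> k i = Input z"
      "\<forall>u. N < u \<and> u < n \<and> is_input (k u) \<longrightarrow> (u \<in> D' \<longleftrightarrow> u \<in> D \<or> k u = Input z \<and> u \<notin> set l)"
      "s + 500 * popcount (length (ins @ new) + 1) + 2030 * card D
        \<le> t + 6 + 500 * popcount (length ins + 1) + 2030 * card D'"
      unfolding J_def by blast
    have sR: "std R1" using J(4) by (simp add: sorter_inv_def)
    have "R1 25 \<noteq> 0" using c sR by (simp add: std_def)
    then obtain i l' where i: "l = i # l'" "R1 25 = i" "chain (G 4) (G 4 i) l'"
      using J(7) by (cases l) auto
    have iU: "N < i" "i < n" "k i = Input z" using J(9) i(1) by auto
    have iD: "i \<notin> D'" using J(10)[rule_format, of i] iU z(3)[OF iU] i(1) by auto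
    have fin: "finite D''" if "sorter_inv p k n ins' S' D'' R' G'" for ins' S' D'' R' G'
      using that by (auto simp: sorter_inv_def intro: finite_subset)
    let ?P = "\<lambda>R' G' t'. \<exists>y<x. J y R' G' t'"
    have "wp signal_code (wp (Do (Get 25 4 25)) ?P) (R1(26 := i)) G1 (s + 9)"
    proof (rule wp_signal[where ins = "ins @ new" and S = "S \<union> set new" and D = D' and i = i and p = p and k = k and n = n])
      show "sorter_inv p k n (ins @ new) (S \<union> set new) D' (R1(26 := i)) G1"
        using J(4) by (simp add: sorter_inv_def std_def)
      show "gate_ok p k n (G1 3) D' u" if "N < u" "u < n" for u using J(5) that by blast
      show "(R1(26 := i)) 26 = i" "N < i" "i < n" "i \<notin> D'" "is_input (k i)" using iU iD by auto
      fix R' G' s' D'' new'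
      assume *: "same ({9, 13, 26, 27, 30, 31} \<union> {14..24}) (R1(26 := i)) R'"
        "\<And>f. f \<notin> {3, 5, 6, 7} \<Longrightarrow> G' f = G1 f"
        "sorter_inv p k n ((ins @ new) @ new') ((S \<union> set new) \<union> set new') D'' R' G'"
        "\<And>u. N < u \<Longrightarrow> u < n \<Longrightarrow> gate_ok p k n (G' 3) D'' u"
        "D' \<subseteq> D''" "i \<in> D''" "\<And>u. u \<in> D'' \<Longrightarrow> u \<noteq> i \<Longrightarrow> is_input (k u) \<Longrightarrow> u \<in> D'"
        "s' + 500 * popcount (length ((ins @ new) @ new') + 1) + 2000 * card D'
        \<le> s + 9 + 500 * popcount (length (ins @ new) + 1) + 2000 * card D''"
      have r25: "R' 25 = i" using *(1) i(2) by (simp add: same_def)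
      have "card (insert i D') \<le> card D''" using *(5,6) fin[OF *(3)] by (intro card_mono) auto
      hence cD: "card D' + 1 \<le> card D''" using iD fin[OF J(4)] by simp
      have g4: "G' 4 = G 4" using *(2)[of 4] J(3) by simp
      have inp: "u \<in> D'' \<longleftrightarrow> u \<in> D \<or> k u = Input z \<and> u \<notin> set l'" if u: "N < u" "u < n" "is_input (k u)" for u
      proof (cases "u = i")
        case True
        thus ?thesis using *(6) iU J(8) i(1) by simp
      next
        case False
        hence "u \<in> D'' \<longleftrightarrow> u \<in> D'" using *(5,7) u(3) by blast
        also have "\<dots> \<longleftrightarrow> u \<in> D \<or> k u = Input z \<and> u \<notin> set l" using J(10) u by blast
        finally show ?thesis using False i(1) by simp
      qed
      have "J (length l') (R'(25 := G 4 i)) G' (s' + 6)"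
        unfolding J_def
      proof (rule exI[of _ D''], rule exI[of _ "new @ new'"], rule exI[of _ l'], intro conjI)
        show "same ?X R (R'(25 := G 4 i))" using *(1) J(2) by (auto simp: same_def)
        show "\<forall>f. f \<notin> {3, 5, 6, 7} \<longrightarrow> G' f = G f" using *(2) J(3) by auto
        show "sorter_inv p k n (ins @ new @ new') (S \<union> set (new @ new')) D'' (R'(25 := G 4 i)) G'"
          using *(3) by (simp add: sorter_inv_def std_def Un_assoc)
        show "\<forall>u. N < u \<and> u < n \<longrightarrow> gate_ok p k n (G' 3) D'' u" using *(4) by blast
        show "D \<subseteq> D''" using *(5) J(6) by blast
        show "chain (G 4) ((R'(25 := G 4 i)) 25) l'" using i(3) by simp
        show "distinct l'" "\<forall>i\<in>set l'. N < i \<and> i < n \<and> k i = Input z" using J(8,9) i(1) by auto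
        show "\<forall>u. N < u \<and> u < n \<and> is_input (k u) \<longrightarrow> (u \<in> D'') = (u \<in> D \<or> k u = Input z \<and> u \<notin> set l')"
          using inp by blast
        show "s' + 6 + 500 * popcount (length (ins @ new @ new') + 1) + 2030 * card D
          \<le> t + 6 + 500 * popcount (length ins + 1) + 2030 * card D''"
          using *(8) J(11) cD by simp
      qed simp
      moreover have "length l' < x" using J(1) i(1) by simp
      moreover have "i < L" using iU net by (simp add: net_ok_def)
      ultimately show "wp (Do (Get 25 4 25)) ?P R' G' s'" unfolding wp_Do using r25 g4 by auto
    qed
    thus "wp ?body ?P R1 G1 (s + 3)" unfolding wp_Seq wp_Do using i(2) by (simp add: add.commute)
  qed
  moreover have "z < L" using z(2) room by linarith
  ultimately show ?thesis using z(1) unfolding process_code_def wp_Seq wp_Do by simp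
qed

end

section \<open>Building the network\<close>

text \<open>The formulas of the first \<open>X\<close> letters have been read. Nodes are numbered
  from \<open>length xs + 1\<close> on; smaller numbers are free to denote letters in the role of
  parents, and 0 can serve as the null pointer.\<close>

definition net_good :: "'a list \<Rightarrow> ('a \<Rightarrow> 'a formula) \<Rightarrow> nat \<Rightarrow> nat \<Rightarrow> (nat \<Rightarrow> nat) \<Rightarrow> (nat \<Rightarrow> gate) \<Rightarrow> bool" where
  "net_good xs F X n p k \<longleftrightarrow>
     (\<forall>i. length xs < i \<and> i < n \<longrightarrow>
        (p i < X \<or> length xs < p i \<and> p i < i \<and> \<not> is_input (k (p i))) \<and>
        (k i = AndGate \<longrightarrow> (\<exists>j. length xs < j \<and> j < n \<and> p j = i)) \<and>
        (\<forall>z. k i = Input z \<longrightarrow> z \<le> length xs + 1)) \<and>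
     (\<forall>i j. length xs < i \<and> i < n \<and> length xs < j \<and> j < n \<and> p i = p j \<and> p i < length xs \<longrightarrow> i = j) \<and>
     (\<forall>x<X. \<exists>i. length xs < i \<and> i < n \<and> p i = x) \<and>
     (\<forall>Y T i. length xs \<in> Y \<and> Suc (length xs) \<notin> Y \<and> consistent p k Y (length xs + 1) n T \<and>
        length xs < i \<and> i < n \<and> p i < length xs \<longrightarrow>
        (i \<in> T \<longleftrightarrow> holds (F (xs ! p i)) (letters xs Y)))"

text \<open>The old net and the new formula have no edge between them, only letters as common
  territory of parents. Hence \<open>consistent_split\<close> reduces the truth of each root to its
  own part.\<close>

lemma net_good_step:
  assumes g: "net_good xs F X n p k" and X: "X < length xs" and n: "length xs < n" and d: "distinct xs"
    and cs: "list_all2 (encodes_symbol xs) cs (symbols (F (xs ! X)))"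
    and r: "read_symbols (length xs)
      (n + 2, n + 1, p(n := X, n + 1 := n), k(n := OrGate, n + 1 := AndGate)) cs = (n', a', p', k')"
  shows "net_good xs F (X + 1) n' p' k' \<and> n + 1 < n'"
proof -
  define N where "N = length xs"
  let ?p = "p(n := X, n + 1 := n)" and ?k = "k(n := OrGate, n + 1 := AndGate)"
  have 1: "n + 1 < n' \<and> p' a' = n \<and> a' < n' \<and> agree (n + 1) ?p ?k p' k' \<and> block N p' k' X n n' \<and>
     (\<forall>i. n \<le> i \<and> i < n' \<longrightarrow> (p' i = X \<longleftrightarrow> i = n)) \<and>
     (\<forall>Y T. N \<in> Y \<longrightarrow> Suc N \<notin> Y \<longrightarrow> consistent p' k' Y n n' T \<longrightarrow>
        (n \<in> T \<longleftrightarrow> holds (F (xs ! X)) (letters xs Y)))"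
    unfolding N_def
    by (rule reads_formula_node[OF reads_symbols(1)[OF d] cs r]) (use X n in auto)
  have nn: "n + 1 < n'" and ag: "agree (n + 1) ?p ?k p' k'" and b: "block N p' k' X n n'"
    and par: "\<And>i. n \<le> i \<Longrightarrow> i < n' \<Longrightarrow> p' i = X \<longleftrightarrow> i = n"
    and sem: "\<And>Y T. N \<in> Y \<Longrightarrow> Suc N \<notin> Y \<Longrightarrow> consistent p' k' Y n n' T \<Longrightarrow>
        (n \<in> T \<longleftrightarrow> holds (F (xs ! X)) (letters xs Y))"
    using 1 by blast+
  have old: "p' i = p i" "k' i = k i" if "i < n" for i using ag that by (auto simp: agree_def)
  have agn: "agree n p k p' k'" using old by (simp add: agree_def)
  have pn: "p' n = X" using par[of n] nn by simp
  note g = g[unfolded net_good_def, folded N_def]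
  have g1: "(p i < X \<or> N < p i \<and> p i < i \<and> \<not> is_input (k (p i))) \<and>
        (k i = AndGate \<longrightarrow> (\<exists>j. N < j \<and> j < n \<and> p j = i)) \<and>
        (\<forall>z. k i = Input z \<longrightarrow> z \<le> N + 1)" if "N < i" "i < n" for i
    using g[THEN conjunct1, rule_format, of i] that by simp
  have g2: "i = j" if "N < i" "i < n" "N < j" "j < n" "p i = p j" "p i < N" for i j
    by (rule g[THEN conjunct2, THEN conjunct1, rule_format]) (use that in simp)
  have g3: "\<exists>i. N < i \<and> i < n \<and> p i = x" if "x < X" for x
    by (rule g[THEN conjunct2, THEN conjunct2, THEN conjunct1, rule_format, OF that])
  have g4: "i \<in> T \<longleftrightarrow> holds (F (xs ! p i)) (letters xs Y)"
    if "N \<in> Y" "Suc N \<notin> Y" "consistent p k Y (N + 1) n T" "N < i" "i < n" "p i < N" for Y T i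
    by (rule g[THEN conjunct2, THEN conjunct2, THEN conjunct2, rule_format]) (use that in simp)
  have b1: "(p' i = X \<or> n \<le> p' i \<and> p' i < i \<and> \<not> is_input (k' (p' i))) \<and>
     (k' i = AndGate \<longrightarrow> (\<exists>j. n \<le> j \<and> j < n' \<and> p' j = i)) \<and>
     (\<forall>z. k' i = Input z \<longrightarrow> z \<le> N + 1)" if "n \<le> i" "i < n'" for i
    using b that unfolding block_def by blast
  have Nn: "N < n" "X < N" using n X by (auto simp: N_def)
  have A: "(p' i < X + 1 \<or> N < p' i \<and> p' i < i \<and> \<not> is_input (k' (p' i))) \<and>
        (k' i = AndGate \<longrightarrow> (\<exists>j. N < j \<and> j < n' \<and> p' j = i)) \<and>
        (\<forall>z. k' i = Input z \<longrightarrow> z \<le> N + 1)" if i: "N < i" "i < n'" for i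
  proof (cases "i < n")
    case True
    have "p i < n \<or> p i < X" using g1[OF i(1) True] True by auto
    hence "k' (p i) = k (p i)" using old(2)[of "p i"] Nn by auto
    moreover have "\<exists>j. N < j \<and> j < n' \<and> p' j = i" if "\<exists>j. N < j \<and> j < n \<and> p j = i"
      using that old(1) nn by (metis (no_types, lifting) add_lessD1 less_trans)
    ultimately show ?thesis using g1[OF i(1) True] old[OF True] by auto
  next
    case False
    hence ni: "n \<le> i" by simp
    have "\<exists>j. N < j \<and> j < n' \<and> p' j = i" if a: "k' i = AndGate"
    proof -
      obtain j where "n \<le> j" "j < n'" "p' j = i" using b1[OF ni i(2)] a by blast
      thus ?thesis using Nn(1) by (intro exI[of _ j]) simp
    qed
    moreover have "p' i < X + 1 \<or> N < p' i \<and> p' i < i \<and> \<not> is_input (k' (p' i))"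
      using b1[OF ni i(2)] Nn by auto
    moreover have "\<forall>z. k' i = Input z \<longrightarrow> z \<le> N + 1" using b1[OF ni i(2)] by blast
    ultimately show ?thesis by blast
  qed
  have B: "i = j" if "N < i" "i < n'" "N < j" "j < n'" "p' i = p' j" "p' i < N" for i j
  proof -
    have lowi: "p' l < X" if "N < l" "l < n" "p' l < N" for l
      using g1[of l] old[of l] that by auto
    have highi: "l = n" if "n \<le> l" "l < n'" "p' l < N" for l
      using b1[of l] par[of l] that Nn by auto
    show ?thesis
    proof (cases "i < n"; cases "j < n")
      assume "i < n" "j < n"
      thus ?thesis using g2[of i j] that old(1)[of i] old(1)[of j] by simp
    next
      assume "i < n" "\<not> j < n"
      thus ?thesis using lowi[of i] highi[of j] that pn by auto
    next
      assume "\<not> i < n" "j < n"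
      thus ?thesis using lowi[of j] highi[of i] that pn by auto
    next
      assume "\<not> i < n" "\<not> j < n"
      thus ?thesis using highi[of i] highi[of j] that by auto
    qed
  qed
  have C: "\<exists>i. N < i \<and> i < n' \<and> p' i = x" if "x < X + 1" for x
  proof (cases "x = X")
    case True
    thus ?thesis using pn Nn nn by (intro exI[of _ n]) auto
  next
    case False
    hence "x < X" using that by simp
    then obtain i where "N < i" "i < n" "p i = x" using g3 by blast
    thus ?thesis using old nn by (intro exI[of _ i]) auto
  qed
  have D: "i \<in> T \<longleftrightarrow> holds (F (xs ! p' i)) (letters xs Y)"
    if Y: "N \<in> Y" "Suc N \<notin> Y" and T: "consistent p' k' Y (N + 1) n' T" and i: "N < i" "i < n'" "p' i < N"
    for Y T i
  proof -
    have l: "p' l < n" if "N + 1 \<le> l" "l < n" for l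
      using g1[of l] old[of l] that Nn by auto
    have h: "p' l < N + 1 \<or> n \<le> p' l" if "n \<le> l" "l < n'" for l
      using b1[of l] that Nn by auto
    have T12: "consistent p' k' Y (N + 1) n T" "consistent p' k' Y n n' T"
      using consistent_split[OF l h _ _ T] Nn nn by auto
    show ?thesis
    proof (cases "i < n")
      case True
      have "consistent p k Y (N + 1) n T" using T12(1) consistent_agree[OF agn, of n] by simp
      thus ?thesis using g4[OF Y _ i(1) True] i(3) old(1)[OF True] by simp
    next
      case False
      hence "i = n" using b1[of i] par[of i] i Nn by auto
      thus ?thesis using sem[OF Y T12(2)] pn by simp
    qed
  qed
  show ?thesis
    unfolding net_good_def N_def[symmetric] using A B C D nn by blast
qed

text \<open>The linked list in terms of bare symbol codes, which are all that the program sees of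
  the letters.\<close>

fun code_list :: "(nat \<Rightarrow> nat) \<Rightarrow> nat \<Rightarrow> nat \<Rightarrow> nat list \<Rightarrow> bool" where
  "code_list M e q [] \<longleftrightarrow> q = 0"
| "code_list M e q (c # cs) \<longleftrightarrow> q \<noteq> 0 \<and> q + 1 < e \<and> M q = c \<and> code_list M e (M (q + 1)) cs"

lemma code_list_exists:
  assumes "linked_list xs e M q ss"
  obtains cs where "list_all2 (encodes_symbol xs) cs ss" "code_list M e q cs"
  using assms
proof (induction ss arbitrary: q thesis)
  case Nil
  thus ?case by (intro Nil.prems(1)[of "[]"]) auto
next
  case (Cons s ss)
  then obtain cs where "list_all2 (encodes_symbol xs) cs ss" "code_list M e (M (q + 1)) cs"
    by (metis linked_list.simps(2))
  thus ?case using Cons.prems by (intro Cons.prems(1)[of "M q # cs"]) auto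
qed

lemma encodes_symbol_bound: "encodes_symbol xs c s \<Longrightarrow> c < length xs + 6"
  by (cases s) auto

definition children :: "nat \<Rightarrow> (nat \<Rightarrow> nat) \<Rightarrow> nat \<Rightarrow> nat \<Rightarrow> nat" where
  "children N p n i = card {j. N < j \<and> j < n \<and> p j = i}"

lemma children_Suc:
  assumes "N < n"
  shows "children N (p(n := q)) (Suc n) i = children N p n i + (if q = i then 1 else 0)"
proof -
  have "{j. N < j \<and> j < Suc n \<and> (p(n := q)) j = i} =
    (if q = i then insert n {j. N < j \<and> j < n \<and> p j = i} else {j. N < j \<and> j < n \<and> p j = i})"
    using assms by (auto simp: less_Suc_eq)
  thus ?thesis by (simp add: children_def)
qed

context sorter begin

lemma chain_upd: "n \<notin> set l \<Longrightarrow> chain (f(n := x)) h l \<longleftrightarrow> chain f h l"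
  by (induction l arbitrary: h) auto


text \<open>
  The nodes up to \<open>N\<close> only serve as parents of roots. Their parent and kind are fixed
  arbitrarily, so that reading a symbol makes sense for unbalanced parentheses, too.
\<close>

definition core :: "nat \<Rightarrow> (nat \<Rightarrow> nat) \<Rightarrow> (nat \<Rightarrow> gate) \<Rightarrow> (nat \<Rightarrow> nat \<Rightarrow> nat) \<Rightarrow> bool" where
  "core n p k G \<longleftrightarrow> N < n \<and> (\<forall>i<n. G 2 i = p i \<and> p i < n) \<and>
     (\<forall>i\<le>N. p i = 0 \<and> k i = AndGate) \<and>
     (\<forall>i<n. k i = AndGate \<longrightarrow> (k (p i) = OrGate \<or> p i \<le> N) \<and> G 3 i \<le> n) \<and>
     (\<forall>i<n. k i = OrGate \<longrightarrow> k (p i) = AndGate \<and> G 3 i = 1) \<and>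
     (\<forall>i. N < i \<and> i < n \<and> k i = AndGate \<longrightarrow> G 3 i = children N p n i) \<and>
     (\<forall>z\<le>N + 1. \<exists>l. chain (G 4) (G 1 z) l \<and> distinct l \<and> set l = {i. N < i \<and> i < n \<and> k i = Input z})"

lemma core_lists:
  assumes "\<forall>z\<le>N + 1. \<exists>l. chain (G 4) (G 1 z) l \<and> distinct l \<and> set l = {i. N < i \<and> i < n \<and> k i = Input z}"
    "\<not> is_input g"
  shows "\<forall>z\<le>N + 1. \<exists>l. chain (G 4) (G 1 z) l \<and> distinct l \<and>
    set l = {i. N < i \<and> i < Suc n \<and> (k(n := g)) i = Input z}"
proof -
  have "{i. N < i \<and> i < Suc n \<and> (k(n := g)) i = Input z} = {i. N < i \<and> i < n \<and> k i = Input z}" for z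
    using assms(2) by (auto simp: less_Suc_eq split: if_splits)
  thus ?thesis using assms(1) by simp
qed

lemma core_and:
  assumes c: "core n p k G" and q: "q < n" "k q = OrGate \<or> q \<le> N"
  shows "core (Suc n) (p(n := q)) (k(n := AndGate))
    (G(2 := (G 2)(n := q), 3 := (G 3)(n := 0)))"
proof -
  note c' = c[unfolded core_def]
  have ch: "children N (p(n := q)) (Suc n) i = children N p n i" if "N < i" "i < n" "k i = AndGate" for i
    using c' q that children_Suc[of N n p q i] by auto
  have z: "children N (p(n := q)) (Suc n) n = 0"
  proof -
    have "{j. N < j \<and> j < Suc n \<and> (p(n := q)) j = n} = {}" using c' q by (auto simp: less_Suc_eq)
    thus ?thesis by (simp add: children_def)
  qed
  have 1: "\<forall>i<Suc n. (G(2 := (G 2)(n := q), 3 := (G 3)(n := 0))) 2 i = (p(n := q)) i \<and> (p(n := q)) i < Suc n"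
    using c' q by (auto simp: less_Suc_eq)
  have 2: "\<forall>i\<le>N. (p(n := q)) i = 0 \<and> (k(n := AndGate)) i = AndGate" using c' by auto
  have 3: "\<forall>i<Suc n. (k(n := AndGate)) i = AndGate \<longrightarrow>
    ((k(n := AndGate)) ((p(n := q)) i) = OrGate \<or> (p(n := q)) i \<le> N) \<and> (G(2 := (G 2)(n := q), 3 := (G 3)(n := 0))) 3 i \<le> Suc n"
    using c' q by (auto simp: less_Suc_eq)
  have 4: "\<forall>i<Suc n. (k(n := AndGate)) i = OrGate \<longrightarrow>
    (k(n := AndGate)) ((p(n := q)) i) = AndGate \<and> (G(2 := (G 2)(n := q), 3 := (G 3)(n := 0))) 3 i = 1"
    using c' q by (auto simp: less_Suc_eq)
  have 5: "\<forall>i. N < i \<and> i < Suc n \<and> (k(n := AndGate)) i = AndGate \<longrightarrow>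
    (G(2 := (G 2)(n := q), 3 := (G 3)(n := 0))) 3 i = children N (p(n := q)) (Suc n) i"
    using c' ch z by (auto simp: less_Suc_eq)
  have 6: "\<forall>z\<le>N + 1. \<exists>l. chain (G 4) (G 1 z) l \<and> distinct l \<and>
    set l = {i. N < i \<and> i < Suc n \<and> (k(n := AndGate)) i = Input z}"
    by (rule core_lists) (use c' in auto)
  show ?thesis unfolding core_def using 1 2 3 4 5 6 c' by simp
qed

text \<open>The new counter is left open for \<open>q \<le> N\<close>, because a letter above a root
  counts nothing. For a parenthesis inside a formula, the counter of the enclosing conjunction has
  to grow.\<close>

lemma core_or:
  assumes c: "core n p k G" and q: "q < n" "k q = AndGate"
    and G3: "\<And>i. i < n \<Longrightarrow> i \<noteq> q \<Longrightarrow> g i = G 3 i" "g n = 1"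
      "g q = (if q \<le> N then g q else G 3 q + 1)" "g q \<le> Suc n"
  shows "core (Suc n) (p(n := q)) (k(n := OrGate)) (G(2 := (G 2)(n := q), 3 := g))"
proof -
  note c' = c[unfolded core_def]
  have 1: "\<forall>i<Suc n. (G(2 := (G 2)(n := q), 3 := g)) 2 i = (p(n := q)) i \<and> (p(n := q)) i < Suc n"
    using c' q by (auto simp: less_Suc_eq)
  have 2: "\<forall>i\<le>N. (p(n := q)) i = 0 \<and> (k(n := OrGate)) i = AndGate" using c' by auto
  have 3: "((k(n := OrGate)) ((p(n := q)) i) = OrGate \<or> (p(n := q)) i \<le> N) \<and> g i \<le> Suc n"
    if "i < Suc n" "(k(n := OrGate)) i = AndGate" for i
  proof -
    have "i < n" "k i = AndGate" using that by (auto simp: less_Suc_eq split: if_splits)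
    thus ?thesis using c' G3 by (cases "i = q") (auto simp: le_SucI)
  qed
  have 4: "(k(n := OrGate)) ((p(n := q)) i) = AndGate \<and> g i = 1"
    if "i < Suc n" "(k(n := OrGate)) i = OrGate" for i
  proof (cases "i = n")
    case False
    hence i: "i < n" "k i = OrGate" using that by auto
    moreover have "i \<noteq> q" using i(2) q(2) by auto
    ultimately have "g i = 1" "k (p i) = AndGate" "p i < n" using c' G3(1)[of i] by auto
    thus ?thesis using False by simp
  qed (use G3 q in auto)
  have 5: "g i = children N (p(n := q)) (Suc n) i"
    if "N < i \<and> i < Suc n \<and> (k(n := OrGate)) i = AndGate" for i
  proof -
    have "N < i" "i < n" "k i = AndGate" using that by (auto simp: less_Suc_eq split: if_splits)
    thus ?thesis using c' G3 children_Suc[of N n p q i] by (cases "i = q") auto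
  qed
  have 6: "\<forall>z\<le>N + 1. \<exists>l. chain (G 4) (G 1 z) l \<and> distinct l \<and>
    set l = {i. N < i \<and> i < Suc n \<and> (k(n := OrGate)) i = Input z}"
    by (rule core_lists) (use c' in auto)
  show ?thesis unfolding core_def using 1 2 3 4 5 6 c' by simp
qed

lemma core_input:
  assumes c: "core n p k G" and q: "q < n" "k q = AndGate" and z: "z \<le> N + 1"
  shows "core (Suc n) (p(n := q)) (k(n := Input z))
    (G(2 := (G 2)(n := q), 3 := (G 3)(q := G 3 q + 1), 4 := (G 4)(n := G 1 z), 1 := (G 1)(z := n)))"
    (is "core _ ?p ?k ?G")
proof -
  note c' = c[unfolded core_def]
  have 1: "\<forall>i<Suc n. ?G 2 i = ?p i \<and> ?p i < Suc n"
    using c' q by (auto simp: less_Suc_eq)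
  have 2: "\<forall>i\<le>N. ?p i = 0 \<and> ?k i = AndGate" using c' by auto
  have 3: "(?k (?p i) = OrGate \<or> ?p i \<le> N) \<and> ?G 3 i \<le> Suc n" if "i < Suc n" "?k i = AndGate" for i
  proof -
    have "i < n" "k i = AndGate" using that by (auto simp: less_Suc_eq split: if_splits)
    thus ?thesis using c' by (auto simp: le_SucI)
  qed
  have 4: "?k (?p i) = AndGate \<and> ?G 3 i = 1" if "i < Suc n" "?k i = OrGate" for i
  proof -
    have "i < n" "k i = OrGate" using that by (auto simp: less_Suc_eq split: if_splits)
    thus ?thesis using c' q by auto
  qed
  have 5: "?G 3 i = children N ?p (Suc n) i" if "N < i \<and> i < Suc n \<and> ?k i = AndGate" for i
  proof -
    have "N < i" "i < n" "k i = AndGate" using that by (auto simp: less_Suc_eq split: if_splits)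
    thus ?thesis using c' children_Suc[of N n p q i] by (cases "i = q") auto
  qed
  have 6: "\<exists>l. chain (?G 4) (?G 1 y) l \<and> distinct l \<and> set l = {i. N < i \<and> i < Suc n \<and> ?k i = Input y}"
    if y: "y \<le> N + 1" for y
  proof -
    obtain l where l: "chain (G 4) (G 1 y) l" "distinct l" "set l = {i. N < i \<and> i < n \<and> k i = Input y}"
      using c'[THEN conjunct2, THEN conjunct2, THEN conjunct2, THEN conjunct2, THEN conjunct2, THEN conjunct2] y
      by blast
    have nl: "n \<notin> set l" using l(3) by auto
    show ?thesis
    proof (cases "y = z")
      case True
      have "set (n # l) = {i. N < i \<and> i < Suc n \<and> ?k i = Input y}"
        using l(3) True c' by (auto simp: less_Suc_eq split: if_splits)
      thus ?thesis using True l nl c' by (intro exI[of _ "n # l"]) (auto simp: chain_upd)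
    next
      case False
      have "set l = {i. N < i \<and> i < Suc n \<and> ?k i = Input y}"
        using l(3) False by (auto simp: less_Suc_eq split: if_splits)
      thus ?thesis using False l nl by (intro exI[of _ l]) (auto simp: chain_upd)
    qed
  qed
  show ?thesis unfolding core_def using 1 2 3 4 5 6 c' by auto
qed

definition read_code :: cmd where
  "read_code =
     If (Equal 29 7)
       (Do (Get 30 2 11) ;; Do (Put 2 10 30) ;; Do (Put 3 10 8) ;; Do (Cpy 11 10) ;; Do (Arith Add 10 10 6))
     (Do (Imm 30 3) ;; If (Equal 29 30) skip_code
     (Do (Imm 30 4) ;; If (Equal 29 30)
       (Do (Get 31 3 11) ;; Do (Arith Add 31 31 6) ;; Do (Put 3 11 31) ;;
        Do (Put 2 10 11) ;; Do (Put 3 10 6) ;; Do (Arith Add 11 10 6) ;;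
        Do (Put 2 11 10) ;; Do (Put 3 11 8) ;; Do (Arith Add 10 10 7))
     (Do (Imm 30 5) ;; If (Equal 29 30) (Do (Get 11 2 11) ;; Do (Get 11 2 11))
       (If (Equal 29 8) (Do (Arith Add 31 0 6))
          (If (Equal 29 6) (Do (Cpy 31 0)) (Do (Imm 30 6) ;; Do (Arith Sub 31 29 30))) ;;
        Do (Get 30 3 11) ;; Do (Arith Add 30 30 6) ;; Do (Put 3 11 30) ;;
        Do (Put 2 10 11) ;; Do (Get 30 1 31) ;; Do (Put 4 10 30) ;; Do (Put 1 31 10) ;;
        Do (Arith Add 10 10 6)))))"

lemma wp_read:
  assumes R: "std R" "R 10 = n" "R 11 = a" "R 29 = c" and c: "core n p k G" "a < n" "k a = AndGate"
    and cb: "c < N + 6" and nL: "n + 2 \<le> L"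
    and rd: "read_symbol N (n, a, p, k) c = (n', a', p', k')"
    and post: "\<And>R' G' s. same {10, 11, 20, 30, 31} R R' \<Longrightarrow> R' 10 = n' \<Longrightarrow> R' 11 = a' \<Longrightarrow>
      core n' p' k' G' \<Longrightarrow> a' < n' \<Longrightarrow> k' a' = AndGate \<Longrightarrow>
      (\<And>f. f \<notin> {1, 2, 3, 4} \<Longrightarrow> G' f = G f) \<Longrightarrow> s \<le> t + 100 \<Longrightarrow> Q R' G' s"
  shows "wp read_code Q R G t"
proof -
  note c' = c(1)[unfolded core_def]
  have r: "R 0 = N" "R 6 = 1" "R 7 = 2" "R 8 = 0" using R(1) by (auto simp: std_def)
  have lt: "a < L" "n < L" "n + 1 < L" "N + 1 < L" using c(2) nL room by auto
  have w: "n + 2 < 2 ^ w" "N + 1 < 2 ^ w" "(6::nat) < 2 ^ w" using nL room small by auto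
  have pa: "p a < n" "k (p a) = OrGate \<or> p a \<le> N" "G 2 a = p a" "G 3 a \<le> n" using c' c(2,3) by auto
  have G3: "G 3 a + 1 < 2 ^ w" using pa(4) w by simp
  \<comment> \<open>If \<open>p a\<close> is at most \<open>N\<close>, the second step ends at node
    0, which is marked as an And gate. Otherwise \<open>p a\<close> is an Or gate below an And gate,
    as after a matched parenthesis.\<close>
  have kppa: "k (p (p a)) = AndGate" "p (p a) < n" "G 2 (p a) = p (p a)"
  proof -
    have k0: "k 0 = AndGate" "\<And>i. i \<le> N \<Longrightarrow> p i = 0" using c' by auto
    show "k (p (p a)) = AndGate" using pa(1,2) c' k0 by (cases "p a \<le> N") auto
    show "p (p a) < n" "G 2 (p a) = p (p a)" using pa(1) c' by auto
  qed
  consider "c = 2" | "c = 3" | "c = 4" | "c = 5" | "c \<notin> {2, 3, 4, 5}" by auto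
  thus ?thesis
  proof cases
    case 1
    have e: "n' = Suc n" "a' = n" "p' = p(n := p a)" "k' = k(n := AndGate)" using rd 1 by auto
    have "core n' p' k' (G(2 := (G 2)(n := p a), 3 := (G 3)(n := 0)))"
      unfolding e by (rule core_and[OF c(1) pa(1,2)])
    thus ?thesis unfolding read_code_def wp_simps using 1 R r lt w pa e
      by simp (rule post; simp add: same_def)
  next
    case 2
    have e: "n' = n" "a' = a" "p' = p" "k' = k" using rd 2 by auto
    show ?thesis unfolding read_code_def wp_simps wp_skip using 2 R r lt w c e
      by simp (rule post; simp add: same_def)
  next
    case 3
    have e: "n' = Suc (Suc n)" "a' = Suc n" "p' = p(n := a, Suc n := n)" "k' = k(n := OrGate, Suc n := AndGate)"
      using rd 3 by auto
    have "core (Suc n) (p(n := a)) (k(n := OrGate))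
      (G(2 := (G 2)(n := a), 3 := (G 3)(a := G 3 a + 1, n := 1)))"
      by (rule core_or[OF c]) (use c(2) pa in auto)
    from core_and[OF this, of n]
    have "core n' p' k' (G(2 := (G 2)(n := a, Suc n := n), 3 := (G 3)(a := Suc (G 3 a), n := Suc 0, Suc n := 0)))"
      unfolding e by simp
    moreover have "G(3 := (G 3)(a := x), 2 := y, 3 := z) = G(2 := y, 3 := z)" for x y z by auto
    moreover have "G(2 := x, 3 := y, 2 := z, 3 := v) = G(2 := z, 3 := v)" for x y z v by auto
    ultimately show ?thesis unfolding read_code_def wp_simps using 3 R r lt w pa G3 e c(2)
      by simp (rule post; simp add: same_def)
  next
    case 4
    have e: "n' = n" "a' = p (p a)" "p' = p" "k' = k" using rd 4 by auto
    show ?thesis unfolding read_code_def wp_simps using 4 R r lt w pa kppa c(1) e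
      by simp (rule post; simp add: same_def)
  next
    case 5
    define z where "z = input_of N c"
    have e: "n' = Suc n" "a' = a" "p' = p(n := a)" "k' = k(n := Input z)" using rd 5 by (auto simp: z_def)
    have z: "z \<le> N + 1" "z < L" using 5 cb lt by (auto simp: z_def input_of_def)
    have "core n' p' k' (G(2 := (G 2)(n := a), 3 := (G 3)(a := G 3 a + 1), 4 := (G 4)(n := G 1 z), 1 := (G 1)(z := n)))"
      unfolding e by (rule core_input[OF c z(1)])
    hence core: "core n' p' k' (G(3 := (G 3)(a := Suc (G 3 a)), 2 := (G 2)(n := a), 4 := (G 4)(n := G 1 z), 1 := (G 1)(z := n)))"
      by (simp add: fun_upd_twist[of 2 3])
    let ?rest = "Do (Get 30 3 11) ;; Do (Arith Add 30 30 6) ;; Do (Put 3 11 30) ;;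
        Do (Put 2 10 11) ;; Do (Get 30 1 31) ;; Do (Put 4 10 30) ;; Do (Put 1 31 10) ;; Do (Arith Add 10 10 6)"
    have rest: "wp ?rest Q R1 G s" if "same {30, 31} R R1" "R1 31 = z" "s \<le> t + 50" for R1 s
    proof -
      have r1: "R1 10 = n" "R1 11 = a" "R1 6 = 1" "R1 10 = n" using that(1) R r by (auto simp: same_def)
      have "Q (R1(30 := G 1 z, 10 := Suc n))
        (G(3 := (G 3)(a := Suc (G 3 a)), 2 := (G 2)(n := a), 4 := (G 4)(n := G 1 z), 1 := (G 1)(z := n))) (48 + s)"
        by (rule post) (use that r1 e core c in \<open>auto simp: same_def\<close>)
      thus ?thesis unfolding wp_simps using r1 that(2) lt z w G3 c(2) by simp
    qed
    show ?thesis
    proof -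
      have z0: "wp ?rest Q (R(30 := 5, 31 := z)) G (34 + t)" "wp ?rest Q (R(30 := 5, 31 := z)) G (36 + t)"
        "wp ?rest Q (R(30 := 6, 31 := z)) G (42 + t)"
        by (rule rest; simp add: same_def)+
      consider "c = 0" "z = Suc N" | "c = 1" "z = N" | "6 \<le> c" "c \<noteq> 0" "c \<noteq> 1" "z = c - 6"
      proof -
        have "c = 0 \<or> c = 1 \<or> 6 \<le> c" using 5 by (simp, linarith)
        thus ?thesis using that by (auto simp: z_def input_of_def)
      qed
      thus ?thesis
      proof cases
        case 1
        thus ?thesis using z0(1)[unfolded wp_simps] R r w
          unfolding read_code_def wp_simps by simp
      next
        case 2
        thus ?thesis using z0(2)[unfolded wp_simps] R r w
          unfolding read_code_def wp_simps by simp
      next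
        case 3
        thus ?thesis using z0(3)[unfolded wp_simps] R r w 5
          unfolding read_code_def wp_simps by simp
      qed
    qed
  qed
qed


section \<open>Initialisation and parsing of the input\<close>

definition init_code :: cmd where
  "init_code =
     Do (Imm 6 1) ;; Do (Imm 7 2) ;; Do (Imm 8 0) ;; Do (Imm 9 0) ;; Do (Put 6 8 0) ;;
     Do (Arith Add 10 0 7) ;; Do (Cpy 12 8) ;;
     While True (Less 12 10) (Do (Put 1 12 8) ;; Do (Put 2 12 8) ;; Do (Put 3 12 8) ;; Do (Arith Add 12 12 6)) ;;
     Do (Arith Add 10 0 6)"

definition formula_code :: cmd where
  "formula_code = While False (Equal 28 8)
     (Do (Rd 29 28) ;; Do (Arith Add 28 28 6) ;; Do (Rd 28 28) ;; read_code)"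

definition parse_code :: cmd where
  "parse_code = Do (Cpy 12 8) ;;
     While True (Less 12 0)
       (Do (Arith Add 28 1 12) ;; Do (Rd 28 28) ;;
        Do (Put 2 10 12) ;; Do (Put 3 10 6) ;; Do (Arith Add 11 10 6) ;;
        Do (Put 2 11 10) ;; Do (Put 3 11 8) ;; Do (Arith Add 10 10 7) ;;
        formula_code ;; Do (Arith Add 12 12 6))"

text \<open>The working space has arbitrary contents. Clearing \<open>N + 2\<close> entries is
  enough: the list heads of all inputs including the two constants, and the dummy nodes up to
  \<open>N\<close>. Later nodes set the fields they need on creation. The entry \<open>N\<close> at
  spine level 0 represents the empty tournament.\<close>

lemma wp_init:
  assumes R: "R 0 = N"
    and post: "\<And>R' G' s. same {6..12} R R' \<Longrightarrow> std R' \<Longrightarrow> R' 9 = 0 \<Longrightarrow> R' 10 = N + 1 \<Longrightarrow>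
      core (N + 1) (\<lambda>_. 0) (\<lambda>_. AndGate) G' \<Longrightarrow> heap_ok [] {} G' \<Longrightarrow>
      s \<le> t + 200 + 30 * N \<Longrightarrow> Q R' G' s"
  shows "wp init_code Q R G t"
proof -
  have w: "N + 2 < 2 ^ w" "N + 2 \<le> L" using room small by auto
  let ?body = "Do (Put 1 12 8) ;; Do (Put 2 12 8) ;; Do (Put 3 12 8) ;; Do (Arith Add 12 12 6)"
  let ?R0 = "R(6 := 1, 7 := 2, 8 := 0, 9 := 0, 10 := N + 2, 12 := 0)"
  define J where "J R1 G1 s \<longleftrightarrow> same {6..12} R R1 \<and> std R1 \<and> R1 9 = 0 \<and> R1 10 = N + 2 \<and> R1 12 \<le> N + 2 \<and>
    (\<forall>i<R1 12. G1 1 i = 0 \<and> G1 2 i = 0 \<and> G1 3 i = 0) \<and> G1 6 0 = N \<and> s \<le> t + 42 + 27 * R1 12"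
    for R1 :: "nat \<Rightarrow> nat" and G1 :: "nat \<Rightarrow> nat \<Rightarrow> nat" and s :: nat
  have "wp (While True (Less 12 10) ?body) (wp (Do (Arith Add 10 0 6)) Q) ?R0 (G(6 := (G 6)(0 := N))) (42 + t)"
  proof (rule wp_While[where J = J and m = "\<lambda>R G. N + 2 - R 12"])
    show "J ?R0 (G(6 := (G 6)(0 := N))) (42 + t)"
      using R unfolding J_def by (auto simp: same_def std_def)
  next
    fix R1 G1 s
    assume J: "J R1 G1 s" and c: "holds_test (Less 12 10) R1 = True"
    let ?R2 = "R1(12 := Suc (R1 12))"
    let ?G2 = "G1(1 := (G1 1)(R1 12 := 0), 2 := (G1 2)(R1 12 := 0), 3 := (G1 3)(R1 12 := 0))"
    have lt: "R1 12 < N + 2" using c J by (simp add: J_def)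
    have "J ?R2 ?G2 (27 + s)"
      using J lt unfolding J_def by (auto simp: same_def std_def less_Suc_eq)
    moreover have "R1 6 = 1" "R1 8 = 0" using J by (auto simp: J_def std_def)
    ultimately show "wp ?body (\<lambda>R' G' t'. J R' G' t' \<and> N + 2 - R' 12 < N + 2 - R1 12) R1 G1 (s + 3)"
      unfolding wp_simps using lt w by simp
  next
    fix R1 G1 s
    assume J: "J R1 G1 s" and c: "holds_test (Less 12 10) R1 \<noteq> True"
    hence eq: "R1 12 = N + 2" and z: "\<And>i. i < N + 2 \<Longrightarrow> G1 1 i = 0 \<and> G1 2 i = 0 \<and> G1 3 i = 0"
      by (auto simp: J_def)
    have "core (N + 1) (\<lambda>_. 0) (\<lambda>_. AndGate) G1"
      unfolding core_def using z by (auto intro!: exI[of _ "[]"])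
    moreover have "heap_ok [] {} G1"
    proof -
      have nf: "\<not> formed 0 k j" for k j
        using mult_le_mono[of 2 "j + 2" 1 "2 ^ k"] by (simp add: formed_def)
      have k0: "k = 0" if "(2::nat) ^ k \<le> 1" for k using less_exp[of k] that by linarith
      have "spine_ok (G1 6) [] {} k" if "2 ^ k \<le> length ([] :: nat list) + 1" for k
        using J k0[of k] that by (simp add: spine_ok_def seg_def is_min_def J_def)
      thus ?thesis using nf by (simp add: heap_ok_def)
    qed
    moreover have "std (R1(10 := N + 1))" "same {6..12} R (R1(10 := N + 1))" "R1 9 = 0"
      using J by (auto simp: J_def std_def same_def)
    moreover have "s + 2 + 6 \<le> t + 200 + 30 * N" using J eq by (simp add: J_def)
    ultimately have "Q (R1(10 := N + 1)) G1 (s + 2 + 6)" by (intro post) simp_all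
    moreover have "R1 0 = N" "R1 6 = 1" using J by (simp_all add: J_def std_def)
    ultimately show "wp (Do (Arith Add 10 0 6)) Q R1 G1 (s + 2)"
      unfolding wp_Do using w by simp
  qed
  moreover have "(2::nat) < 2 ^ w" "0 < L" using w small by auto
  ultimately show ?thesis using R w(1) unfolding init_code_def wp_Seq wp_Do by simp
qed

lemma wp_formula:
  assumes R: "std R" "R 10 = n" "R 11 = a" and c: "core n p k G" "a < n" "k a = AndGate"
    and cs: "code_list I e (R 28) cs" "\<forall>c\<in>set cs. c < N + 6"
    and n: "n + 2 * length cs \<le> L" and e: "e < 2 ^ w"
    and rd: "read_symbols N (n, a, p, k) cs = (n', a', p', k')"
    and post: "\<And>R' G' s. same ({10, 11, 20} \<union> {28..31}) R R' \<Longrightarrow> R' 10 = n' \<Longrightarrow>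
      core n' p' k' G' \<Longrightarrow> (\<And>f. f \<notin> {1, 2, 3, 4} \<Longrightarrow> G' f = G f) \<Longrightarrow>
      s \<le> t + 10 + 150 * length cs \<Longrightarrow> Q R' G' s"
  shows "wp formula_code Q R G t"
proof -
  let ?X = "{10, 11, 20} \<union> {28..31} :: nat set"
  define J where "J x R1 G1 s \<longleftrightarrow> (\<exists>cs1 n1 a1 p1 k1. length cs1 = x \<and> code_list I e (R1 28) cs1 \<and>
    (\<forall>c\<in>set cs1. c < N + 6) \<and> core n1 p1 k1 G1 \<and> a1 < n1 \<and> k1 a1 = AndGate \<and> R1 10 = n1 \<and> R1 11 = a1 \<and>
    n1 + 2 * length cs1 \<le> L \<and> read_symbols N (n1, a1, p1, k1) cs1 = (n', a', p', k') \<and>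
    same ?X R R1 \<and> (\<forall>f. f \<notin> {1, 2, 3, 4} \<longrightarrow> G1 f = G f) \<and> s + 150 * length cs1 \<le> t + 150 * length cs)"
    for x :: nat and R1 :: "nat \<Rightarrow> nat" and G1 :: "nat \<Rightarrow> nat \<Rightarrow> nat" and s :: nat
  show ?thesis unfolding formula_code_def
  proof (rule wp_While_index[where J = J and x = "length cs"])
    show "J (length cs) R G t"
      unfolding J_def
      by (rule exI[of _ cs], rule exI[of _ n], rule exI[of _ a], rule exI[of _ p], rule exI[of _ k])
        (use R c cs n rd in \<open>simp add: same_def\<close>)
  next
    fix x R1 G1 s
    assume "J x R1 G1 s" and c: "holds_test (Equal 28 8) R1 = False"
    then obtain cs1 n1 a1 p1 k1 where J: "length cs1 = x" "code_list I e (R1 28) cs1"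
      "\<forall>c\<in>set cs1. c < N + 6" "core n1 p1 k1 G1" "a1 < n1" "k1 a1 = AndGate" "R1 10 = n1" "R1 11 = a1"
      "n1 + 2 * length cs1 \<le> L" "read_symbols N (n1, a1, p1, k1) cs1 = (n', a', p', k')"
      "same ?X R R1" "\<forall>f. f \<notin> {1, 2, 3, 4} \<longrightarrow> G1 f = G f" "s + 150 * length cs1 \<le> t + 150 * length cs"
      unfolding J_def by blast
    have std: "std R1" using same_std[OF J(11) _ R(1)] by simp
    have "R1 28 \<noteq> 0" using c std by (simp add: std_def)
    then obtain d cs2 where d: "cs1 = d # cs2" "R1 28 + 1 < e" "I (R1 28) = d" "code_list I e (I (R1 28 + 1)) cs2"
      using J(2) by (cases cs1) auto
    obtain n2 a2 p2 k2 where s2: "read_symbol N (n1, a1, p1, k1) d = (n2, a2, p2, k2)"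
      by (metis prod.exhaust)
    have n2: "n2 \<le> n1 + 2" using s2 by (auto split: if_splits)
    let ?P = "\<lambda>R' G' t'. \<exists>y<x. J y R' G' t'"
    let ?R2 = "R1(29 := d, 28 := I (R1 28 + 1))"
    have "wp read_code ?P ?R2 G1 (21 + s)"
    proof (rule wp_read[where n = n1 and a = a1 and c = d and p = p1 and k = k1])
      show "std ?R2" "?R2 10 = n1" "?R2 11 = a1" "?R2 29 = d" using std J by (auto simp: std_def)
      show "core n1 p1 k1 G1" "a1 < n1" "k1 a1 = AndGate" by fact+
      show "d < N + 6" "n1 + 2 \<le> L" using J(3,9) d(1) by auto
      show "read_symbol N (n1, a1, p1, k1) d = (n2, a2, p2, k2)" by fact
      fix R' G' s'
      assume *: "same {10, 11, 20, 30, 31} ?R2 R'" "R' 10 = n2" "R' 11 = a2" "core n2 p2 k2 G'" "a2 < n2"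
        "k2 a2 = AndGate" "\<And>f. f \<notin> {1, 2, 3, 4} \<Longrightarrow> G' f = G1 f" "s' \<le> 21 + s + 100"
      have "J (length cs2) R' G' s'"
        unfolding J_def
      proof (rule exI[of _ cs2], rule exI[of _ n2], rule exI[of _ a2], rule exI[of _ p2], rule exI[of _ k2], intro conjI)
        show "code_list I e (R' 28) cs2" using *(1) d(4) by (simp add: same_def)
        show "\<forall>c\<in>set cs2. c < N + 6" using J(3) d(1) by simp
        show "n2 + 2 * length cs2 \<le> L" using n2 J(9) d(1) by simp
        show "read_symbols N (n2, a2, p2, k2) cs2 = (n', a', p', k')" using J(10) d(1) s2 by simp
        show "same ?X R R'" using *(1) J(11) by (auto simp: same_def)
        show "\<forall>f. f \<notin> {1, 2, 3, 4} \<longrightarrow> G' f = G f" using *(7) J(12) by auto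
        show "s' + 150 * length cs2 \<le> t + 150 * length cs" using *(8) J(13) d(1) by simp
      qed (use * in auto)
      thus "?P R' G' s'" using J(1) d(1) by auto
    qed
    moreover have "R1 28 + 1 < 2 ^ w" using d(2) e by linarith
    ultimately show "wp (Do (Rd 29 28) ;; Do (Arith Add 28 28 6) ;; Do (Rd 28 28) ;; read_code) ?P R1 G1 (s + 3)"
      unfolding wp_Seq wp_Do using d std by (simp add: std_def)
  next
    fix x R1 G1 s
    assume "J x R1 G1 s" and c: "holds_test (Equal 28 8) R1 \<noteq> False"
    then obtain cs1 n1 a1 p1 k1 where J: "length cs1 = x" "code_list I e (R1 28) cs1"
      "core n1 p1 k1 G1" "R1 10 = n1"
      "read_symbols N (n1, a1, p1, k1) cs1 = (n', a', p', k')"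
      "same ?X R R1" "\<forall>f. f \<notin> {1, 2, 3, 4} \<longrightarrow> G1 f = G f" "s + 150 * length cs1 \<le> t + 150 * length cs"
      unfolding J_def by blast
    have "std R1" using same_std[OF J(6) _ R(1)] by simp
    hence "R1 28 = 0" using c by (simp add: std_def)
    hence "cs1 = []" using J(2) by (cases cs1) auto
    thus "Q R1 G1 (s + 2)" using J by (intro post) auto
  qed
qed

lemma wp_parse:
  fixes xs :: "'a list" and F :: "'a \<Rightarrow> 'a formula"
  defines "len \<equiv> \<lambda>x. length (symbols (F (xs ! x)))"
  assumes xs: "length xs = N" "distinct xs"
    and heads: "\<And>x. x < N \<Longrightarrow> linked_list xs e I (I (R 1 + x)) (symbols (F (xs ! x)))"
      "R 1 + N \<le> e" "e < 2 ^ w"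
    and R: "std R" "R 10 = N + 1" and c: "core (N + 1) (\<lambda>_. 0) (\<lambda>_. AndGate) G"
    and L: "N + 1 + 2 * N + 2 * (\<Sum>x<N. len x) \<le> L"
    and post: "\<And>R' G' s n p k. same ({10, 11, 12, 20} \<union> {28..31}) R R' \<Longrightarrow>
      n \<le> N + 1 + 2 * N + 2 * (\<Sum>x<N. len x) \<Longrightarrow>
      core n p k G' \<Longrightarrow> net_good xs F N n p k \<Longrightarrow> (\<And>f. f \<notin> {1, 2, 3, 4} \<Longrightarrow> G' f = G f) \<Longrightarrow>
      s \<le> t + 20 + 150 * N + 150 * (\<Sum>x<N. len x) \<Longrightarrow> Q R' G' s"
  shows "wp parse_code Q R G t"
proof -
  let ?X = "{10, 11, 12, 20} \<union> {28..31} :: nat set"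
  let ?body = "Do (Arith Add 28 1 12) ;; Do (Rd 28 28) ;;
        Do (Put 2 10 12) ;; Do (Put 3 10 6) ;; Do (Arith Add 11 10 6) ;;
        Do (Put 2 11 10) ;; Do (Put 3 11 8) ;; Do (Arith Add 10 10 7) ;;
        formula_code ;; Do (Arith Add 12 12 6)"
  define J where "J R1 G1 s \<longleftrightarrow> (\<exists>n p k. core n p k G1 \<and> net_good xs F (R1 12) n p k \<and> R1 10 = n \<and>
    R1 12 \<le> N \<and> n \<le> N + 1 + 2 * R1 12 + 2 * (\<Sum>x<R1 12. len x) \<and> same ?X R R1 \<and>
    (\<forall>f. f \<notin> {1, 2, 3, 4} \<longrightarrow> G1 f = G f) \<and> s \<le> t + 6 + 100 * R1 12 + 150 * (\<Sum>x<R1 12. len x))"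
    for R1 :: "nat \<Rightarrow> nat" and G1 :: "nat \<Rightarrow> nat \<Rightarrow> nat" and s :: nat
  have "wp (While True (Less 12 0) ?body) Q (R(12 := 0)) G (t + 6)"
  proof (rule wp_While[where J = J and m = "\<lambda>R G. N - R 12"])
    have "net_good xs F 0 (N + 1) (\<lambda>_. 0) (\<lambda>_. AndGate)"
      using xs(1) by (auto simp: net_good_def)
    thus "J (R(12 := 0)) G (t + 6)"
      unfolding J_def using c R
      by (intro exI[of _ "N + 1"] exI[of _ "\<lambda>_. 0"] exI[of _ "\<lambda>_. AndGate"]) (simp add: same_def)
  next
    fix R1 G1 s
    assume "J R1 G1 s" and c: "holds_test (Less 12 0) R1 = True"
    then obtain n p k where J: "core n p k G1" "net_good xs F (R1 12) n p k" "R1 10 = n"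
      "R1 12 \<le> N" "n \<le> N + 1 + 2 * R1 12 + 2 * (\<Sum>x<R1 12. len x)" "same ?X R R1"
      "\<forall>f. f \<notin> {1, 2, 3, 4} \<longrightarrow> G1 f = G f" "s \<le> t + 6 + 100 * R1 12 + 150 * (\<Sum>x<R1 12. len x)"
      unfolding J_def by blast
    have std: "std R1" using same_std[OF J(6) _ R(1)] by simp
    define x where "x = R1 12"
    have x: "x < N" using c std by (simp add: std_def x_def)
    have "R1 1 = R 1" using J(6) by (simp add: same_def)
    obtain cs where cs: "list_all2 (encodes_symbol xs) cs (symbols (F (xs ! x)))" "code_list I e (I (R1 1 + x)) cs"
      using code_list_exists[OF heads(1)[OF x]] \<open>R1 1 = R 1\<close> by metis
    have lcs: "length cs = len x" using list_all2_lengthD[OF cs(1)] by (simp add: len_def)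
    have cb: "\<forall>c\<in>set cs. c < N + 6"
    proof
      fix c assume "c \<in> set cs"
      then obtain i where "i < length cs" "cs ! i = c" by (auto simp: in_set_conv_nth)
      hence "encodes_symbol xs c (symbols (F (xs ! x)) ! i)" using list_all2_nthD[OF cs(1)] by blast
      thus "c < N + 6" using encodes_symbol_bound[of xs c] xs(1) by simp
    qed
    define p1 k1 where "p1 = p(n := x, n + 1 := n)" and "k1 = k(n := OrGate, n + 1 := AndGate)"
    obtain n' a' p' k' where rd: "read_symbols N (n + 2, n + 1, p1, k1) cs = (n', a', p', k')"
      by (metis prod.exhaust)
    have Nn: "N < n" "x < n" "k x = AndGate" "G1 3 x \<le> n" using J(1) x by (auto simp: core_def)
    have step: "net_good xs F (x + 1) n' p' k'"
      using net_good_step[of xs F x n p k cs n' a' p' k'] J(2) Nn x xs cs(1) rd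
      by (simp add: p1_def k1_def x_def)
    let ?G2 = "G1(2 := (G1 2)(n := x, Suc n := n), 3 := (G1 3)(n := 1, Suc n := 0))"
    have "core (Suc n) (p(n := x)) (k(n := OrGate)) (G1(2 := (G1 2)(n := x), 3 := (G1 3)(n := 1)))"
      by (rule core_or[OF J(1)]) (use Nn x in auto)
    from core_and[OF this, of n] have core1: "core (n + 2) p1 k1 ?G2"
      by (simp add: p1_def k1_def)
    have sumx: "(\<Sum>y<Suc x. len y) = (\<Sum>y<x. len y) + len x" by simp
    have "(\<Sum>y<Suc x. len y) \<le> (\<Sum>y<N. len y)" using x by (intro sum_mono2) auto
    hence nL: "n + 2 + 2 * length cs \<le> L" using J(5) L x lcs sumx by (simp add: x_def)
    have n': "n' \<le> n + 2 + 2 * len x" using read_symbols_size[OF rd] lcs by simp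
    let ?P = "\<lambda>R' G' t'. J R' G' t' \<and> N - R' 12 < N - R1 12"
    let ?R2 = "R1(28 := I (R1 1 + x), 11 := n + 1, 10 := n + 2)"
    have "wp formula_code (wp (Do (Arith Add 12 12 6)) ?P) ?R2 ?G2 (51 + s)"
    proof (rule wp_formula[where n = "n + 2" and a = "n + 1" and p = p1 and k = k1 and cs = cs])
      show "std ?R2" "?R2 10 = n + 2" "?R2 11 = n + 1" using std by (auto simp: std_def)
      show "core (n + 2) p1 k1 ?G2" "\<forall>c\<in>set cs. c < N + 6" "n + 2 + 2 * length cs \<le> L" "e < 2 ^ w" by fact+
      show "n + 1 < n + 2" "k1 (n + 1) = AndGate" by (auto simp: k1_def)
      show "code_list I e (?R2 28) cs" using cs(2) by simp
      show "read_symbols N (n + 2, n + 1, p1, k1) cs = (n', a', p', k')" by fact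
      fix R' G' s'
      assume *: "same ({10, 11, 20} \<union> {28..31}) ?R2 R'" "R' 10 = n'" "core n' p' k' G'"
        "\<And>f. f \<notin> {1, 2, 3, 4} \<Longrightarrow> G' f = ?G2 f" "s' \<le> 51 + s + 10 + 150 * length cs"
      have r: "R' 12 = x" "R' 6 = 1" using *(1) std by (auto simp: same_def x_def std_def)
      have "J (R'(12 := Suc x)) G' (s' + 6)"
        unfolding J_def
      proof (rule exI[of _ n'], rule exI[of _ p'], rule exI[of _ k'], intro conjI)
        show "same ?X R (R'(12 := Suc x))" using *(1) J(6) by (auto simp: same_def)
        show "\<forall>f. f \<notin> {1, 2, 3, 4} \<longrightarrow> G' f = G f" using *(4) J(7) by auto
        show "s' + 6 \<le> t + 6 + 100 * (R'(12 := Suc x)) 12 + 150 * (\<Sum>x<(R'(12 := Suc x)) 12. len x)"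
          using *(5) J(8) lcs by (simp add: x_def)
        show "n' \<le> N + 1 + 2 * (R'(12 := Suc x)) 12 + 2 * (\<Sum>x<(R'(12 := Suc x)) 12. len x)"
          using n' J(5) by (simp add: x_def)
      qed (use * step x in simp_all)
      thus "wp (Do (Arith Add 12 12 6)) ?P R' G' s'"
        unfolding wp_Do using r x small[of "Suc x"] by (simp add: x_def[symmetric])
    qed
    moreover have "R1 1 + x < e" using heads(2) x \<open>R1 1 = R 1\<close> by simp
    moreover have "n + 1 < L" using nL by simp
    moreover have "n + 2 < 2 ^ w" using nL room x by simp
    moreover have "G1(2 := a, 3 := b, 2 := c, 3 := d) = G1(2 := c, 3 := d)" for a b c d by auto
    ultimately show "wp ?body ?P R1 G1 (s + 3)"
      unfolding wp_Seq wp_Do using std J(3) heads(3) by (simp add: std_def x_def[symmetric])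
  next
    fix R1 G1 s
    assume "J R1 G1 s" and c: "holds_test (Less 12 0) R1 \<noteq> True"
    then obtain n p k where J: "core n p k G1" "net_good xs F (R1 12) n p k" "R1 10 = n"
      "R1 12 \<le> N" "n \<le> N + 1 + 2 * R1 12 + 2 * (\<Sum>x<R1 12. len x)" "same ?X R R1"
      "\<forall>f. f \<notin> {1, 2, 3, 4} \<longrightarrow> G1 f = G f" "s \<le> t + 6 + 100 * R1 12 + 150 * (\<Sum>x<R1 12. len x)"
      unfolding J_def by blast
    have "std R1" using same_std[OF J(6) _ R(1)] by simp
    hence eq: "R1 12 = N" using c J(4) by (simp add: std_def)
    show "Q R1 G1 (s + 2)"
      by (rule post[where n = n and p = p and k = k]) (use J eq in auto)
  qed
  thus ?thesis unfolding parse_code_def wp_Seq wp_Do using R by (simp add: std_def)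
qed

section \<open>The sorting program\<close>


text \<open>Input \<open>N\<close> is the constant 1. Processing it first inserts the letters that
  are admissible at the start. Input \<open>N + 1\<close>, the constant 0, is never
  processed.\<close>

definition main_code :: cmd where
  "main_code = Do (Cpy 13 0) ;; process_code ;; Do (Cpy 12 8) ;;
     While True (Less 12 0)
       (Do (Get 13 6 8) ;; Do (Put 0 12 13) ;; delete_code ;; process_code ;; Do (Arith Add 12 12 6)) ;;
     Do (Cpy 0 2)"

definition sort_code :: cmd where
  "sort_code = init_code ;; parse_code ;; main_code"

section \<open>From fired gates to admissible letters\<close>

lemma consistent_true_nodes:
  assumes "\<And>u. N < u \<Longrightarrow> u < n \<Longrightarrow> gate_ok p k n c D u"
    and "\<And>u z. N < u \<Longrightarrow> u < n \<Longrightarrow> k u = Input z \<Longrightarrow> u \<in> D \<longleftrightarrow> z \<in> Y"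
  shows "consistent p k Y (N + 1) n D"
  unfolding consistent_def
proof (intro allI impI)
  fix j assume j: "N + 1 \<le> j \<and> j < n"
  hence g: "gate_ok p k n c D j" using assms(1) by simp
  have fin: "finite {i. N < i \<and> i < n \<and> p i = j \<and> i \<notin> D}" by simp
  show "case k j of Input z \<Rightarrow> (j \<in> D) = (z \<in> Y)
        | AndGate \<Rightarrow> (j \<in> D) = (\<forall>i. N + 1 \<le> i \<and> i < n \<and> p i = j \<longrightarrow> i \<in> D)
        | OrGate \<Rightarrow> (j \<in> D) = (\<exists>i. N + 1 \<le> i \<and> i < n \<and> p i = j \<and> i \<in> D)"
  proof (cases "k j")
    case (Input z)
    thus ?thesis using assms(2)[of j z] j by simp
  next
    case AndGate
    hence "j \<in> D \<longleftrightarrow> card {i. N < i \<and> i < n \<and> p i = j \<and> i \<notin> D} = 0" using g by (simp add: gate_ok_def)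
    also have "\<dots> \<longleftrightarrow> (\<forall>i. N + 1 \<le> i \<and> i < n \<and> p i = j \<longrightarrow> i \<in> D)"
      using fin by (auto simp: Suc_le_eq)
    finally show ?thesis using AndGate by simp
  next
    case OrGate
    thus ?thesis using g by (simp add: gate_ok_def Suc_le_eq)
  qed
qed

text \<open>The root of the formula of \<open>x\<close> is the only node with parent
  \<open>x\<close>. So \<open>x\<close> has been inserted iff this root has fired, and the fired
  nodes form a consistent set, to which the semantic clause of \<open>net_good\<close>
  applies.\<close>

lemma available:
  fixes xs :: "'a list"
  assumes net: "net_good xs F N n p k" and xs: "length xs = N"
    and gates: "\<And>u. N < u \<Longrightarrow> u < n \<Longrightarrow> gate_ok p k n c D u"
    and inputs: "\<And>u z. N < u \<Longrightarrow> u < n \<Longrightarrow> k u = Input z \<Longrightarrow> u \<in> D \<longleftrightarrow> z \<in> Y"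
    and Y: "N \<in> Y" "Suc N \<notin> Y" and D: "D \<subseteq> {i. N < i \<and> i < n}"
    and ins: "\<forall>x<N. x \<in> set ins \<longleftrightarrow> (\<exists>i\<in>D. p i = x)" and x: "x < N"
  shows "x \<in> set ins \<longleftrightarrow> holds (F (xs ! x)) (letters xs Y)"
proof -
  note g = net[unfolded net_good_def xs]
  obtain r where r: "N < r" "r < n" "p r = x"
    using g[THEN conjunct2, THEN conjunct2, THEN conjunct1, rule_format, OF x] by blast
  have con: "consistent p k Y (N + 1) n D" by (rule consistent_true_nodes[OF gates inputs])
  have 1: "r \<in> D \<longleftrightarrow> holds (F (xs ! p r)) (letters xs Y)"
    by (rule g[THEN conjunct2, THEN conjunct2, THEN conjunct2, rule_format]) (use Y con r x in simp)
  have "i = r" if "i \<in> D" "p i = x" for i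
    by (rule g[THEN conjunct2, THEN conjunct1, rule_format]) (use that r D x in auto)
  hence "x \<in> set ins \<longleftrightarrow> r \<in> D" using ins x r by blast
  thus ?thesis using 1 r by simp
qed

text \<open>With nothing fired, the counter of an And gate must be positive; this is where the
  existence of a child, maintained during parsing, pays off.\<close>

lemma start_gates:
  fixes xs :: "'a list"
  assumes c: "core n p k G" and net: "net_good xs F N n p k" and xs: "length xs = N" and n: "n \<le> L"
  shows "net_ok p k n G" "\<And>u. N < u \<Longrightarrow> u < n \<Longrightarrow> gate_ok p k n (G 3) {} u"
proof -
  note c' = c[unfolded core_def] and g = net[unfolded net_good_def xs]
  note lists = c'[THEN conjunct2, THEN conjunct2, THEN conjunct2, THEN conjunct2, THEN conjunct2, THEN conjunct2]
  have 1: "(p i < N \<or> N < p i \<and> p i < i \<and> \<not> is_input (k (p i))) \<and>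
        (k i = AndGate \<longrightarrow> (\<exists>j. N < j \<and> j < n \<and> p j = i))" if "N < i" "i < n" for i
    using g[THEN conjunct1, rule_format, of i] that by simp
  have inj: "\<forall>i j. N < i \<and> i < n \<and> N < j \<and> j < n \<and> p i = p j \<and> p i < N \<longrightarrow> i = j"
    by (rule g[THEN conjunct2, THEN conjunct1])
  have G2: "G 2 i = p i" if "i < n" for i using c' that by blast
  show "net_ok p k n G" unfolding net_ok_def
    by (intro conjI n inj lists) (use 1 G2 in blast)
  fix u assume u: "N < u" "u < n"
  show "gate_ok p k n (G 3) {} u"
  proof (cases "k u")
    case AndGate
    obtain j where "N < j" "j < n" "p j = u" using 1[OF u] AndGate by blast
    hence "{i. N < i \<and> i < n \<and> p i = u} \<noteq> {}" by blast
    moreover have "finite {i. N < i \<and> i < n \<and> p i = u}" by simp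
    ultimately have "card {i. N < i \<and> i < n \<and> p i = u} \<noteq> 0" by (metis card_0_eq)
    moreover have "G 3 u = children N p n u" using c' u AndGate by blast
    ultimately show ?thesis using AndGate by (simp add: gate_ok_def children_def)
  next
    case OrGate
    moreover have "G 3 u = 1" using c' u OrGate by blast
    ultimately show ?thesis by (simp add: gate_ok_def)
  qed (simp add: gate_ok_def)
qed

text \<open>\<open>\<sigma> i\<close> is the number of the \<open>i\<close>-th letter of the hidden
  permutation, and \<open>rk\<close> inverts \<open>\<sigma>\<close>. Insertion times
  \<open>lo\<close>, removal times \<open>hi\<close> and the levels \<open>ks\<close> climbed at
  removals are exported, indexed by positions in \<open>\<pi>\<close>, as the data from which the
  counting argument bounds the running time.\<close>

lemma wp_main:
  fixes xs :: "'a list" and \<sigma> :: "nat \<Rightarrow> nat" and \<pi> :: "'a list"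
  assumes R: "std R" "R 9 = 0" "R 2 = e"
    and c: "core n p k G" and net: "net_good xs F N n p k" and xs: "length xs = N" and n: "n \<le> L"
    and H: "heap_ok [] {} G"
    and \<sigma>: "bij_betw \<sigma> {..<N} {..<N}" "\<And>i. i < N \<Longrightarrow> xs ! \<sigma> i = \<pi> ! i" "\<And>i. i < N \<Longrightarrow> rk (\<sigma> i) = i"
    and \<pi>: "length \<pi> = N" "\<And>i. i < N \<Longrightarrow> holds (F (\<pi> ! i)) (set (take i \<pi>))"
    and post: "\<And>R' G' s hi lo ks. R' 0 = e \<Longrightarrow> (\<And>i. i < N \<Longrightarrow> G' 0 i = \<sigma> i) \<Longrightarrow>
      (\<And>i. i < N \<Longrightarrow> hi i \<le> N \<and> 2 ^ ks i \<le> hi i - lo i) \<Longrightarrow>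
      (\<And>i. i < N \<Longrightarrow> holds (F (\<pi> ! i)) {\<pi> ! i' | i'. i' < N \<and> hi i' \<le> lo i}) \<Longrightarrow>
      s \<le> t + 2000 + 2030 * n + 1200 * N + 500 * (\<Sum>i<N. ks i) \<Longrightarrow> Q R' G' s"
  shows "wp main_code Q R G t"
proof -
  \<comment> \<open>The true inputs after \<open>\<tau>\<close> outputs are the constant 1 and the
    letters already output.\<close>
  define Y where "Y \<tau> = insert N (\<sigma> ` {..<\<tau>})" for \<tau>
  have \<sigma>N: "\<sigma> i < N" if "i < N" for i using \<sigma>(1) that by (auto simp: bij_betw_def)
  have \<sigma>inj: "i = j" if "\<sigma> i = \<sigma> j" "i < N" "j < N" for i j using \<sigma>(3) that by metis
  have YN: "N \<in> Y \<tau>" "Suc N \<notin> Y \<tau>" if "\<tau> \<le> N" for \<tau>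
  proof -
    show "N \<in> Y \<tau>" by (simp add: Y_def)
    show "Suc N \<notin> Y \<tau>"
    proof
      assume "Suc N \<in> Y \<tau>"
      then obtain i where "i < \<tau>" "Suc N = \<sigma> i" by (auto simp: Y_def)
      thus False using \<sigma>N[of i] that by simp
    qed
  qed
  have Ylet: "letters xs (Y \<tau>) = set (take \<tau> \<pi>)" if t: "\<tau> \<le> N" for \<tau>
  proof -
    have "\<sigma> i < N" if "i < \<tau>" for i using \<sigma>N[of i] that t by simp
    hence "{i. i \<in> Y \<tau> \<and> i < N} = \<sigma> ` {..<\<tau>}" by (auto simp: Y_def)
    moreover have "letters xs (Y \<tau>) = (!) xs ` {i. i \<in> Y \<tau> \<and> i < N}" by (auto simp: letters_def xs)
    ultimately have "letters xs (Y \<tau>) = (\<lambda>i. xs ! \<sigma> i) ` {..<\<tau>}" by (simp add: image_image)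
    also have "\<dots> = (\<lambda>i. \<pi> ! i) ` {..<\<tau>}" using \<sigma>(2) t by (intro image_cong) auto
    also have "\<dots> = set (take \<tau> \<pi>)" using nth_image[of \<tau> \<pi>] \<pi>(1) t by (simp add: lessThan_atLeast0)
    finally show ?thesis .
  qed
  have takeset: "{\<pi> ! i | i. i < \<tau>} = set (take \<tau> \<pi>)" if "\<tau> \<le> N" for \<tau>
  proof -
    have "{\<pi> ! i | i. i < \<tau>} = (!) \<pi> ` {0..<\<tau>}" by auto
    thus ?thesis using nth_image[of \<tau> \<pi>] \<pi>(1) that by simp
  qed
  define mst where "mst \<tau> ins S D R1 G1 \<longleftrightarrow> sorter_inv p k n ins S D R1 G1 \<and>
    (\<forall>u. N < u \<and> u < n \<longrightarrow> gate_ok p k n (G1 3) D u) \<and>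
    (\<forall>u z. N < u \<and> u < n \<and> k u = Input z \<longrightarrow> (u \<in> D \<longleftrightarrow> z \<in> Y \<tau>)) \<and>
    S = set ins - \<sigma> ` {..<\<tau>} \<and> \<sigma> ` {..<\<tau>} \<subseteq> set ins" for \<tau> ins S D R1 G1
  \<comment> \<open>The history of the run: the letter with insertion index \<open>j\<close> is
    admissible by virtue of the letters removed when at most \<open>j\<close> insertions had been
    made. This is the hypothesis needed for moving letters within their intervals.\<close>
  define hst where "hst \<tau> ins hi ks \<longleftrightarrow> (\<forall>i<\<tau>. hi i \<le> length ins) \<and>
    (\<forall>j<length ins. holds (F (xs ! (ins ! j))) {\<pi> ! i | i. i < \<tau> \<and> hi i \<le> j}) \<and>
    (\<forall>i<\<tau>. \<exists>j<length ins. ins ! j = \<sigma> i \<and> 2 ^ ks i \<le> hi i - j)"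
    for \<tau> and ins :: "nat list" and hi ks :: "nat \<Rightarrow> nat"
  have avail: "x \<in> set ins \<longleftrightarrow> holds (F (xs ! x)) (set (take \<tau> \<pi>))"
    if "mst \<tau> ins S D R1 G1" "\<tau> \<le> N" "x < N" for \<tau> ins S D R1 G1 x
  proof -
    have "x \<in> set ins \<longleftrightarrow> holds (F (xs ! x)) (letters xs (Y \<tau>))"
      by (rule available[OF net xs, where c = "G1 3" and D = D])
        (use that YN in \<open>auto simp: mst_def sorter_inv_def\<close>)
    thus ?thesis by (simp add: Ylet that(2))
  qed
  have insN: "distinct ins" "set ins \<subseteq> {..<N}" "length ins \<le> N" if "mst \<tau> ins S D R1 G1" for \<tau> ins S D R1 G1
    using that length_ins[of ins] by (auto simp: mst_def sorter_inv_def heap_ok_def)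
  define J where "J R1 G1 s \<longleftrightarrow> (\<exists>ins S D hi ks. R1 12 \<le> N \<and> R1 2 = e \<and> mst (R1 12) ins S D R1 G1 \<and>
    hst (R1 12) ins hi ks \<and> (\<forall>i<R1 12. G1 0 i = \<sigma> i) \<and>
    s + 500 * popcount (length ins + 1)
      \<le> t + 600 + 2030 * card D + 600 * R1 12 + 500 * (\<Sum>i<R1 12. ks i))"
    for R1 :: "nat \<Rightarrow> nat" and G1 :: "nat \<Rightarrow> nat \<Rightarrow> nat" and s :: nat
  let ?body = "Do (Get 13 6 8) ;; Do (Put 0 12 13) ;; delete_code ;; process_code ;; Do (Arith Add 12 12 6)"
  have loop: "wp (While True (Less 12 0) ?body) (wp (Do (Cpy 0 2)) Q) R0 G0 t0" if "J R0 G0 t0" for R0 G0 t0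
  proof (rule wp_While[where J = J and m = "\<lambda>R G. N - R 12"])
    show "J R0 G0 t0" by fact
  next
    fix R1 G1 s
    assume "J R1 G1 s" and c: "holds_test (Less 12 0) R1 = True"
    then obtain ins S D hi ks where J: "R1 12 \<le> N" "R1 2 = e" "mst (R1 12) ins S D R1 G1"
      "hst (R1 12) ins hi ks" "\<forall>i<R1 12. G1 0 i = \<sigma> i"
      "s + 500 * popcount (length ins + 1) \<le> t + 600 + 2030 * card D + 600 * R1 12 + 500 * (\<Sum>i<R1 12. ks i)"
      unfolding J_def by blast
    define \<tau> where "\<tau> = R1 12"
    note M = J(3)[unfolded mst_def, folded \<tau>_def]
    have inv: "sorter_inv p k n ins S D R1 G1" and S: "S = set ins - \<sigma> ` {..<\<tau>}" "\<sigma> ` {..<\<tau>} \<subseteq> set ins"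
      using M by blast+
    have std: "std R1" and R9: "R1 9 = length ins" and H1: "heap_ok ins S G1" and net1: "net_ok p k n G1"
      using inv by (auto simp: sorter_inv_def)
    note ins = insN[OF J(3)]
    have tN: "\<tau> < N" using c std by (simp add: std_def \<tau>_def)
    define x where "x = \<sigma> \<tau>"
    have x: "x < N" "rk x = \<tau>" "xs ! x = \<pi> ! \<tau>" using \<sigma>N \<sigma> tN by (auto simp: x_def)
    \<comment> \<open>Since \<open>\<pi>\<close> satisfies the precedence conditions, its next
      letter is admissible. All letters of smaller rank are gone, so it is the minimum of the
      tournament.\<close>
    have xin: "x \<in> set ins" using avail[OF J(3), of x] tN x \<pi>(2)[OF tN] by (simp add: \<tau>_def)
    have xnot: "x \<notin> \<sigma> ` {..<\<tau>}"
    proof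
      assume "x \<in> \<sigma> ` {..<\<tau>}"
      then obtain i where "i < \<tau>" "\<sigma> \<tau> = \<sigma> i" by (auto simp: x_def)
      thus False using \<sigma>inj[of \<tau> i] tN by simp
    qed
    have xS: "x \<in> S" using xin S(1) xnot by blast
    have rkS: "\<tau> \<le> rk y \<and> (rk y = \<tau> \<longrightarrow> y = x)" if "y \<in> S" for y
    proof -
      have "y < N" using that S(1) ins(2) by auto
      then obtain i where i: "i < N" "y = \<sigma> i" using \<sigma>(1) by (auto simp: bij_betw_def)
      have "\<not> i < \<tau>" using that S(1) i by auto
      thus ?thesis using i \<sigma>(3) by (auto simp: x_def)
    qed
    have "spine_ok (G1 6) ins S 0" using H1 by (simp add: heap_ok_def)
    hence "is_min (G1 6 0) (seg ins S 0 (length ins))" by (simp add: spine_ok_def)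
    moreover have "seg ins S 0 (length ins) = S"
    proof
      show "seg ins S 0 (length ins) \<subseteq> S" by (auto simp: seg_def)
      show "S \<subseteq> seg ins S 0 (length ins)"
      proof
        fix y assume y: "y \<in> S"
        hence "y \<in> set ins" using S(1) by blast
        then obtain i where "i < length ins" "ins ! i = y" by (auto simp: in_set_conv_nth)
        thus "y \<in> seg ins S 0 (length ins)" using y unfolding seg_def by blast
      qed
    qed
    ultimately have "G1 6 0 \<in> S" "rk (G1 6 0) \<le> rk x" using xS by (auto simp: is_min_def split: if_splits)
    hence T0: "G1 6 0 = x" using rkS[of "G1 6 0"] x(2) by auto
    obtain j where j: "j < length ins" "ins ! j = x" using xin by (auto simp: in_set_conv_nth)
    let ?G2 = "G1(0 := (G1 0)(\<tau> := x))"
    let ?P = "\<lambda>R' G' t'. J R' G' t' \<and> N - R' 12 < N - R1 12"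
    have "wp delete_code (wp process_code (wp (Do (Arith Add 12 12 6)) ?P)) (R1(13 := x)) ?G2 (15 + s)"
    proof (rule wp_delete[where ins = ins and j = j and S = S])
      show "std (R1(13 := x))" "(R1(13 := x)) 9 = length ins" "(R1(13 := x)) 13 = ins ! j" "j < length ins"
        using std R9 j by (auto simp: std_def)
      show "heap_ok ins S ?G2" using H1 by (simp add: heap_ok_def)
      fix R2 G2 s2 l
      assume 2: "same {14..24} (R1(13 := x)) R2" "heap_ok ins (S - {ins ! j}) G2"
        "\<And>f. f \<notin> {5, 6} \<Longrightarrow> G2 f = ?G2 f" "2 ^ l \<le> length ins - j" "s2 \<le> 15 + s + 500 + 500 * l"
      show "wp process_code (wp (Do (Arith Add 12 12 6)) ?P) R2 G2 s2"
      proof (rule wp_process[where p = p and k = k and n = n and ins = ins and S = "S - {x}" and D = D and z = x])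
        have "std R2" "R2 9 = length ins" using 2(1) std R9 by (auto simp: same_def std_def)
        moreover have "net_ok p k n G2" using net1 2(3) by (simp add: net_ok_def)
        ultimately show "sorter_inv p k n ins (S - {x}) D R2 G2"
          using inv 2(2) j(2) by (simp add: sorter_inv_def)
        have g3: "G2 3 = G1 3" using 2(3)[of 3] by simp
        show "gate_ok p k n (G2 3) D u" if "N < u" "u < n" for u using M that g3 by simp
        show "R2 13 = x" using 2(1) by (simp add: same_def)
        show "x \<le> N + 1" using x by simp
        show "i \<notin> D" if "N < i" "i < n" "k i = Input x" for i
        proof -
          have "x \<notin> Y \<tau>" using xnot x(1) by (simp add: Y_def)
          thus ?thesis using M that by blast
        qed
        fix R3 G3 s3 D' new
        assume 3: "same ({9, 13} \<union> {14..31}) R2 R3" "\<And>f. f \<notin> {3, 5, 6, 7} \<Longrightarrow> G3 f = G2 f"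
          "sorter_inv p k n (ins @ new) (S - {x} \<union> set new) D' R3 G3"
          "\<And>u. N < u \<Longrightarrow> u < n \<Longrightarrow> gate_ok p k n (G3 3) D' u" "D \<subseteq> D'"
          "\<And>u. N < u \<Longrightarrow> u < n \<Longrightarrow> is_input (k u) \<Longrightarrow> (u \<in> D') = (u \<in> D \<or> k u = Input x)"
          "s3 + 500 * popcount (length (ins @ new) + 1) + 2030 * card D
            \<le> s2 + 20 + 500 * popcount (length ins + 1) + 2030 * card D'"
        let ?ins = "ins @ new"
        have r: "R3 12 = \<tau>" "R3 6 = 1" "R3 2 = e"
          using 3(1) 2(1) std J(2) by (auto simp: same_def std_def \<tau>_def)
        have img: "\<sigma> ` {..<Suc \<tau>} = insert x (\<sigma> ` {..<\<tau>})" by (auto simp: x_def less_Suc_eq)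
        have YS: "Y (Suc \<tau>) = insert x (Y \<tau>)" unfolding Y_def img by blast
        let ?R4 = "R3(12 := Suc \<tau>)"
        have "distinct ?ins" using 3(3) by (simp add: sorter_inv_def heap_ok_def)
        hence disj: "set new \<inter> set ins = {}" by auto
        have m4: "mst (Suc \<tau>) ?ins (S - {x} \<union> set new) D' ?R4 G3"
          unfolding mst_def
        proof (intro conjI)
          show "sorter_inv p k n ?ins (S - {x} \<union> set new) D' ?R4 G3"
            using 3(3) by (simp add: sorter_inv_def std_def)
          show "\<forall>u. N < u \<and> u < n \<longrightarrow> gate_ok p k n (G3 3) D' u" using 3(4) by blast
          show "\<forall>u z. N < u \<and> u < n \<and> k u = Input z \<longrightarrow> (u \<in> D' \<longleftrightarrow> z \<in> Y (Suc \<tau>))"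
          proof (intro allI impI)
            fix u z assume u: "N < u \<and> u < n \<and> k u = Input z"
            hence "u \<in> D \<longleftrightarrow> z \<in> Y \<tau>" using M by blast
            moreover have "u \<in> D' \<longleftrightarrow> u \<in> D \<or> z = x" using 3(6)[of u] u by simp
            ultimately show "u \<in> D' \<longleftrightarrow> z \<in> Y (Suc \<tau>)" unfolding YS by blast
          qed
          show "S - {x} \<union> set new = set ?ins - \<sigma> ` {..<Suc \<tau>}" "\<sigma> ` {..<Suc \<tau>} \<subseteq> set ?ins"
            unfolding img using S xin disj by auto
        qed
        define hi' ks' where "hi' = hi(\<tau> := length ins)" and "ks' = ks(\<tau> := l)"
        have h: "\<forall>i<\<tau>. hi i \<le> length ins"
          "\<forall>j<length ins. holds (F (xs ! (ins ! j))) {\<pi> ! i | i. i < \<tau> \<and> hi i \<le> j}"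
          "\<forall>i<\<tau>. \<exists>j<length ins. ins ! j = \<sigma> i \<and> 2 ^ ks i \<le> hi i - j"
          using J(4) unfolding hst_def \<tau>_def by blast+
        have "hst (Suc \<tau>) ?ins hi' ks'"
          unfolding hst_def
        proof (intro conjI allI impI)
          show "hi' i \<le> length ?ins" if "i < Suc \<tau>" for i
            using h(1) that by (auto simp: hi'_def less_Suc_eq intro: trans_le_add1)
          show "\<exists>j<length ?ins. ?ins ! j = \<sigma> i \<and> 2 ^ ks' i \<le> hi' i - j" if i: "i < Suc \<tau>" for i
          proof (cases "i = \<tau>")
            case True
            thus ?thesis using j 2(4) by (intro exI[of _ j]) (auto simp: nth_append hi'_def ks'_def x_def)
          next
            case False
            then obtain j' where "j' < length ins" "ins ! j' = \<sigma> i" "2 ^ ks i \<le> hi i - j'"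
              using h(3) i by (auto simp: less_Suc_eq)
            thus ?thesis using False by (intro exI[of _ j']) (auto simp: nth_append hi'_def ks'_def)
          qed
          show "holds (F (xs ! (?ins ! j'))) {\<pi> ! i | i. i < Suc \<tau> \<and> hi' i \<le> j'}" if j': "j' < length ?ins" for j'
          proof (cases "j' < length ins")
            case True
            have "{\<pi> ! i | i. i < \<tau> \<and> hi i \<le> j'} \<subseteq> {\<pi> ! i | i. i < Suc \<tau> \<and> hi' i \<le> j'}"
              by (auto simp: hi'_def less_Suc_eq)
            thus ?thesis using h(2) True by (auto simp: nth_append intro: holds_mono(1))
          next
            case False
            \<comment> \<open>Letters of \<open>new\<close> are inserted after the current removal.
              Their indices are at least \<open>length ins\<close>, and no \<open>hi'\<close> so far
              exceeds this number.\<close>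
            have "hi' i \<le> j'" if "i < Suc \<tau>" for i
              using h(1) that False by (auto simp: hi'_def less_Suc_eq intro: order_trans)
            hence "{\<pi> ! i | i. i < Suc \<tau> \<and> hi' i \<le> j'} = {\<pi> ! i | i. i < Suc \<tau>}" by blast
            hence eq: "{\<pi> ! i | i. i < Suc \<tau> \<and> hi' i \<le> j'} = set (take (Suc \<tau>) \<pi>)"
              using takeset[of "Suc \<tau>"] tN by simp
            have "?ins ! j' \<in> set ?ins" using j' by (rule nth_mem)
            moreover have "?ins ! j' < N" using insN(2)[OF m4] calculation by blast
            ultimately show ?thesis unfolding eq using avail[OF m4] tN by simp
          qed
        qed
        moreover have "\<forall>i<Suc \<tau>. G3 0 i = \<sigma> i"
          using 3(2)[of 0] 2(3)[of 0] J(5) by (auto simp: less_Suc_eq x_def \<tau>_def)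
        moreover have "(\<Sum>i<Suc \<tau>. ks' i) = (\<Sum>i<\<tau>. ks i) + l" by (simp add: ks'_def)
        hence "s3 + 6 + 500 * popcount (length ?ins + 1)
          \<le> t + 600 + 2030 * card D' + 600 * Suc \<tau> + 500 * (\<Sum>i<Suc \<tau>. ks' i)"
          using 3(7) 2(5) J(6) by (simp add: \<tau>_def)
        ultimately have "J ?R4 G3 (s3 + 6)"
          unfolding J_def using m4 tN r
          by (intro exI[of _ ?ins] exI[of _ "S - {x} \<union> set new"] exI[of _ D'] exI[of _ hi'] exI[of _ ks']) simp
        thus "wp (Do (Arith Add 12 12 6)) ?P R3 G3 s3"
          unfolding wp_Do using r tN small[of "Suc \<tau>"] by (simp add: \<tau>_def[symmetric])
      qed
    qed
    moreover have "0 < L" using room by simp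
    ultimately show "wp ?body ?P R1 G1 (s + 3)"
      unfolding wp_Seq wp_Do using std T0 tN by (simp add: std_def \<tau>_def[symmetric])
  next
    fix R1 G1 s
    assume "J R1 G1 s" and c: "holds_test (Less 12 0) R1 \<noteq> True"
    then obtain ins S D hi ks where J: "R1 12 \<le> N" "R1 2 = e" "mst (R1 12) ins S D R1 G1"
      "hst (R1 12) ins hi ks" "\<forall>i<R1 12. G1 0 i = \<sigma> i"
      "s + 500 * popcount (length ins + 1) \<le> t + 600 + 2030 * card D + 600 * R1 12 + 500 * (\<Sum>i<R1 12. ks i)"
      unfolding J_def by blast
    have std: "std R1" and DU: "D \<subseteq> {i. N < i \<and> i < n}"
      using J(3) by (auto simp: mst_def sorter_inv_def)
    have eq: "R1 12 = N" using c std J(1) by (simp add: std_def)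
    have "D \<subseteq> {..<n}" using DU by auto
    hence cD: "card D \<le> n" using card_mono[of "{..<n}" D] by simp
    note ins = insN[OF J(3)]
    have h: "\<forall>i<N. hi i \<le> length ins"
      "\<forall>j<length ins. holds (F (xs ! (ins ! j))) {\<pi> ! i | i. i < N \<and> hi i \<le> j}"
      "\<forall>i<N. \<exists>j<length ins. ins ! j = \<sigma> i \<and> 2 ^ ks i \<le> hi i - j"
      using J(4) unfolding hst_def eq by blast+
    obtain lo where lo: "\<And>i. i < N \<Longrightarrow> lo i < length ins \<and> ins ! lo i = \<sigma> i \<and> 2 ^ ks i \<le> hi i - lo i"
      using h(3) by metis
    show "wp (Do (Cpy 0 2)) Q R1 G1 (s + 2)"
      unfolding wp_Do
    proof (rule conjI, simp, rule post[where hi = hi and lo = lo and ks = ks])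
      show "(new_regs (Cpy 0 2) R1 G1) 0 = e" using J(2) by simp
      show "new_fields (Cpy 0 2) R1 G1 0 i = \<sigma> i" if "i < N" for i using J(5) eq that by simp
      show "hi i \<le> N \<and> 2 ^ ks i \<le> hi i - lo i" if "i < N" for i
        using h(1) lo[OF that] that ins(3) by (meson order_trans)
      show "holds (F (\<pi> ! i)) {\<pi> ! i' |i'. i' < N \<and> hi i' \<le> lo i}" if "i < N" for i
        using h(2)[rule_format, of "lo i"] lo[OF that] \<sigma>(2)[OF that] by simp
      show "s + 2 + 6 \<le> t + 2000 + 2030 * n + 1200 * N + 500 * (\<Sum>i<N. ks i)"
        using J(6) cD eq by simp
    qed
  qed
  have net0: "net_ok p k n G" and gates0: "\<And>u. N < u \<Longrightarrow> u < n \<Longrightarrow> gate_ok p k n (G 3) {} u"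
    using start_gates[OF assms(4) net xs n] by blast+
  have "wp process_code (wp (Do (Cpy 12 8)) (wp (While True (Less 12 0) ?body) (wp (Do (Cpy 0 2)) Q)))
    (R(13 := N)) G (t + 6)"
  proof (rule wp_process[where p = p and k = k and n = n and ins = "[]" and S = "{}" and D = "{}" and z = N])
    show "sorter_inv p k n [] {} {} (R(13 := N)) G"
      using R H net0 by (simp add: sorter_inv_def std_def)
    show "gate_ok p k n (G 3) {} u" if "N < u" "u < n" for u using gates0 that by blast
    show "(R(13 := N)) 13 = N" "N \<le> N + 1" by simp_all
    show "i \<notin> {}" for i :: nat by simp
    fix R3 G3 s3 D' new
    assume 3: "same ({9, 13} \<union> {14..31}) (R(13 := N)) R3" "\<And>f. f \<notin> {3, 5, 6, 7} \<Longrightarrow> G3 f = G f"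
      "sorter_inv p k n ([] @ new) ({} \<union> set new) D' R3 G3"
      "\<And>u. N < u \<Longrightarrow> u < n \<Longrightarrow> gate_ok p k n (G3 3) D' u" "{} \<subseteq> D'"
      "\<And>u. N < u \<Longrightarrow> u < n \<Longrightarrow> is_input (k u) \<Longrightarrow> (u \<in> D') = (u \<in> {} \<or> k u = Input N)"
      "s3 + 500 * popcount (length ([] @ new) + 1) + 2030 * card ({} :: nat set)
        \<le> t + 6 + 20 + 500 * popcount (length ([] :: nat list) + 1) + 2030 * card D'"
    let ?R4 = "R3(12 := 0)"
    have r: "R3 2 = e" "R3 8 = 0" using 3(1) R by (auto simp: same_def std_def)
    have pc1: "popcount 1 = 1" by (simp add: popcount.simps)
    have m4: "mst 0 new (set new) D' ?R4 G3"
      unfolding mst_def Y_def using 3(3,4,6) by (simp add: sorter_inv_def std_def)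
    have "hst 0 new (\<lambda>_. 0) (\<lambda>_. 0)"
      unfolding hst_def
    proof (intro conjI allI impI)
      fix j assume "j < length new"
      hence "new ! j \<in> set new" by (rule nth_mem)
      moreover have "new ! j < N" using insN(2)[OF m4] calculation by blast
      ultimately show "holds (F (xs ! (new ! j))) {\<pi> ! i | i. i < 0 \<and> 0 \<le> j}" using avail[OF m4] by simp
    qed simp_all
    hence "J ?R4 G3 (s3 + 6)"
      unfolding J_def using m4 r 3(7) pc1
      by (intro exI[of _ new] exI[of _ "set new"] exI[of _ D'] exI[of _ "\<lambda>_. 0"]) simp
    from loop[OF this]
    show "wp (Do (Cpy 12 8)) (wp (While True (Less 12 0) ?body) (wp (Do (Cpy 0 2)) Q)) R3 G3 s3"
      unfolding wp_Do using r by simp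
  qed
  thus ?thesis unfolding main_code_def wp_Seq wp_Do using R by (simp add: std_def)
qed

lemma wf_sort_code: "wf_cmd sort_code"
  by (simp add: sort_code_def init_code_def parse_code_def formula_code_def read_code_def main_code_def
      process_code_def signal_code_def insert_code_def delete_code_def spine_code_def spine_body_def
      recompute_code_def node_code_def min_code_def skip_code_def)

end

text \<open>Makes the number of letters at most the input length, so that costs per letter vanish in
  the linear term.\<close>

lemma one_le_length_symbols:
  fixes f :: "'a formula" and c :: "'a conjunction" and a :: "'a atom"
  shows "1 \<le> length (symbols f)" "1 \<le> length (symbols_conj c)" "1 \<le> length (symbols_atom a)"
  by (induction f and c and a) auto

lemma code_at_Cons_rest: "code_at (i # cs) 1 cs"
  by (simp add: code_at_def)

section \<open>The complete program and its running time\<close>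

context sorter begin

lemma wp_sort:
  fixes xs :: "'a list" and F :: "'a \<Rightarrow> 'a formula" and \<pi> :: "'a list"
  defines "len \<equiv> \<lambda>x. length (symbols (F (xs ! x)))"
  assumes xs: "length xs = N" "distinct xs"
    and heads: "\<And>x. x < N \<Longrightarrow> linked_list xs e I (I (R 1 + x)) (symbols (F (xs ! x)))"
      "R 1 + N \<le> e" "e < 2 ^ w"
    and R: "R 0 = N" "R 2 = e"
    and L: "N + 1 + 2 * N + 2 * (\<Sum>x<N. len x) \<le> L"
    and \<sigma>: "bij_betw \<sigma> {..<N} {..<N}" "\<And>i. i < N \<Longrightarrow> xs ! \<sigma> i = \<pi> ! i" "\<And>i. i < N \<Longrightarrow> rk (\<sigma> i) = i"
    and \<pi>: "length \<pi> = N" "\<And>i. i < N \<Longrightarrow> holds (F (\<pi> ! i)) (set (take i \<pi>))"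
    and post: "\<And>R' G' s hi lo ks. R' 0 = e \<Longrightarrow> (\<And>i. i < N \<Longrightarrow> G' 0 i = \<sigma> i) \<Longrightarrow>
      (\<And>i. i < N \<Longrightarrow> hi i \<le> N \<and> 2 ^ ks i \<le> hi i - lo i) \<Longrightarrow>
      (\<And>i. i < N \<Longrightarrow> holds (F (\<pi> ! i)) {\<pi> ! i' | i'. i' < N \<and> hi i' \<le> lo i}) \<Longrightarrow>
      s \<le> t + 5000 + 8000 * N + 5000 * (\<Sum>x<N. len x) + 500 * (\<Sum>i<N. ks i) \<Longrightarrow> Q R' G' s"
  shows "wp sort_code Q R G t"
  unfolding sort_code_def wp_Seq
proof (rule wp_init)
  show "R 0 = N" by fact
  fix R1 G1 s1
  assume 1: "same {6..12} R R1" "std R1" "R1 9 = 0" "R1 10 = N + 1"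
    "core (N + 1) (\<lambda>_. 0) (\<lambda>_. AndGate) G1" "heap_ok [] {} G1" "s1 \<le> t + 200 + 30 * N"
  have r1: "R1 1 = R 1" "R1 2 = R 2" using 1(1) by (auto simp: same_def)
  show "wp parse_code (wp main_code Q) R1 G1 s1"
  proof (rule wp_parse[where xs = xs and F = F])
    show "length xs = N" "distinct xs" "std R1" "R1 10 = N + 1" "e < 2 ^ w"
      "core (N + 1) (\<lambda>_. 0) (\<lambda>_. AndGate) G1" by fact+
    show "linked_list xs e I (I (R1 1 + x)) (symbols (F (xs ! x)))" if "x < N" for x
      using heads(1)[OF that] r1 by simp
    show "R1 1 + N \<le> e" using heads(2) r1 by simp
    show "N + 1 + 2 * N + 2 * (\<Sum>x<N. length (symbols (F (xs ! x)))) \<le> L" using L by (simp add: len_def)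
    fix R2 G2 s2 n p k
    assume 2: "same ({10, 11, 12, 20} \<union> {28..31}) R1 R2"
      "n \<le> N + 1 + 2 * N + 2 * (\<Sum>x<N. length (symbols (F (xs ! x))))" "core n p k G2"
      "net_good xs F N n p k" "\<And>f. f \<notin> {1, 2, 3, 4} \<Longrightarrow> G2 f = G1 f"
      "s2 \<le> s1 + 20 + 150 * N + 150 * (\<Sum>x<N. length (symbols (F (xs ! x))))"
    show "wp main_code Q R2 G2 s2"
    proof (rule wp_main[where p = p and k = k and n = n and xs = xs and F = F and \<sigma> = \<sigma> and \<pi> = \<pi>])
      show "std R2" "R2 9 = 0" "R2 2 = e" using 2(1) 1 R(2) r1 by (auto simp: same_def std_def)
      show "n \<le> L" using 2(2) L by (simp add: len_def)
      show "heap_ok [] {} G2" using 1(6) 2(5) by (simp add: heap_ok_def)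
      show "core n p k G2" "net_good xs F N n p k" "length xs = N" "length \<pi> = N"
        "bij_betw \<sigma> {..<N} {..<N}" by fact+
      show "xs ! \<sigma> i = \<pi> ! i" "rk (\<sigma> i) = i" "holds (F (\<pi> ! i)) (set (take i \<pi>))" if "i < N" for i
        using \<sigma>(2,3) \<pi>(2) that by blast+
      fix R' :: "nat \<Rightarrow> nat" and G' :: "nat \<Rightarrow> nat \<Rightarrow> nat" and s :: nat and hi lo ks :: "nat \<Rightarrow> nat"
      assume 3: "R' 0 = e" "\<And>i. i < N \<Longrightarrow> G' 0 i = \<sigma> i"
        "\<And>i. i < N \<Longrightarrow> hi i \<le> N \<and> 2 ^ ks i \<le> hi i - lo i"
        "\<And>i. i < N \<Longrightarrow> holds (F (\<pi> ! i)) {\<pi> ! i' | i'. i' < N \<and> hi i' \<le> lo i}"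
        "s \<le> s2 + 2000 + 2030 * n + 1200 * N + 500 * (\<Sum>i<N. ks i)"
      show "Q R' G' s"
        by (rule post[where R' = R' and G' = G' and s = s and hi = hi and lo = lo and ks = ks, OF 3(1) 3(2) 3(3) 3(4)]) (use 3(5) 2(2,6) 1(7) in \<open>auto simp: len_def\<close>)
    qed
  qed
qed

end

text \<open>Intervals are indexed by positions in \<open>\<pi>\<close> here but by letters in
  \<open>interval_volume\<close>, hence the translation through \<open>pos\<close>. The term
  \<open>2 * real N\<close> is the logarithm of the factor \<open>4 ^ N\<close>.\<close>

lemma log_volume:
  fixes ks :: "nat \<Rightarrow> nat"
  assumes \<Sigma>: "finite \<Sigma>" and rep: "precedence_representation \<Sigma> F A"
    and \<pi>: "\<pi> \<in> permutations_in \<Sigma> A" "length \<pi> = N"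
    and h: "\<And>i. i < N \<Longrightarrow> hi i \<le> N \<and> 2 ^ ks i \<le> hi i - lo i"
    and F: "\<And>i. i < N \<Longrightarrow> holds (F (\<pi> ! i)) {\<pi> ! i' | i'. i' < N \<and> hi i' \<le> lo i}"
  shows "real (\<Sum>i<N. ks i) \<le> 2 * real N + log 2 (real (card (permutations_in \<Sigma> A)))"
proof -
  let ?c = "card (permutations_in \<Sigma> A)"
  have d: "distinct \<pi>" "set \<pi> = \<Sigma>" using \<pi>(1) by (auto simp: permutations_in_def simple_words_def)
  have card: "card \<Sigma> = N" using distinct_card[OF d(1)] d(2) \<pi>(2) by simp
  have bij: "bij_betw ((!) \<pi>) {..<N} \<Sigma>" using bij_betw_nth[OF d(1), of "{..<N}" \<Sigma>] d(2) \<pi>(2) by simp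
  define pos where "pos = inv_into {..<N} ((!) \<pi>)"
  have pos: "pos (\<pi> ! i) = i" if "i < N" for i
    using bij that by (simp add: pos_def bij_betw_def inv_into_f_f)
  have pos': "pos x < N" "\<pi> ! pos x = x" if x: "x \<in> \<Sigma>" for x
  proof -
    obtain i where "i < N" "x = \<pi> ! i" using bij x by (auto simp: bij_betw_def)
    thus "pos x < N" "\<pi> ! pos x = x" using pos by auto
  qed
  have "(\<Prod>x\<in>\<Sigma>. hi (pos x) - lo (pos x)) \<le> 4 ^ card \<Sigma> * ?c"
  proof (rule interval_volume[OF \<Sigma> rep])
    show "hi (pos x) \<le> card \<Sigma>" if "x \<in> \<Sigma>" for x using h[OF pos'(1)[OF that]] card by simp
    show "holds (F x) {y\<in>\<Sigma>. hi (pos y) \<le> lo (pos x)}" if x: "x \<in> \<Sigma>" for x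
    proof (rule holds_mono(1))
      show "holds (F x) {\<pi> ! i' | i'. i' < N \<and> hi i' \<le> lo (pos x)}"
        using F[OF pos'(1)[OF x]] pos'(2)[OF x] by simp
      show "{\<pi> ! i' | i'. i' < N \<and> hi i' \<le> lo (pos x)} \<subseteq> {y\<in>\<Sigma>. hi (pos y) \<le> lo (pos x)}"
        using pos d(2) \<pi>(2) by auto
    qed
  qed
  moreover have "(\<Prod>x\<in>\<Sigma>. hi (pos x) - lo (pos x)) = (\<Prod>i<N. hi (pos (\<pi> ! i)) - lo (pos (\<pi> ! i)))"
    by (rule prod.reindex_bij_betw[OF bij, symmetric])
  moreover have "\<dots> = (\<Prod>i<N. hi i - lo i)" by (rule prod.cong) (use pos in auto)
  moreover have "(2::nat) ^ (\<Sum>i<N. ks i) = (\<Prod>i<N. 2 ^ ks i)" by (rule power_sum)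
  moreover have "(\<Prod>i<N. 2 ^ ks i) \<le> (\<Prod>i<N. hi i - lo i)" by (rule prod_mono) (use h in auto)
  ultimately have "2 ^ (\<Sum>i<N. ks i) \<le> 4 ^ N * ?c" using card by simp
  hence "real (\<Sum>i<N. ks i) \<le> log 2 (real (4 ^ N * ?c))" by (rule le_log2_of_power)
  also have "\<dots> = 2 * real N + log 2 (real ?c)"
  proof -
    have "?c > 0" using \<pi>(1) finite_permutations_in[OF \<Sigma>, of A] card_gt_0_iff by blast
    moreover have "log 2 (4 ^ N) = 2 * real N"
    proof -
      have "(4::real) ^ N = 2 ^ (2 * N)" by (simp add: power_mult)
      thus ?thesis by (simp add: log_nat_power)
    qed
    ultimately show ?thesis by (simp add: log_mult)
  qed
  finally show ?thesis .
qed

text \<open>The compiled code relies on register 5 containing \<open>e + N\<close>, which the extra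
  instruction provides; the code therefore starts at position 1.\<close>

definition sort_program :: "instr list" where
  "sort_program = Op Add 5 2 0 # code 1 sorter.sort_code"

lemma sort_program_correct:
  fixes xs :: "'a list" and \<Sigma> :: "'a set" and F :: "'a \<Rightarrow> 'a formula" and w :: nat
  defines "n \<equiv> representation_length \<Sigma> F" and "run' \<equiv> \<lambda>\<pi>. run w (comparison_oracle xs \<pi>) sort_program"
  assumes \<Sigma>: "finite \<Sigma>" and rep: "precedence_representation \<Sigma> F A"
    and \<pi>: "\<pi> \<in> permutations_in \<Sigma> A" and xs: "distinct xs" "set xs = \<Sigma>"
    and s: "input_state w (100 * (1 + n)) xs F s"
  shows "\<exists>t. real t \<le> 30000 * (1 + real n + log 2 (real (card (permutations_in \<Sigma> A)))) \<and>
    halted sort_program (run' \<pi> t s) \<and> outputs w xs \<pi> (run' \<pi> t s)"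
proof -
  define N e M R where "N = length xs" and "e = regs s 2" and "M = mem s" and "R = regs s"
  \<comment> \<open>The net needs at most \<open>3 * N + 1 + 2 * n\<close> entries and the
    tournament \<open>2 * N + 4\<close>. As \<open>N \<le> n\<close>, both fit into
    \<open>L\<close>, and \<open>N + 8 * L\<close> words fit into the \<open>100 * (1 + n)\<close>
    cells available.\<close>
  define L where "L = 6 * n + 10"
  have s_eq: "s = State 0 R M" using s by (cases s) (simp add: input_state_def R_def M_def)
  have d: "distinct \<pi>" "set \<pi> = \<Sigma>" "\<pi> \<in> A"
    using \<pi> by (auto simp: permutations_in_def simple_words_def)
  have len: "length \<pi> = N" using distinct_card[OF d(1)] distinct_card[OF xs(1)] d(2) xs(2) by (simp add: N_def)
  have holds: "holds (F (\<pi> ! i)) (set (take i \<pi>))" if "i < N" for i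
    using rep d(3) that len by (auto simp: precedence_representation_def)
  have bij_xs: "bij_betw ((!) xs) {..<N} \<Sigma>" using bij_betw_nth[OF xs(1), of "{..<N}" \<Sigma>] xs(2) by (simp add: N_def)
  have n_sum: "n = (\<Sum>i<N. length (symbols (F (xs ! i))))"
    unfolding n_def representation_length_def by (rule sum.reindex_bij_betw[OF bij_xs, symmetric])
  have "(\<Sum>i<N. 1) \<le> n" unfolding n_sum by (rule sum_mono) (rule one_le_length_symbols(1))
  hence Nn: "N \<le> n" by simp
  have in': "\<And>r. R r < 2 ^ w" "\<And>a. M a < 2 ^ w" "R 0 = N" "R 2 = e" "R 1 + N \<le> e"
    "e + 100 * (1 + n) \<le> 2 ^ w"
    "\<And>i. i < N \<Longrightarrow> linked_list xs e M (M (R 1 + i)) (symbols (F (xs ! i)))"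
    using s by (auto simp: input_state_def R_def M_def N_def e_def)
  have "\<exists>x. x < N \<and> xs ! x = \<pi> ! i" if "i < N" for i
    using that len d(2) xs(2) by (metis N_def in_set_conv_nth nth_mem)
  then obtain \<sigma> where \<sigma>: "\<And>i. i < N \<Longrightarrow> \<sigma> i < N \<and> xs ! \<sigma> i = \<pi> ! i" by metis
  have "\<exists>i. i < N \<and> \<pi> ! i = xs ! x" if "x < N" for x
    using that len d(2) xs(2) by (metis N_def in_set_conv_nth nth_mem)
  then obtain rk where rk: "\<And>x. x < N \<Longrightarrow> rk x < N \<and> \<pi> ! rk x = xs ! x" by metis
  have rk\<sigma>: "rk (\<sigma> i) = i" if "i < N" for i
    using rk[of "\<sigma> i"] \<sigma>[OF that] that d(1) len nth_eq_iff_index_eq[of \<pi> "rk (\<sigma> i)" i] by simp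
  have \<sigma>rk: "\<sigma> (rk x) = x" if "x < N" for x
    using \<sigma>[of "rk x"] rk[OF that] that xs(1) nth_eq_iff_index_eq[of xs "\<sigma> (rk x)" x] by (simp add: N_def)
  have bij: "bij_betw \<sigma> {..<N} {..<N}"
    by (rule bij_betw_byWitness[where f' = rk]) (use rk \<sigma> rk\<sigma> \<sigma>rk in auto)
  let ?orc = "comparison_oracle xs \<pi>"
  have orc: "?orc a b \<longleftrightarrow> a < N \<and> b < N \<and> rk a < rk b" for a b
  proof (cases "a < N \<and> b < N")
    case True
    have "precedes \<pi> (xs ! a) (xs ! b) \<longleftrightarrow> rk a < rk b"
    proof
      assume "precedes \<pi> (xs ! a) (xs ! b)"
      then obtain i j where ij: "i < j" "j < N" "\<pi> ! i = xs ! a" "\<pi> ! j = xs ! b"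
        by (auto simp: precedes_def len)
      have "i = rk a" "j = rk b"
        using nth_eq_iff_index_eq[OF d(1), of i "rk a"] nth_eq_iff_index_eq[OF d(1), of j "rk b"] ij rk True len
        by auto
      thus "rk a < rk b" using ij by simp
    next
      assume "rk a < rk b"
      thus "precedes \<pi> (xs ! a) (xs ! b)" unfolding precedes_def using rk True len by metis
    qed
    thus ?thesis using True by (simp add: comparison_oracle_def N_def)
  qed (auto simp: comparison_oracle_def N_def)
  have room: "e + N + 8 * L \<le> 2 ^ w" "2 * N + 4 \<le> L" using in'(6) Nn by (auto simp: L_def)
  interpret sorter w ?orc N L e M rk
    by unfold_locales (use orc room in auto)
  define Q where "Q R' G' u \<longleftrightarrow> R' 0 = e \<and> (\<forall>i<N. G' 0 i = \<sigma> i) \<and> (\<exists>ks :: nat \<Rightarrow> nat.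
      real (\<Sum>i<N. ks i) \<le> 2 * real N + log 2 (real (card (permutations_in \<Sigma> A))) \<and>
      u \<le> 5000 + 8000 * N + 5000 * n + 500 * (\<Sum>i<N. ks i))"
    for R' :: "nat \<Rightarrow> nat" and G' :: "nat \<Rightarrow> nat \<Rightarrow> nat" and u :: nat
  \<comment> \<open>The fields initially are whatever the memory contains, so the simulation holds
    at the start without any clearing.\<close>
  let ?R = "R(5 := e + N)" and ?G = "\<lambda>f i. M (address f i)"
  have "wp sort_code Q ?R ?G 0"
  proof (rule wp_sort[where xs = xs and F = F and \<sigma> = \<sigma> and \<pi> = \<pi>])
    show "length xs = N" "distinct xs" using xs by (auto simp: N_def)
    show "linked_list xs e M (M (?R 1 + x)) (symbols (F (xs ! x)))" if "x < N" for x
      using in'(7)[OF that] by simp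
    show "?R 1 + N \<le> e" "e < 2 ^ w" "?R 0 = N" "?R 2 = e" using in' by auto
    show "N + 1 + 2 * N + 2 * (\<Sum>x<N. length (symbols (F (xs ! x)))) \<le> L"
      using Nn by (simp add: L_def flip: n_sum)
    show "bij_betw \<sigma> {..<N} {..<N}" "length \<pi> = N" by fact+
    show "xs ! \<sigma> i = \<pi> ! i" "rk (\<sigma> i) = i" "holds (F (\<pi> ! i)) (set (take i \<pi>))" if "i < N" for i
      using \<sigma> rk\<sigma> holds that by blast+
    fix R' :: "nat \<Rightarrow> nat" and G' :: "nat \<Rightarrow> nat \<Rightarrow> nat" and u :: nat and hi lo ks :: "nat \<Rightarrow> nat"
    assume *: "R' 0 = e" "\<And>i. i < N \<Longrightarrow> G' 0 i = \<sigma> i"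
      "\<And>i. i < N \<Longrightarrow> hi i \<le> N \<and> 2 ^ ks i \<le> hi i - lo i"
      "\<And>i. i < N \<Longrightarrow> holds (F (\<pi> ! i)) {\<pi> ! i' | i'. i' < N \<and> hi i' \<le> lo i}"
      "u \<le> 0 + 5000 + 8000 * N + 5000 * (\<Sum>x<N. length (symbols (F (xs ! x)))) + 500 * (\<Sum>i<N. ks i)"
    have "real (\<Sum>i<N. ks i) \<le> 2 * real N + log 2 (real (card (permutations_in \<Sigma> A)))"
      by (rule log_volume[OF \<Sigma> rep \<pi> len *(3,4)])
    thus "Q R' G' u" unfolding Q_def using *(1,2,5) by (intro conjI exI[of _ ks]) (auto simp: n_sum)
  qed
  then obtain R' G' u where ex: "exec sort_code ?R ?G 0 R' G' u" and Q: "Q R' G' u"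
    unfolding wp_def by blast
  obtain ks :: "nat \<Rightarrow> nat" where ks: "R' 0 = e" "\<forall>i<N. G' 0 i = \<sigma> i"
    "real (\<Sum>i<N. ks i) \<le> 2 * real N + log 2 (real (card (permutations_in \<Sigma> A)))"
    "u \<le> 5000 + 8000 * N + 5000 * n + 500 * (\<Sum>i<N. ks i)"
    using Q unfolding Q_def by blast
  have eN: "e + N < 2 ^ w" using room by (simp add: L_def)
  have "simulates ?R ?G ?R M"
    unfolding simulates_def using in' eN by auto
  moreover have "code_at sort_program 1 (code 1 sort_code)"
    unfolding sort_program_def by (rule code_at_Cons_rest)
  moreover have "8 < e + 100 * (1 + n)" by simp
  hence "8 < (2::nat) ^ w" using in'(6) by (rule less_le_trans)
  ultimately obtain v R\<^sub>1 M\<^sub>1 where v: "0 + v \<le> u"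
    "run w ?orc sort_program v (State 1 ?R M) = State (1 + code_length sort_code) R\<^sub>1 M\<^sub>1"
    "simulates R' G' R\<^sub>1 M\<^sub>1"
    using exec_code[OF ex room(1) _ wf_sort_code] by blast
  have "step w ?orc sort_program s = State 1 ?R M"
    unfolding s_eq sort_program_def step_def halted_def using in' eN by simp
  hence run: "run' \<pi> (Suc v) s = State (1 + code_length sort_code) R\<^sub>1 M\<^sub>1"
    using v(2) by (simp add: run'_def run_Suc')
  \<comment> \<open>The terms in \<open>N\<close>, including \<open>1000 * N\<close> from the bound
    on the sum of the levels, are absorbed by \<open>N \<le> n\<close>; the constant is not
    tight.\<close>
  have "real (Suc v) \<le> 30000 * (1 + real n + log 2 (real (card (permutations_in \<Sigma> A))))"
  proof -
    have "card (permutations_in \<Sigma> A) > 0" using \<pi> finite_permutations_in[OF \<Sigma>, of A] card_gt_0_iff by blast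
    hence l0: "log 2 (real (card (permutations_in \<Sigma> A))) \<ge> 0" by simp
    define z where "z = (\<Sum>i<N. ks i)"
    have "v \<le> 5000 + 8000 * N + 5000 * n + 500 * z" using v(1) ks(4) unfolding z_def by linarith
    hence "real v \<le> real (5000 + 8000 * N + 5000 * n + 500 * z)" by (simp only: of_nat_le_iff)
    hence "real v \<le> 5000 + 8000 * real N + 5000 * real n + 500 * real z" by simp
    moreover have "real N \<le> real n" using Nn by simp
    moreover have "real z \<le> 2 * real N + log 2 (real (card (permutations_in \<Sigma> A)))"
      using ks(3) unfolding z_def .
    moreover have "real (Suc v) = real v + 1" by simp
    ultimately show ?thesis using l0 unfolding distrib_left by linarith
  qed
  moreover have "halted sort_program (run' \<pi> (Suc v) s)"
    unfolding run by (simp add: halted_def sort_program_def length_code)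
  moreover have "outputs w xs \<pi> (run' \<pi> (Suc v) s)"
  proof -
    have "R\<^sub>1 0 = e" using v(3) ks(1) by (simp add: simulates_def)
    moreover have "M\<^sub>1 (e + i) = \<sigma> i" if "i < N" for i
    proof -
      have "M\<^sub>1 (address 0 i) = G' 0 i" using v(3) that by (simp add: simulates_def cell_def)
      thus ?thesis using ks(2) that by (simp add: address_def)
    qed
    ultimately show ?thesis unfolding run outputs_def using len \<sigma> eN by (auto simp: N_def)
  qed
  ultimately show ?thesis by blast
qed

text \<open>The summand 1 covers the empty alphabet, where the input length and the logarithm are
  both 0. Optimality holds for arbitrary programs and start states because the adversary uses only
  that equal configurations with equal answers have equal successors.\<close>

theorem theorem6:
  shows
    "(\<exists>(P :: instr list) (C :: real) (K :: nat).
       \<forall>(\<Sigma> :: nat set) (A :: nat list set) (F :: nat \<Rightarrow> nat formula) (\<pi> :: nat list)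
        (xs :: nat list) (w :: nat) (s :: state).
         finite \<Sigma> \<and> full_antimatroid \<Sigma> A \<and> precedence_representation \<Sigma> F A \<and>
         \<pi> \<in> permutations_in \<Sigma> A \<and>
         distinct xs \<and> set xs = \<Sigma> \<and>
         input_state w (K * (1 + representation_length \<Sigma> F)) xs F s \<longrightarrow>
         (\<exists>t. real t \<le> C * (1 + real (representation_length \<Sigma> F)
                               + log 2 (real (card (permutations_in \<Sigma> A)))) \<and>
              halted P (run w (comparison_oracle xs \<pi>) P t s) \<and>
              outputs w xs \<pi> (run w (comparison_oracle xs \<pi>) P t s)))
     \<and>
     (\<forall>(P :: instr list) (\<Sigma> :: nat set) (A :: nat list set) (xs :: nat list) (w :: nat) (s :: state).
       finite \<Sigma> \<and> full_antimatroid \<Sigma> A \<and> distinct xs \<and> set xs = \<Sigma> \<and>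
       (\<forall>\<pi>\<in>permutations_in \<Sigma> A. \<exists>t.
          halted P (run w (comparison_oracle xs \<pi>) P t s) \<and>
          outputs w xs \<pi> (run w (comparison_oracle xs \<pi>) P t s)) \<longrightarrow>
       (\<exists>\<pi>\<in>permutations_in \<Sigma> A. \<exists>t.
          halted P (run w (comparison_oracle xs \<pi>) P t s) \<and>
          log 2 (real (card (permutations_in \<Sigma> A)))
            \<le> real (comparisons w (comparison_oracle xs \<pi>) P t s)))"
proof (rule conjI, goal_cases)
  case 1
  show ?case
  proof (rule exI[of _ sort_program], rule exI[of _ 30000], rule exI[of _ 100], intro allI impI, goal_cases)
    case (1 \<Sigma> A F \<pi> xs w s)
    then show ?case using sort_program_correct[of \<Sigma> F A \<pi> xs w s] by blast
  qed
next
  case 2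
  show ?case
  proof (intro allI impI, goal_cases)
    case (1 P \<Sigma> A xs w s)
    then show ?case using comparison_lower_bound[of \<Sigma> A xs P w s] by blast
  qed
qed

end
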